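(* Let $N\ge 1$, $R>0$, $0<p<1$, and assume that, for some $M>0$ and $A>0$, $u\in H^1(B_{2R})$ satisfies (in the weak sense) $$\begin{cases}-\Delta u\le -M u^p & \text{in } B_{2R},\\ u\ge 0 & \text{in } B_{2R},\\ u\le A & \text{on }\partial B_{2R}.\end{cases}$$ If $$M\ge \frac{(1+p)\,2^{N(1-p)+p}}{(1-p)^2}\cdot\frac{A^{1-p}}{R^2},$$ then $u\equiv 0$ in $B_R$.
   Context: $B_r$ denotes the open ball in $\mathbb{R}^N$ of radius $r$ centered at the origin. The differential inequality is meant weakly: $\int_{B_{2R}}\nabla u\cdot\nabla\varphi\le -M\int_{B_{2R}}u^p\varphi$ for every nonnegative $\varphi\in H^1_0(B_{2R})$. The inequality $u\ge0$ is meant a.e., and $u\le A$ on $\partial B_{2R}$ is meant in the sense of traces, i.e. $(u-A)^+\in H^1_0(B_{2R})$. *)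

theory Defs
  imports "HOL-Analysis.Analysis"
begin

text \<open>
  Elements of the function spaces below are represented by total functions on the ambient space;
  only their values on \<open>\<Omega>\<close>, up to a Lebesgue null set, are relevant.
\<close>

definition L2 :: "'a::euclidean_space set \<Rightarrow> ('a \<Rightarrow> 'b::euclidean_space) set" where
  "L2 \<Omega> = {f \<in> borel_measurable (lebesgue_on \<Omega>). integrable (lebesgue_on \<Omega>) (\<lambda>x. (norm (f x))\<^sup>2)}"

definition L1_loc :: "'a::euclidean_space set \<Rightarrow> ('a \<Rightarrow> 'b::euclidean_space) set" where
  "L1_loc \<Omega> = {f. \<forall>K. compact K \<and> K \<subseteq> \<Omega> \<longrightarrow> set_integrable lebesgue K f}"

primrec Ck :: "nat \<Rightarrow> ('a::euclidean_space \<Rightarrow> real) \<Rightarrow> bool" where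
  "Ck 0 f \<longleftrightarrow> continuous_on UNIV f"
| "Ck (Suc k) f \<longleftrightarrow> (\<forall>x. f differentiable (at x)) \<and>
     (\<forall>b\<in>Basis. Ck k (\<lambda>x. frechet_derivative f (at x) b))"

definition test_functions :: "'a::euclidean_space set \<Rightarrow> ('a \<Rightarrow> real) set" where
  "test_functions \<Omega> = {\<phi>. (\<forall>k. Ck k \<phi>) \<and>
     compact (closure {x. \<phi> x \<noteq> 0}) \<and> closure {x. \<phi> x \<noteq> 0} \<subseteq> \<Omega>}"

definition grad :: "('a::euclidean_space \<Rightarrow> real) \<Rightarrow> 'a \<Rightarrow> 'a" where
  "grad f x = (\<Sum>b\<in>Basis. frechet_derivative f (at x) b *\<^sub>R b)"

text \<open>
  Local integrability is part of the definition: the Bochner integral of a non-integrable function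
  is 0, so the integral identity alone would be satisfied by spurious functions.  The weak gradient
  on an open set is unique up to a null set, so it is handled as a relation.
\<close>

definition weak_gradient :: "'a::euclidean_space set \<Rightarrow> ('a \<Rightarrow> real) \<Rightarrow> ('a \<Rightarrow> 'a) \<Rightarrow> bool" where
  "weak_gradient \<Omega> u Du \<longleftrightarrow> u \<in> L1_loc \<Omega> \<and> Du \<in> L1_loc \<Omega> \<and>
     (\<forall>\<phi>\<in>test_functions \<Omega>. \<forall>b\<in>Basis.
        (LINT x|lebesgue_on \<Omega>. u x * (grad \<phi> x \<bullet> b)) = - (LINT x|lebesgue_on \<Omega>. (Du x \<bullet> b) * \<phi> x))"

definition H1 :: "'a::euclidean_space set \<Rightarrow> ('a \<Rightarrow> real) set" where
  "H1 \<Omega> = {u \<in> L2 \<Omega>. \<exists>Du \<in> L2 \<Omega>. weak_gradient \<Omega> u Du}"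

text \<open>The closure of the test functions in the norm of \<open>H1 \<Omega>\<close>.\<close>

definition H10 :: "'a::euclidean_space set \<Rightarrow> ('a \<Rightarrow> real) set" where
  "H10 \<Omega> = {u \<in> L2 \<Omega>. \<exists>Du \<in> L2 \<Omega>. weak_gradient \<Omega> u Du \<and>
     (\<exists>\<phi>. (\<forall>n::nat. \<phi> n \<in> test_functions \<Omega>) \<and>
        (\<lambda>n. (LINT x|lebesgue_on \<Omega>. (\<phi> n x - u x)\<^sup>2)
           + (LINT x|lebesgue_on \<Omega>. (norm (grad (\<phi> n) x - Du x))\<^sup>2)) \<longlonglongrightarrow> 0)}"

text \<open>The weak form of \<open>- \<Delta> u \<le> - M u\<^sup>p\<close> in \<open>\<Omega>\<close>.\<close>

definition weak_subsolution :: "'a::euclidean_space set \<Rightarrow> real \<Rightarrow> real \<Rightarrow> ('a \<Rightarrow> real) \<Rightarrow> bool" where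
  "weak_subsolution \<Omega> M p u \<longleftrightarrow>
     (\<forall>Du \<phi> D\<phi>. weak_gradient \<Omega> u Du \<and> \<phi> \<in> H10 \<Omega> \<and> (AE x in lebesgue_on \<Omega>. 0 \<le> \<phi> x) \<and>
        weak_gradient \<Omega> \<phi> D\<phi> \<longrightarrow>
        (LINT x|lebesgue_on \<Omega>. Du x \<bullet> D\<phi> x) \<le> - M * (LINT x|lebesgue_on \<Omega>. u x powr p * \<phi> x))"

end

theory Submission
  imports Defs
begin

text \<open>
  Put \<open>q = 1 / (1 - p)\<close> and \<open>c = A / R\<^bsup>2q\<^esup>\<close>.  For \<open>a\<close> in the ball of radius \<open>R\<close> and \<open>\<delta> > 0\<close>
  the smooth function \<open>w x = c (\<bar>x - a\<bar>\<^sup>2 + \<delta>)\<^bsup>q\<^esup>\<close> satisfies \<open>\<Delta>w \<le> M w\<^bsup>p\<^esup>\<close>: the coefficient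
  produced by \<open>\<Delta>\<close> is \<open>(4p + 2N(1 - p)) / (1 - p)\<^sup>2\<close>, and \<open>4p + 2N(1 - p) \<le> (1 + p) 2\<^bsup>N(1 - p) + p\<^esup>\<close>.
  Testing with \<open>(u - A)\<^sup>+\<close> gives \<open>u \<le> A\<close>, and \<open>w > A\<close> off the closed ball of radius \<open>R\<close> around \<open>a\<close>,
  which is a compact subset of the domain.  So \<open>(u - w)\<^sup>+\<close> is compactly supported and, after mollification,
  can be used as a test function, whence \<open>u \<le> w\<close>.  Letting \<open>\<delta>\<close> tend to 0 and \<open>a\<close> run through a countable
  dense set gives \<open>u = 0\<close>.
\<close>

subsection \<open>Smooth bump functions\<close>

text \<open>With \<open>\<delta> = 0\<close> the barrier is a multiple of the dead-core profile
  \<open>|x - a|\<close> to the power \<open>2q\<close>: its Laplacian is a constant times its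
  \<open>p\<close>-th power, and it vanishes at \<open>a\<close>. The choice of \<open>c\<close>
  makes it equal to \<open>A\<close> on the sphere of radius \<open>R\<close> about
  \<open>a\<close>, which lies inside the domain because \<open>a\<close> has norm below
  \<open>R\<close>. The parameter \<open>\<delta>\<close> keeps the base of the power positive, so
  that the derivative formulas hold at \<open>a\<close> too, and makes \<open>w > A\<close> strict
  outside the closed ball. The comparison works because \<open>t\<close> to the power
  \<open>p\<close> is increasing: after subtraction, the gradient term and the reaction term have
  opposite signs. The difficulty is to make positive parts admissible. For \<open>(u - A)\<close>
  this is the boundary hypothesis, but its weak gradient must still be identified; for
  \<open>(u - w)\<close> compact support lets mollification produce genuine test functions. Both
  need the weak chain rule for the positive part, hence the work on convolutions in L2. Each bound
  \<open>u \<le> w\<close> holds only off a null set depending on \<open>a\<close> and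
  \<open>\<delta>\<close>, so it cannot be evaluated at \<open>x = a\<close>; centres close to
  \<open>x\<close> from a countable set replace this.\<close>

lemma frechet_derivative_eqI:
  "(f has_derivative f') (at x) \<Longrightarrow> frechet_derivative f (at x) = f'"
  by (metis frechet_derivative_at)

text \<open>\<open>Ck\<close> is phrased with \<open>frechet_derivative\<close>, a choice operator;
  uniqueness of the derivative lets an explicit formula take its place.\<close>

lemma Ck_SucI:
  assumes "\<And>x. (f has_derivative f' x) (at x)"
    and "\<And>b. b \<in> Basis \<Longrightarrow> Ck k (\<lambda>x. f' x b)"
  shows "Ck (Suc k) f"
proof -
  have "frechet_derivative f (at x) = f' x" for x
    by (rule frechet_derivative_eqI[OF assms(1)])
  then show ?thesis
    using assms by (auto simp: differentiable_def)
qed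

lemma Ck_mono: "Ck (Suc k) f \<Longrightarrow> Ck k f"
proof (induction k arbitrary: f)
  case 0
  then show ?case
    by (auto intro!: continuous_at_imp_continuous_on differentiable_imp_continuous_within)
next
  case (Suc k)
  then show ?case by (metis Ck.simps(2))
qed

lemma Ck_const: "Ck k (\<lambda>x. c)"
proof (induction k arbitrary: c)
  case (Suc k)
  then show ?case by (intro Ck_SucI[where f' = "\<lambda>x h. 0"]) auto
qed simp

lemma Ck_add: "Ck k f \<Longrightarrow> Ck k g \<Longrightarrow> Ck k (\<lambda>x. f x + g x)"
proof (induction k arbitrary: f g)
  case (Suc k)
  have "(f has_derivative frechet_derivative f (at x)) (at x)"
       "(g has_derivative frechet_derivative g (at x)) (at x)" for x
    using Suc.prems by (auto simp: frechet_derivative_works)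
  then show ?case using Suc
    by (intro Ck_SucI[where f' = "\<lambda>x h. frechet_derivative f (at x) h + frechet_derivative g (at x) h"]
        has_derivative_add) auto
qed (auto intro: continuous_on_add)

lemma Ck_mult: "Ck k f \<Longrightarrow> Ck k g \<Longrightarrow> Ck k (\<lambda>x. f x * g x)"
proof (induction k arbitrary: f g)
  case (Suc k)
  have "(f has_derivative frechet_derivative f (at x)) (at x)"
       "(g has_derivative frechet_derivative g (at x)) (at x)" for x
    using Suc.prems by (auto simp: frechet_derivative_works)
  moreover have "Ck k f" "Ck k g" using Suc.prems Ck_mono by auto
  ultimately show ?case using Suc
    by (intro Ck_SucI[where f' = "\<lambda>x h. f x * frechet_derivative g (at x) h + frechet_derivative f (at x) h * g x"]
        has_derivative_mult Ck_add) auto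
qed (auto intro: continuous_on_mult)

lemma Ck_inner: "Ck k (\<lambda>x. (x - a) \<bullet> b)"
proof (cases k)
  case (Suc n)
  show ?thesis
    unfolding Suc by (rule Ck_SucI[where f' = "\<lambda>x h. h \<bullet> b"])
      (auto intro!: derivative_eq_intros Ck_const)
qed (auto intro!: continuous_intros)

text \<open>The case \<open>m = 0\<close> is the standard flat function. The powers in the
  denominator are those that differentiation produces, so linear combinations of the family are
  closed under it.\<close>

definition exp_recip :: "nat \<Rightarrow> real \<Rightarrow> real" where
  "exp_recip m t = (if t > 0 then exp (- 1 / t) / t ^ m else 0)"

lemma exp_recip_nonneg: "0 \<le> exp_recip m t"
  by (auto simp: exp_recip_def)

text \<open>From the right, \<open>x = 1 / t\<close> turns the claim into the decay of
  \<open>x ^ m / exp x\<close> at infinity; from the left the function is constantly 0.\<close>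

lemma exp_recip_tendsto_0: "exp_recip m \<midarrow>0\<rightarrow> 0"
proof -
  have "((\<lambda>x. x ^ m / exp x) \<longlongrightarrow> (0::real)) at_top"
    by (rule tendsto_power_div_exp_0)
  then have "((\<lambda>t. inverse t ^ m / exp (inverse t)) \<longlongrightarrow> (0::real)) (at_right 0)"
    by (rule filterlim_compose[OF _ filterlim_inverse_at_top_right])
  moreover have "\<forall>\<^sub>F t in at_right 0. inverse t ^ m / exp (inverse t) = exp_recip m t"
    by (rule eventually_at_rightI[of 0 1])
       (auto simp: exp_recip_def field_simps exp_minus power_divide)
  ultimately have "(exp_recip m \<longlongrightarrow> 0) (at_right 0)"
    by (rule Lim_transform_eventually)
  moreover have "(exp_recip m \<longlongrightarrow> 0) (at_left 0)"
    by (rule Lim_transform_eventually[OF tendsto_const], rule eventually_at_leftI[of "-1"])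
       (auto simp: exp_recip_def)
  ultimately show ?thesis by (simp add: filterlim_split_at)
qed

text \<open>Away from 0 this is elementary calculus. At 0 the difference quotient of member
  \<open>m\<close> is member \<open>m + 1\<close>, which tends to 0, and the right-hand side is 0
  there too.\<close>

lemma exp_recip_deriv:
  "(exp_recip m has_field_derivative exp_recip (m + 2) t - real m * exp_recip (m + 1) t) (at t)"
proof -
  consider "t > 0" | "t < 0" | "t = 0" by linarith
  then show ?thesis
  proof cases
    case 1
    have pow: "((\<lambda>t. t ^ m) has_field_derivative real m * t ^ (m - 1)) (at t)"
      using DERIV_pow[of m t] by simp
    have exp: "((\<lambda>t. exp (- 1 / t)) has_field_derivative exp (- 1 / t) / t\<^sup>2) (at t)"
      using 1 by (auto intro!: derivative_eq_intros simp: power2_eq_square)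
    have "(exp (- 1 / t) / t\<^sup>2 * t ^ m - exp (- 1 / t) * (real m * t ^ (m - 1))) / (t ^ m * t ^ m)
        = exp_recip (m + 2) t - real m * exp_recip (m + 1) t"
      using 1 by (cases m) (auto simp: exp_recip_def field_simps power2_eq_square)
    with DERIV_divide[OF exp pow] have "((\<lambda>t. exp (- 1 / t) / t ^ m) has_field_derivative
        exp_recip (m + 2) t - real m * exp_recip (m + 1) t) (at t)"
      using 1 by simp
    then show ?thesis
      by (rule has_field_derivative_transform_within_open[of _ _ _ "{0<..}"])
         (use 1 in \<open>auto simp: exp_recip_def\<close>)
  next
    case 2
    have "((\<lambda>t. 0) has_field_derivative
        exp_recip (m + 2) t - real m * exp_recip (m + 1) t) (at t)"
      using 2 by (auto simp: exp_recip_def)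
    then show ?thesis
      by (rule has_field_derivative_transform_within_open[of _ _ _ "{..<0}"])
         (use 2 in \<open>auto simp: exp_recip_def\<close>)
  next
    case 3
    have "((\<lambda>h. (exp_recip m (0 + h) - exp_recip m 0) / h) \<longlongrightarrow> 0) (at 0)"
      by (rule Lim_transform_eventually[OF exp_recip_tendsto_0[of "Suc m"]])
         (auto simp: exp_recip_def eventually_at intro!: exI[of _ 1])
    then show ?thesis
      using 3 by (simp add: DERIV_def exp_recip_def)
  qed
qed

text \<open>The squared norm makes the inner function a polynomial, so the centre is no special
  point for smoothness.\<close>

definition bump :: "real \<Rightarrow> 'a::euclidean_space \<Rightarrow> real" where
  "bump r x = exp_recip 0 (r\<^sup>2 - x \<bullet> x)"

text \<open>Differentiation raises \<open>m\<close> and multiplies by an affine factor; hence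
  \<open>m\<close> must be arbitrary in the induction.\<close>

lemma Ck_exp_recip_quadratic:
  "Ck k (\<lambda>x::'a::euclidean_space. exp_recip m (r - (x - a) \<bullet> (x - a)))"
proof (induction k arbitrary: m)
  case 0
  have "continuous_on UNIV (exp_recip m)"
    using DERIV_isCont[OF exp_recip_deriv] by (simp add: continuous_at_imp_continuous_on)
  then show ?case
    by (auto intro!: continuous_on_compose2[of UNIV "exp_recip m"] continuous_intros)
next
  case (Suc k)
  let ?t = "\<lambda>x::'a. r - (x - a) \<bullet> (x - a)"
  let ?d = "\<lambda>x. exp_recip (m + 2) (?t x) - real m * exp_recip (m + 1) (?t x)"
  have "((\<lambda>x. exp_recip m (?t x)) has_derivative (\<lambda>h. ?d x * (- (2 * ((x - a) \<bullet> h))))) (at x)" for x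
  proof -
    have "(?t has_derivative (\<lambda>h. - (2 * ((x - a) \<bullet> h)))) (at x)"
      by (auto intro!: derivative_eq_intros simp: inner_commute)
    from has_derivative_compose[OF this exp_recip_deriv[of m "?t x", unfolded has_field_derivative_def]]
    show ?thesis by simp
  qed
  moreover have "Ck k (\<lambda>x. ?d x * (- (2 * ((x - a) \<bullet> b))))" for b
  proof -
    have "Ck k (\<lambda>x. (exp_recip (m + 2) (?t x) + (- real m) * exp_recip (m + 1) (?t x)) * (- 2 * ((x - a) \<bullet> b)))"
      by (intro Ck_mult Ck_add Ck_const Suc Ck_inner)
    then show ?thesis by (simp add: algebra_simps)
  qed
  ultimately show ?case by (rule Ck_SucI)
qed

lemma Ck_bump: "Ck k (\<lambda>y. bump r (x - y))"
  using Ck_exp_recip_quadratic[of k 0 "r\<^sup>2" x]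
  by (simp add: bump_def algebra_simps inner_commute)

lemma bump_eq_0: "r \<ge> 0 \<Longrightarrow> r \<le> norm x \<Longrightarrow> bump r x = 0"
  by (auto simp: bump_def exp_recip_def dot_square_norm power_mono not_less)

lemma bump_pos: "norm x < r \<Longrightarrow> 0 < bump r x"
  by (auto simp: bump_def exp_recip_def dot_square_norm power_strict_mono)

subsection \<open>Integration by parts\<close>

abbreviation pd :: "'a::euclidean_space \<Rightarrow> ('a \<Rightarrow> real) \<Rightarrow> 'a \<Rightarrow> real" where
  "pd b f x \<equiv> frechet_derivative f (at x) b"

lemma grad_inner_Basis: "b \<in> Basis \<Longrightarrow> grad f x \<bullet> b = pd b f x"
  by (simp add: grad_def)

lemma linear_sum_Basis:
  fixes F :: "'a::euclidean_space \<Rightarrow> real"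
  assumes "linear F"
  shows "F h = (\<Sum>b\<in>Basis. F b * (h \<bullet> b))"
proof -
  have "F h = F (\<Sum>b\<in>Basis. (h \<bullet> b) *\<^sub>R b)" by (simp add: euclidean_representation)
  also have "\<dots> = (\<Sum>b\<in>Basis. F b * (h \<bullet> b))"
    using assms by (simp add: linear_sum linear_cmul mult.commute)
  finally show ?thesis .
qed

lemma test_functionsI:
  assumes "\<And>k. Ck k f" "compact K" "K \<subseteq> S" "\<And>x. x \<notin> K \<Longrightarrow> f x = 0"
  shows "f \<in> test_functions S"
proof -
  have "closure {x. f x \<noteq> 0} \<subseteq> K"
    using assms by (intro closure_minimal) (auto intro: compact_imp_closed)
  then show ?thesis
    using assms closed_Int_compact[of "closure {x. f x \<noteq> 0}" K]
    by (auto simp: test_functions_def Int_absorb2)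
qed

lemma test_functionsE:
  assumes "f \<in> test_functions S"
  obtains K where "compact K" "K \<subseteq> S" "\<And>x. x \<notin> K \<Longrightarrow> f x = 0"
proof
  show "f x = 0" if "x \<notin> closure {x. f x \<noteq> 0}" for x
    using that closure_subset[of "{x. f x \<noteq> 0}"] by auto
qed (use assms in \<open>auto simp: test_functions_def\<close>)

lemma test_functions_Ck: "f \<in> test_functions S \<Longrightarrow> Ck k f"
  by (auto simp: test_functions_def)

lemma test_functions_continuous: "f \<in> test_functions S \<Longrightarrow> continuous_on T f"
  using test_functions_Ck[of f S 0] continuous_on_subset by auto

lemma test_functions_has_derivative:
  "f \<in> test_functions S \<Longrightarrow> (f has_derivative frechet_derivative f (at x)) (at x)"
  using test_functions_Ck[of f S 1] by (auto simp: frechet_derivative_works)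

lemma frechet_derivative_outside:
  assumes "closed K" "\<And>x. x \<notin> K \<Longrightarrow> f x = 0" "x \<notin> K"
  shows "frechet_derivative f (at x) = (\<lambda>h. 0)"
proof (rule frechet_derivative_eqI)
  show "(f has_derivative (\<lambda>h. 0)) (at x)"
    by (rule has_derivative_transform_within_open[of "\<lambda>x. 0" _ _ _ "- K"])
       (use assms in auto)
qed

lemma test_functions_pd:
  assumes "f \<in> test_functions S" "b \<in> Basis"
  shows "pd b f \<in> test_functions S"
proof -
  obtain K where K: "compact K" "K \<subseteq> S" "\<And>x. x \<notin> K \<Longrightarrow> f x = 0"
    using assms(1) by (rule test_functionsE) blast
  show ?thesis
  proof (rule test_functionsI[OF _ K(1,2)])
    show "Ck k (pd b f)" for k
      using test_functions_Ck[OF assms(1), of "Suc k"] assms(2) by auto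
    show "pd b f x = 0" if "x \<notin> K" for x
      using frechet_derivative_outside[of K f x] K that by (simp add: compact_imp_closed)
  qed
qed

lemma continuous_compact_support_bounded:
  fixes f :: "'a::euclidean_space \<Rightarrow> real"
  assumes "continuous_on UNIV f" "compact K" "\<And>x. x \<notin> K \<Longrightarrow> f x = 0"
  obtains B where "0 \<le> B" "\<And>x. \<bar>f x\<bar> \<le> B"
proof -
  have "bounded (f ` K)"
    using assms by (intro compact_imp_bounded compact_continuous_image) (auto intro: continuous_on_subset)
  then obtain B where "\<forall>x\<in>K. \<bar>f x\<bar> \<le> B" by (auto simp: bounded_iff)
  then have "\<bar>f x\<bar> \<le> max B 0" for x using assms(3)[of x] by (cases "x \<in> K") (force simp: max_def)+
  then show ?thesis by (intro that[of "max B 0"]) auto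
qed

lemma continuous_compact_support_integrable:
  fixes f :: "'a::euclidean_space \<Rightarrow> real"
  assumes "continuous_on UNIV f" "compact K" "\<And>x. x \<notin> K \<Longrightarrow> f x = 0"
  shows "integrable lborel f"
proof -
  have "integrable lborel (\<lambda>x. indicator K x *\<^sub>R f x)"
    using assms by (intro borel_integrable_compact) (auto intro: continuous_on_subset)
  moreover have "(\<lambda>x. indicator K x *\<^sub>R f x) = f"
    using assms(3) unfolding indicator_def fun_eq_iff by fastforce
  ultimately show ?thesis by simp
qed

lemma continuous_compact_support_uniform:
  fixes f :: "'a::euclidean_space \<Rightarrow> real"
  assumes f: "continuous_on UNIV f" and K: "compact K" "\<And>x. x \<notin> K \<Longrightarrow> f x = 0" and "e > 0"
  obtains d where "d > 0" "\<And>x y. norm (x - y) < d \<Longrightarrow> \<bar>f x - f y\<bar> < e"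
proof -
  obtain r where r: "K \<subseteq> cball 0 r"
    using bounded_subset_ballD[OF compact_imp_bounded[OF K(1)], of 0] ball_subset_cball by fastforce
  \<comment> \<open>The margin 1 ensures that if one of two points at distance below 1 lies in
    \<open>K\<close>, both lie in this ball; if neither does, \<open>f\<close> is 0 at both.\<close>
  have "uniformly_continuous_on (cball 0 (r + 1)) f"
    using f by (intro compact_uniformly_continuous) (auto intro: continuous_on_subset)
  then obtain d where d: "d > 0"
    "\<And>x y. x \<in> cball 0 (r+1) \<Longrightarrow> y \<in> cball 0 (r+1) \<Longrightarrow> dist x y < d \<Longrightarrow> \<bar>f x - f y\<bar> < e"
    using \<open>e > 0\<close> unfolding uniformly_continuous_on_def dist_real_def by metis
  show ?thesis
  proof (rule that[of "min d 1"])
    fix x y :: 'a assume xy: "norm (x - y) < min d 1"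
    have tri: "norm x \<le> norm y + norm (x - y)" "norm y \<le> norm x + norm (x - y)"
      using norm_triangle_ineq2[of x y] norm_triangle_ineq3[of x y] by auto
    show "\<bar>f x - f y\<bar> < e"
    proof (cases "x \<in> K \<or> y \<in> K")
      case True
      then have "norm x \<le> r \<or> norm y \<le> r" using r by auto
      then have "x \<in> cball 0 (r+1)" "y \<in> cball 0 (r+1)" using tri xy by auto
      then show ?thesis using d(2) xy by (auto simp: dist_norm)
    qed (use K(2) \<open>e > 0\<close> in auto)
  qed (use d in auto)
qed

lemma integral_lborel_shift:
  fixes f :: "'a::euclidean_space \<Rightarrow> real"
  assumes [measurable]: "f \<in> borel_measurable borel"
  shows "(\<integral>x. f (c + x) \<partial>lborel) = (\<integral>x. f x \<partial>lborel)"
proof -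
  have "(\<integral>x. f x \<partial>distr lborel borel ((+) c)) = (\<integral>x. f (c + x) \<partial>lborel)"
    by (rule integral_distr) auto
  then show ?thesis by (simp add: lborel_distr_plus)
qed

lemma integrable_lborel_shift:
  fixes f :: "'a::euclidean_space \<Rightarrow> real"
  assumes "integrable lborel f"
  shows "integrable lborel (\<lambda>x. f (c + x))"
proof -
  have [measurable]: "f \<in> borel_measurable borel" using assms by auto
  have "integrable (distr lborel borel ((+) c)) f" using assms by (simp add: lborel_distr_plus)
  then show ?thesis by (subst (asm) integrable_distr_eq) auto
qed

lemma mvt_direction:
  fixes f :: "'a::euclidean_space \<Rightarrow> real"
  assumes "\<And>x. (f has_derivative f' x) (at x)"
  obtains s where "0 < s" "s < 1" "f (x + h) - f x = f' (x + s *\<^sub>R h) h"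
proof -
  have "((\<lambda>s. f (x + s *\<^sub>R h)) has_derivative (\<lambda>t. f' (x + s *\<^sub>R h) (t *\<^sub>R h))) (at s within T)" for s T
    by (rule has_derivative_at_withinI, rule has_derivative_compose[of "\<lambda>s. x + s *\<^sub>R h", OF _ assms])
       (auto intro!: derivative_eq_intros)
  then obtain s where "s \<in> {0<..<1::real}" "f (x + 1 *\<^sub>R h) - f (x + 0 *\<^sub>R h) = f' (x + s *\<^sub>R h) ((1 - 0) *\<^sub>R h)"
    using mvt_simple[of 0 1 "\<lambda>s. f (x + s *\<^sub>R h)" "\<lambda>s t. f' (x + s *\<^sub>R h) (t *\<^sub>R h)"] by auto
  then show ?thesis by (intro that[of s]) auto
qed

text \<open>Translation invariance annihilates the integrals of the difference quotients of \<open>f\<close>,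
  which converge boundedly to the directional derivative.\<close>

lemma integral_derivative_eq_0:
  fixes f :: "'a::euclidean_space \<Rightarrow> real"
  assumes f': "\<And>x. (f has_derivative f' x) (at x)" and cont: "continuous_on UNIV (\<lambda>x. f' x b)"
    and K: "compact K" "\<And>x. x \<notin> K \<Longrightarrow> f x = 0"
  shows "(\<integral>x. f' x b \<partial>lborel) = 0"
proof -
  have contf: "continuous_on UNIV f"
    by (intro continuous_at_imp_continuous_on ballI has_derivative_continuous[OF f'])
  have out: "f' x b = 0" if "x \<notin> K" for x
    using frechet_derivative_outside[of K f x] frechet_derivative_eqI[OF f'[of x]] K that
    by (simp add: compact_imp_closed)
  obtain C where C: "0 \<le> C" "\<And>x. \<bar>f' x b\<bar> \<le> C"
    by (rule continuous_compact_support_bounded[OF cont K(1) out], assumption, rule that)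
  obtain r where r: "K \<subseteq> cball 0 r"
    using bounded_subset_ballD[OF compact_imp_bounded[OF K(1)], of 0] ball_subset_cball by fastforce
  have int: "integrable lborel f" by (rule continuous_compact_support_integrable[OF contf K])
  define t where "t n = inverse (real (Suc n))" for n
  define q where "q n x = (f (t n *\<^sub>R b + x) - f x) / t n" for n x
  have t: "0 < t n" "t n \<le> 1" for n by (auto simp: t_def field_simps)
  have [measurable]: "f \<in> borel_measurable borel" using contf by (rule borel_measurable_continuous_onI)
  have [measurable]: "(\<lambda>x. f' x b) \<in> borel_measurable borel" using cont by (rule borel_measurable_continuous_onI)
  have q0: "(\<integral>x. q n x \<partial>lborel) = 0" for n
    unfolding q_def using int integrable_lborel_shift[OF int, of "t n *\<^sub>R b"]
    by (simp add: integral_lborel_shift)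
  \<comment> \<open>The mean value theorem bounds every quotient by \<open>C\<close>, and since
    \<open>t n \<le> 1\<close> the quotients vanish outside the ball of radius
    \<open>r + norm b\<close>; this gives the dominating function.\<close>
  have "(\<lambda>n. \<integral>x. q n x \<partial>lborel) \<longlonglongrightarrow> (\<integral>x. f' x b \<partial>lborel)"
  proof (rule integral_dominated_convergence)
    show "integrable lborel (\<lambda>x::'a. indicator (cball 0 (r + norm b)) x * C :: real)"
      using emeasure_bounded_finite[of "cball (0::'a) (r + norm b)"]
      by (intro integrable_mult_left integrable_real_indicator) simp_all
    show "AE x in lborel. (\<lambda>n. q n x) \<longlonglongrightarrow> f' x b"
    proof (rule AE_I2)
      fix x
      have lin: "linear (f' x)" using f' has_derivative_linear by blast
      have "((\<lambda>s. f (x + s *\<^sub>R b)) has_derivative (\<lambda>s. f' (x + 0 *\<^sub>R b) (s *\<^sub>R b))) (at 0)"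
        by (rule has_derivative_compose[of "\<lambda>s. x + s *\<^sub>R b", OF _ f'])
           (auto intro!: derivative_eq_intros)
      then have "((\<lambda>s. f (x + s *\<^sub>R b)) has_field_derivative f' x b) (at 0)"
        using lin by (simp add: has_field_derivative_def linear_cmul mult_commute_abs)
      then have "((\<lambda>h. (f (x + h *\<^sub>R b) - f x) / h) \<longlongrightarrow> f' x b) (at 0)"
        by (simp add: DERIV_def)
      moreover have "filterlim t (at 0) sequentially"
        unfolding t_def by (rule filterlim_atI[OF LIMSEQ_inverse_real_of_nat]) auto
      ultimately have "(\<lambda>n. (f (x + t n *\<^sub>R b) - f x) / t n) \<longlonglongrightarrow> f' x b"
        by (rule filterlim_compose)
      then show "(\<lambda>n. q n x) \<longlonglongrightarrow> f' x b" by (simp add: q_def add.commute)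
    qed
    show "AE x in lborel. norm (q n x) \<le> indicator (cball 0 (r + norm b)) x * C" for n
    proof (rule AE_I2)
      fix x
      obtain s where s: "f (x + t n *\<^sub>R b) - f x = f' (x + s *\<^sub>R (t n *\<^sub>R b)) (t n *\<^sub>R b)"
        using mvt_direction[OF f', of x "t n *\<^sub>R b"] by metis
      have "linear (f' (x + s *\<^sub>R (t n *\<^sub>R b)))" using f' has_derivative_linear by blast
      then have q: "q n x = f' (x + s *\<^sub>R (t n *\<^sub>R b)) b"
        using s t[of n] by (simp add: q_def linear_cmul add.commute)
      show "norm (q n x) \<le> indicator (cball 0 (r + norm b)) x * C"
      proof (cases "x \<in> cball 0 (r + norm b)")
        case False
        have "norm x \<le> norm (t n *\<^sub>R b + x) + t n * norm b"
          using norm_triangle_ineq4[of "t n *\<^sub>R b + x" "t n *\<^sub>R b"] t(1)[of n] by simp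
        moreover have "t n * norm b \<le> norm b" using t[of n] by (simp add: mult_left_le_one_le)
        ultimately have "t n *\<^sub>R b + x \<notin> cball 0 r" "x \<notin> cball 0 r"
          using False by auto (smt (verit) norm_ge_zero)
        then have "t n *\<^sub>R b + x \<notin> K" "x \<notin> K" using r by auto
        then show ?thesis using K(2) by (simp add: q_def C)
      qed (use q C in simp)
    qed
  qed (auto simp: q_def)
  then show ?thesis using q0 by (simp add: LIMSEQ_const_iff)
qed

text \<open>The two integrands add up to a directional derivative of \<open>f * g\<close>, which
  inherits compact support from \<open>g\<close>. So \<open>f\<close> may be a globally smooth
  function without decay, such as a derivative of the barrier.\<close>

lemma integral_by_parts:
  fixes f g :: "'a::euclidean_space \<Rightarrow> real"
  assumes f: "\<And>x. (f has_derivative f' x) (at x)" "continuous_on UNIV (\<lambda>x. f' x b)"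
    and g: "\<And>x. (g has_derivative g' x) (at x)" "continuous_on UNIV (\<lambda>x. g' x b)"
    and K: "compact K" "\<And>x. x \<notin> K \<Longrightarrow> g x = 0"
  shows "(\<integral>x. f x * g' x b \<partial>lborel) = - (\<integral>x. f' x b * g x \<partial>lborel)"
proof -
  have c: "continuous_on UNIV f" "continuous_on UNIV g"
    by (intro continuous_at_imp_continuous_on ballI has_derivative_continuous[OF f(1)]
        has_derivative_continuous[OF g(1)])+
  have out: "g' x b = 0" if "x \<notin> K" for x
    using frechet_derivative_outside[of K g x] frechet_derivative_eqI[OF g(1)[of x]] K that
    by (simp add: compact_imp_closed)
  have c1: "continuous_on UNIV (\<lambda>x. f x * g' x b)"
    by (rule continuous_on_mult[OF c(1) g(2)])
  have c2: "continuous_on UNIV (\<lambda>x. f' x b * g x)"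
    by (rule continuous_on_mult[OF f(2) c(2)])
  have "(\<integral>x. f x * g' x b + f' x b * g x \<partial>lborel) = 0"
    by (rule integral_derivative_eq_0[OF has_derivative_mult[OF f(1) g(1)] continuous_on_add[OF c1 c2] K(1)])
       (simp add: K(2))
  moreover have "integrable lborel (\<lambda>x. f x * g' x b)"
    by (rule continuous_compact_support_integrable[OF c1 K(1)]) (simp add: out)
  moreover have "integrable lborel (\<lambda>x. f' x b * g x)"
    by (rule continuous_compact_support_integrable[OF c2 K(1)]) (simp add: K(2))
  ultimately show ?thesis by simp
qed

subsection \<open>Mollification\<close>

definition conv :: "('a::euclidean_space \<Rightarrow> real) \<Rightarrow> ('a \<Rightarrow> real) \<Rightarrow> 'a \<Rightarrow> real" where
  "conv f g x = (\<integral>y. f y * g (x - y) \<partial>lborel)"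

lemma test_functions_bounded:
  assumes "f \<in> test_functions S"
  obtains B where "0 \<le> B" "\<And>x. \<bar>f x\<bar> \<le> B"
proof -
  obtain K where "compact K" "\<And>x. x \<notin> K \<Longrightarrow> f x = 0"
    using assms by (rule test_functionsE) blast
  then show ?thesis
    using continuous_compact_support_bounded[OF test_functions_continuous[OF assms]] that by metis
qed

lemma test_functions_measurable: "f \<in> test_functions S \<Longrightarrow> f \<in> borel_measurable borel"
  by (rule borel_measurable_continuous_onI[OF test_functions_continuous])

lemma test_functions_integrable:
  assumes "f \<in> test_functions S"
  shows "integrable lborel f"
proof -
  obtain K where "compact K" "\<And>x. x \<notin> K \<Longrightarrow> f x = 0"
    using assms by (rule test_functionsE) blast
  then show ?thesis
    by (rule continuous_compact_support_integrable[OF test_functions_continuous[OF assms]])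
qed

lemma integrable_mult_bounded:
  fixes f g :: "'a \<Rightarrow> real"
  assumes "integrable M f" "g \<in> borel_measurable M" "\<And>x. \<bar>g x\<bar> \<le> B"
  shows "integrable M (\<lambda>x. f x * g x)"
proof (rule Bochner_Integration.integrable_bound)
  show "integrable M (\<lambda>x. B * f x)" using assms by auto
  show "AE x in M. norm (f x * g x) \<le> norm (B * f x)"
  proof (rule AE_I2)
    fix x
    have "\<bar>f x\<bar> * \<bar>g x\<bar> \<le> \<bar>f x\<bar> * \<bar>B\<bar>" using assms(3)[of x] by (intro mult_left_mono) auto
    then show "norm (f x * g x) \<le> norm (B * f x)" by (simp add: abs_mult mult.commute)
  qed
qed (use assms in auto)

lemma conv_integrable:
  assumes "integrable lborel f" "g \<in> test_functions UNIV"
  shows "integrable lborel (\<lambda>y. f y * g (x - y))"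
proof -
  obtain B where "\<And>x. \<bar>g x\<bar> \<le> B" using test_functions_bounded[OF assms(2)] by blast
  moreover have [measurable]: "g \<in> borel_measurable borel"
    using assms(2) by (rule test_functions_measurable)
  ultimately show ?thesis by (intro integrable_mult_bounded[OF assms(1)]) auto
qed

text \<open>The mean value theorem turns the error into differences of partial derivatives, which
  are uniformly continuous by compact support. Uniformity in \<open>x\<close> is what
  differentiation under the integral sign requires.\<close>

lemma test_functions_uniformly_differentiable:
  fixes f :: "'a::euclidean_space \<Rightarrow> real"
  assumes f: "f \<in> test_functions UNIV" and "e > 0"
  obtains d where "d > 0"
    "\<And>x h. norm h < d \<Longrightarrow> \<bar>f (x + h) - f x - (\<Sum>b\<in>Basis. pd b f x * (h \<bullet> b))\<bar> \<le> e * norm h"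
proof -
  define e' where "e' = e / DIM('a)"
  have "e' > 0" using \<open>e > 0\<close> by (simp add: e'_def)
  have "\<exists>d>0. \<forall>x y. norm (x - y) < d \<longrightarrow> \<bar>pd b f x - pd b f y\<bar> < e'" if b: "b \<in> Basis" for b
  proof -
    have p: "pd b f \<in> test_functions UNIV" using f b by (rule test_functions_pd)
    obtain K where "compact K" "\<And>x. x \<notin> K \<Longrightarrow> pd b f x = 0"
      using p by (rule test_functionsE) blast
    from continuous_compact_support_uniform[OF test_functions_continuous[OF p] this \<open>e' > 0\<close>]
    show ?thesis by metis
  qed
  then obtain d where d: "\<And>b. b \<in> Basis \<Longrightarrow> d b > 0"
    "\<And>b x y. b \<in> Basis \<Longrightarrow> norm (x - y) < d b \<Longrightarrow> \<bar>pd b f x - pd b f y\<bar> < e'"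
    by metis
  show ?thesis
  proof (rule that[of "Min (d ` Basis)"])
    fix x h :: 'a assume h: "norm h < Min (d ` Basis)"
    obtain s where s: "0 < s" "s < 1" "f (x + h) - f x = frechet_derivative f (at (x + s *\<^sub>R h)) h"
      using mvt_direction[OF test_functions_has_derivative[OF f]] by metis
    have "frechet_derivative f (at (x + s *\<^sub>R h)) h = (\<Sum>b\<in>Basis. pd b f (x + s *\<^sub>R h) * (h \<bullet> b))"
      using test_functions_has_derivative[OF f] has_derivative_linear linear_sum_Basis by blast
    then have "\<bar>f (x + h) - f x - (\<Sum>b\<in>Basis. pd b f x * (h \<bullet> b))\<bar>
        = \<bar>\<Sum>b\<in>Basis. (pd b f (x + s *\<^sub>R h) - pd b f x) * (h \<bullet> b)\<bar>"
      using s by (simp add: sum_subtractf left_diff_distrib)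
    also have "\<dots> \<le> (\<Sum>b\<in>(Basis::'a set). e' * norm h)"
    proof (rule order_trans[OF sum_abs], rule sum_mono)
      fix b :: 'a assume b: "b \<in> Basis"
      have "norm ((x + s *\<^sub>R h) - x) \<le> norm h"
        using s by (simp add: mult_left_le_one_le)
      also have "\<dots> < d b" using h b by auto
      finally have "\<bar>pd b f (x + s *\<^sub>R h) - pd b f x\<bar> \<le> e'" using d(2)[OF b] by fastforce
      then show "\<bar>(pd b f (x + s *\<^sub>R h) - pd b f x) * (h \<bullet> b)\<bar> \<le> e' * norm h"
        using Basis_le_norm[OF b, of h] \<open>e' > 0\<close> by (simp add: abs_mult mult_mono)
    qed
    also have "\<dots> = e * norm h" by (simp add: e'_def)
    finally show "\<bar>f (x + h) - f x - (\<Sum>b\<in>Basis. pd b f x * (h \<bullet> b))\<bar> \<le> e * norm h" .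
  qed (use d in simp)
qed

text \<open>The linearisation error of \<open>g\<close> is small uniformly in the base point, so
  integrating it against \<open>f\<close> costs only the factor
  \<open>\<integral>|f|\<close>.\<close>

lemma conv_has_derivative:
  assumes f: "integrable lborel f" and g: "g \<in> test_functions UNIV"
  shows "(conv f g has_derivative (\<lambda>h. \<Sum>b\<in>Basis. conv f (pd b g) x * (h \<bullet> b))) (at x)"
  unfolding has_derivative_at_alt
proof (intro conjI allI impI)
  show "bounded_linear (\<lambda>h. \<Sum>b\<in>Basis. conv f (pd b g) x * (h \<bullet> b))"
    by (intro bounded_linear_sum bounded_linear_const_mult bounded_linear_inner_left)
  fix e :: real assume "e > 0"
  define I where "I = (\<integral>y. \<bar>f y\<bar> \<partial>lborel)"
  have "I \<ge> 0" by (simp add: I_def)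
  \<comment> \<open>The summand 1 covers the case \<open>I = 0\<close>.\<close>
  define e' where "e' = e / (I + 1)"
  have "e' > 0" using \<open>e > 0\<close> \<open>I \<ge> 0\<close> by (simp add: e'_def)
  then obtain d where d: "d > 0"
    "\<And>x h. norm h < d \<Longrightarrow> \<bar>g (x + h) - g x - (\<Sum>b\<in>Basis. pd b g x * (h \<bullet> b))\<bar> \<le> e' * norm h"
    using test_functions_uniformly_differentiable[OF g] by metis
  show "\<exists>d>0. \<forall>y. norm (y - x) < d \<longrightarrow>
      norm (conv f g y - conv f g x - (\<Sum>b\<in>Basis. conv f (pd b g) x * ((y - x) \<bullet> b))) \<le> e * norm (y - x)"
  proof (intro exI[of _ d] conjI allI impI d(1))
    fix y assume y: "norm (y - x) < d"
    let ?R = "\<lambda>z. g (y - z) - g (x - z) - (\<Sum>b\<in>Basis. pd b g (x - z) * ((y - x) \<bullet> b))"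
    have int: "integrable lborel (\<lambda>z. f z * g (w - z))"
       "b \<in> Basis \<Longrightarrow> integrable lborel (\<lambda>z. f z * pd b g (w - z))" for w b
      using conv_integrable[OF f g] conv_integrable[OF f test_functions_pd[OF g]] by auto
    have R: "f z * ?R z = f z * g (y - z) - f z * g (x - z)
        - (\<Sum>b\<in>Basis. (f z * pd b g (x - z)) * ((y - x) \<bullet> b))" for z
      by (simp add: algebra_simps sum_distrib_left)
    have intR: "integrable lborel (\<lambda>z. f z * ?R z)"
      unfolding R using int by auto
    have "conv f g y - conv f g x - (\<Sum>b\<in>Basis. conv f (pd b g) x * ((y - x) \<bullet> b)) = (\<integral>z. f z * ?R z \<partial>lborel)"
      unfolding R conv_def using int by simp
    then have "norm (conv f g y - conv f g x - (\<Sum>b\<in>Basis. conv f (pd b g) x * ((y - x) \<bullet> b)))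
        \<le> (\<integral>z. \<bar>f z * ?R z\<bar> \<partial>lborel)"
      using integral_norm_bound[of lborel "\<lambda>z. f z * ?R z"] by simp
    also have "\<dots> \<le> (\<integral>z. \<bar>f z\<bar> * (e' * norm (y - x)) \<partial>lborel)"
    proof (rule integral_mono)
      show "\<bar>f z * ?R z\<bar> \<le> \<bar>f z\<bar> * (e' * norm (y - x))" for z
      proof -
        have "x - z + (y - x) = y - z" by simp
        with d(2)[OF y, of "x - z"] have "\<bar>?R z\<bar> \<le> e' * norm (y - x)" by simp
        then show ?thesis unfolding abs_mult by (intro mult_left_mono) auto
      qed
    qed (use intR f in auto)
    also have "\<dots> = (I / (I + 1)) * (e * norm (y - x))"
      by (simp add: I_def e'_def)
    also have "\<dots> \<le> 1 * (e * norm (y - x))"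
      using \<open>I \<ge> 0\<close> \<open>e > 0\<close> by (intro mult_right_mono) auto
    finally show "norm (conv f g y - conv f g x - (\<Sum>b\<in>Basis. conv f (pd b g) x * ((y - x) \<bullet> b)))
      \<le> e * norm (y - x)" by simp
  qed
qed

lemma conv_pd:
  assumes "integrable lborel f" "g \<in> test_functions UNIV" "b \<in> Basis"
  shows "pd b (conv f g) x = conv f (pd b g) x"
proof -
  have "pd b (conv f g) x = (\<Sum>c\<in>Basis. conv f (pd c g) x * (b \<bullet> c))"
    by (simp add: frechet_derivative_eqI[OF conv_has_derivative[OF assms(1,2)]])
  also have "\<dots> = (\<Sum>c\<in>Basis. if c = b then conv f (pd c g) x else 0)"
    using assms(3) by (intro sum.cong) (auto simp: inner_Basis)
  finally show ?thesis using assms(3) by simp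
qed

lemma conv_continuous:
  assumes "integrable lborel f" "g \<in> test_functions UNIV"
  shows "continuous_on T (conv f g)"
  by (intro continuous_at_imp_continuous_on ballI has_derivative_continuous[OF conv_has_derivative[OF assms]])

text \<open>Every derivative falls on the kernel, whose partial derivatives are again test
  functions; therefore \<open>g\<close> varies in the induction while \<open>f\<close> stays merely
  integrable.\<close>

lemma conv_Ck:
  assumes "integrable lborel f"
  shows "g \<in> test_functions UNIV \<Longrightarrow> Ck k (conv f g)"
proof (induction k arbitrary: g)
  case 0
  then show ?case using conv_continuous[OF assms] by simp
next
  case (Suc k)
  have "pd b (conv f g) = conv f (pd b g)" if "b \<in> Basis" for b
    using conv_pd[OF assms Suc.prems that] by auto
  then show ?case
    using Suc.IH[OF test_functions_pd[OF Suc.prems]] conv_has_derivative[OF assms Suc.prems]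
    by (auto simp: differentiable_def)
qed

text \<open>The support lies in the Minkowski sum of \<open>K\<close> and the closed ball of radius
  \<open>r\<close>, which is compact and contained in \<open>S\<close> by the last
  assumption.\<close>

lemma conv_test_functions:
  assumes f: "integrable lborel f" and g: "g \<in> test_functions UNIV"
    and K: "compact K" "\<And>x. x \<notin> K \<Longrightarrow> f x = 0" and r: "\<And>x. r \<le> norm x \<Longrightarrow> g x = 0"
    and S: "\<And>x. x \<in> K \<Longrightarrow> cball x r \<subseteq> S"
  shows "conv f g \<in> test_functions S"
proof (rule test_functionsI[OF conv_Ck[OF f g]])
  let ?L = "{x + y |x y. x \<in> K \<and> y \<in> cball 0 r}"
  show "compact ?L" by (rule compact_sums[OF K(1) compact_cball])
  show "?L \<subseteq> S"
  proof clarify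
    fix x y :: 'a assume "x \<in> K" "y \<in> cball 0 r"
    then have "x + y \<in> cball x r" by (simp add: dist_norm)
    then show "x + y \<in> S" using S[OF \<open>x \<in> K\<close>] by auto
  qed
  fix x assume x: "x \<notin> ?L"
  have "f y * g (x - y) = 0" for y
  proof (cases "y \<in> K")
    case True
    then have "x - y \<notin> cball 0 r" using x by (auto dest!: spec[of _ y])
    then show ?thesis using r[of "x - y"] by simp
  qed (use K(2) in auto)
  then show "conv f g x = 0" unfolding conv_def by (simp only: Bochner_Integration.integral_zero)
qed

definition eta :: "real \<Rightarrow> 'a::euclidean_space \<Rightarrow> real" where
  "eta r x = bump r x / (\<integral>x. bump r (x::'a) \<partial>lborel)"

lemma bump_test_function:
  assumes "r \<ge> 0" "cball x r \<subseteq> S"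
  shows "(\<lambda>y. bump r (x - y)) \<in> test_functions S"
  by (rule test_functionsI[OF Ck_bump compact_cball assms(2)])
     (use assms in \<open>auto intro!: bump_eq_0 simp: dist_norm\<close>)

lemma bump_minus: "bump r (- x) = bump r x"
  by (simp add: bump_def)

lemma bump_test_function_0: "r \<ge> 0 \<Longrightarrow> (bump r :: 'a::euclidean_space \<Rightarrow> real) \<in> test_functions UNIV"
  using bump_test_function[of r "0::'a" UNIV] by (simp add: bump_minus)

lemma bump_integral_pos:
  assumes "r > 0"
  shows "(\<integral>x. bump r (x::'a::euclidean_space) \<partial>lborel) > 0"
proof -
  have t: "(bump r :: 'a \<Rightarrow> real) \<in> test_functions UNIV" using assms by (intro bump_test_function_0) simp
  have nn: "bump r x \<ge> 0" for x :: 'a by (simp add: bump_def exp_recip_nonneg)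
  have "(\<integral>x. bump r (x::'a) \<partial>lborel) \<noteq> 0"
  proof
    assume "(\<integral>x. bump r (x::'a) \<partial>lborel) = 0"
    then have "AE x::'a in lborel. bump r x = 0"
      using integral_nonneg_eq_0_iff_AE[OF test_functions_integrable[OF t]] nn by simp
    then have "AE x::'a in lborel. x \<notin> ball 0 r"
      by eventually_elim (use bump_pos in force)
    then have "ball (0::'a) r \<in> null_sets lborel"
      by (subst (asm) AE_iff_null_sets[symmetric]) auto
    then have "measure lborel (ball (0::'a) r) = 0" by (simp add: measure_def null_sets_def)
    then show False using content_ball_pos[OF assms, of "0::'a"] by simp
  qed
  then show ?thesis using nn by (simp add: less_le)
qed

context
  fixes r :: real
  assumes r: "r > 0"
begin

lemma eta_eq: "eta r = (\<lambda>x::'a::euclidean_space. bump r x * inverse (\<integral>x. bump r (x::'a) \<partial>lborel))"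
  by (auto simp: eta_def field_simps)

lemma eta_test_function_shift:
  fixes x :: "'a::euclidean_space"
  assumes "cball x r \<subseteq> S"
  shows "(\<lambda>y. eta r (x - y)) \<in> test_functions S"
proof -
  have t: "(\<lambda>y. bump r (x - y)) \<in> test_functions S" using assms r by (intro bump_test_function) simp_all
  show ?thesis
    by (rule test_functionsE[OF t], rule test_functionsI)
       (auto simp: eta_eq intro: Ck_mult Ck_const Ck_bump)
qed

lemma eta_minus: "eta r (- x) = eta r x"
  by (simp add: eta_def bump_minus)

lemma eta_test_function: "(eta r :: 'a::euclidean_space \<Rightarrow> real) \<in> test_functions UNIV"
  using eta_test_function_shift[of "0::'a" UNIV] by (simp add: eta_minus)

lemma eta_measurable [measurable]: "(eta r :: 'a::euclidean_space \<Rightarrow> real) \<in> borel_measurable borel"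
  using eta_test_function by (rule test_functions_measurable)

lemma eta_nonneg: "eta r x \<ge> 0"
  unfolding eta_def using bump_integral_pos[OF r]
  by (simp add: bump_def exp_recip_nonneg less_imp_le)

lemma eta_eq_0: "r \<le> norm x \<Longrightarrow> eta r x = 0"
  using r by (simp add: eta_def bump_eq_0)

lemma eta_integral: "(\<integral>x. eta r (x::'a::euclidean_space) \<partial>lborel) = 1"
  using bump_integral_pos[OF r, where 'a='a] by (simp add: eta_def)

lemma eta_integrable_shift: "integrable lborel (\<lambda>x. eta r (x - y))" for y :: "'a::euclidean_space"
  using integrable_lborel_shift[OF test_functions_integrable[OF eta_test_function], of "- y"] by simp

lemma eta_integral_shift: "(\<integral>x. eta r (x - y) \<partial>lborel) = 1" for y :: "'a::euclidean_space"
  using integral_lborel_shift[OF eta_measurable, of "- y"] by (simp add: eta_integral)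

lemma eta_integrable_shift': "integrable lborel (\<lambda>y. eta r (x - y))" for x :: "'a::euclidean_space"
  using eta_integrable_shift[of x] eta_minus[of "x - _"] by (subst eta_minus[symmetric]) simp

lemma eta_integral_shift': "(\<integral>y. eta r (x - y) \<partial>lborel) = 1" for x :: "'a::euclidean_space"
  using eta_integral_shift[of x] by (subst eta_minus[symmetric]) simp

end

subsection \<open>Square-integrable functions\<close>

text \<open>A whole-space version of L2; functions on a domain enter as extensions by 0, so that
  convolution needs no restriction.\<close>

definition sqint :: "('a::euclidean_space \<Rightarrow> real) \<Rightarrow> bool" where
  "sqint f \<longleftrightarrow> f \<in> borel_measurable borel \<and> integrable lborel (\<lambda>x. (f x)\<^sup>2)"

lemma sqint_measurable [measurable_dest]: "sqint f \<Longrightarrow> f \<in> borel_measurable borel"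
  by (simp add: sqint_def)

lemma sqint_integrable_sq: "sqint f \<Longrightarrow> integrable lborel (\<lambda>x. (f x)\<^sup>2)"
  by (simp add: sqint_def)

lemma sqint_bound:
  assumes "integrable lborel w" "f \<in> borel_measurable borel" "\<And>x. (f x)\<^sup>2 \<le> w x"
  shows "sqint f"
  unfolding sqint_def
proof
  show "integrable lborel (\<lambda>x. (f x)\<^sup>2)"
    by (rule Bochner_Integration.integrable_bound[OF assms(1)])
       (use assms(2,3) in \<open>auto intro!: AE_I2 intro: order_trans[OF _ abs_ge_self]\<close>)
qed (rule assms(2))

lemma sq_add_le: "(a + b)\<^sup>2 \<le> 2 * a\<^sup>2 + 2 * (b::real)\<^sup>2"
  using sum_squares_bound[of a b] by (simp add: power2_sum)

lemma sqint_add: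
  assumes "sqint f" "sqint g"
  shows "sqint (\<lambda>x. f x + g x)"
  by (rule sqint_bound[of "\<lambda>x. 2 * (f x)\<^sup>2 + 2 * (g x)\<^sup>2"])
     (use assms sq_add_le in \<open>auto simp: sqint_def\<close>)

lemma sqint_mult_bounded:
  assumes "sqint f" "g \<in> borel_measurable borel" "\<And>x. \<bar>g x\<bar> \<le> B"
  shows "sqint (\<lambda>x. g x * f x)"
proof (rule sqint_bound[of "\<lambda>x. B\<^sup>2 * (f x)\<^sup>2"])
  show "(g x * f x)\<^sup>2 \<le> B\<^sup>2 * (f x)\<^sup>2" for x
    using power_mono[OF assms(3)[of x], of 2] by (simp add: power_mult_distrib mult_right_mono)
qed (use assms in \<open>auto simp: sqint_def\<close>)

lemma sqint_uminus: "sqint f \<Longrightarrow> sqint (\<lambda>x. - f x)"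
  by (simp add: sqint_def)

lemma sqint_diff: "sqint f \<Longrightarrow> sqint g \<Longrightarrow> sqint (\<lambda>x. f x - g x)"
  using sqint_add[OF _ sqint_uminus, of f g] by simp

lemma sqint_mult_integrable:
  assumes "sqint f" "sqint g"
  shows "integrable lborel (\<lambda>x. f x * g x)"
proof (rule Bochner_Integration.integrable_bound)
  show "integrable lborel (\<lambda>x. (f x)\<^sup>2 + (g x)\<^sup>2)" using assms by (auto simp: sqint_def)
  show "AE x in lborel. norm (f x * g x) \<le> norm ((f x)\<^sup>2 + (g x)\<^sup>2)"
  proof (rule AE_I2)
    fix x
    have "2 * \<bar>f x\<bar> * \<bar>g x\<bar> \<le> (f x)\<^sup>2 + (g x)\<^sup>2"
      using sum_squares_bound[of "\<bar>f x\<bar>" "\<bar>g x\<bar>"] by simp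
    moreover have "0 \<le> \<bar>f x\<bar> * \<bar>g x\<bar>" by simp
    ultimately have "\<bar>f x\<bar> * \<bar>g x\<bar> \<le> (f x)\<^sup>2 + (g x)\<^sup>2" by linarith
    then show "norm (f x * g x) \<le> norm ((f x)\<^sup>2 + (g x)\<^sup>2)"
      by (simp add: abs_mult)
  qed
qed (use assms in \<open>auto simp: sqint_def\<close>)

lemma sqint_continuous_compact_support:
  assumes "continuous_on UNIV f" "compact K" "\<And>x. x \<notin> K \<Longrightarrow> f x = 0"
  shows "sqint f"
proof -
  have "integrable lborel (\<lambda>x. (f x)\<^sup>2)"
    by (rule continuous_compact_support_integrable[OF _ assms(2)])
       (use assms in \<open>auto intro!: continuous_intros\<close>)
  then show ?thesis
    using borel_measurable_continuous_onI[OF assms(1)] by (simp add: sqint_def)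
qed

lemma sqint_test_function:
  assumes "f \<in> test_functions S"
  shows "sqint f"
proof -
  obtain K where "compact K" "\<And>x. x \<notin> K \<Longrightarrow> f x = 0"
    using assms by (rule test_functionsE) blast
  then show ?thesis
    by (rule sqint_continuous_compact_support[OF test_functions_continuous[OF assms]])
qed

lemma sqint_indicator:
  assumes "bounded S" "S \<in> sets borel"
  shows "sqint (indicator S :: 'a::euclidean_space \<Rightarrow> real)"
proof -
  have "integrable lborel (indicator S :: 'a \<Rightarrow> real)"
    using assms emeasure_bounded_finite[OF assms(1)] by (intro integrable_real_indicator) auto
  moreover have "(\<lambda>x. (indicator S x)\<^sup>2) = (indicator S :: 'a \<Rightarrow> real)"
    by (auto simp: indicator_def)
  ultimately show ?thesis using assms by (simp add: sqint_def)
qed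

lemma sqint_integrable:
  assumes "sqint f" "bounded S" "S \<in> sets borel" "\<And>x. x \<notin> S \<Longrightarrow> f x = 0"
  shows "integrable lborel f"
proof -
  have "(\<lambda>x. indicator S x * f x) = f"
    using assms(4) unfolding indicator_def fun_eq_iff by fastforce
  then show ?thesis
    using sqint_mult_integrable[OF sqint_indicator[OF assms(2,3)] assms(1)] by simp
qed

text \<open>The integral of the square of \<open>f + t * g\<close> is a quadratic polynomial in
  \<open>t\<close> without negative values; its discriminant gives the bound.\<close>

lemma Cauchy_Schwarz_integral:
  assumes "sqint f" "sqint g"
  shows "(\<integral>x. f x * g x \<partial>lborel)\<^sup>2 \<le> (\<integral>x. (f x)\<^sup>2 \<partial>lborel) * (\<integral>x. (g x)\<^sup>2 \<partial>lborel)"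
proof -
  define a b c where "a = (\<integral>x. (f x)\<^sup>2 \<partial>lborel)" and "b = (\<integral>x. f x * g x \<partial>lborel)"
    and "c = (\<integral>x. (g x)\<^sup>2 \<partial>lborel)"
  have q: "0 \<le> a + 2 * t * b + t\<^sup>2 * c" for t
  proof -
    have "0 \<le> (\<integral>x. (f x + t * g x)\<^sup>2 \<partial>lborel)" by simp
    also have "\<dots> = (\<integral>x. (f x)\<^sup>2 + 2 * t * (f x * g x) + t\<^sup>2 * (g x)\<^sup>2 \<partial>lborel)"
      by (simp add: power2_eq_square algebra_simps)
    also have "\<dots> = a + 2 * t * b + t\<^sup>2 * c"
      using assms sqint_mult_integrable[OF assms] by (simp add: sqint_def a_def b_def c_def)
    finally show ?thesis .
  qed
  have "c \<ge> 0" by (simp add: c_def)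
  have "b\<^sup>2 \<le> a * c"
  proof (cases "c = 0")
    case True
    show ?thesis
    proof (rule ccontr)
      assume "\<not> b\<^sup>2 \<le> a * c"
      then have "b \<noteq> 0" using True by auto
      \<comment> \<open>For \<open>c = 0\<close> the polynomial is affine, and at this
        \<open>t\<close> its value is -1.\<close>
      then show False using q[of "- (a + 1) / (2 * b)"] True by (simp add: field_simps)
    qed
  next
    case False
    then have "c > 0" using \<open>c \<ge> 0\<close> by simp
    \<comment> \<open>This is the minimiser of the quadratic.\<close>
    then show ?thesis using q[of "- b / c"]
      by (simp add: field_simps power2_eq_square)
  qed
  then show ?thesis by (simp add: a_def b_def c_def)
qed

text \<open>Jensen's inequality for the probability density \<open>eta r (x - y)\<close>.\<close>

lemma conv_eta_sq_le:
  fixes f :: "'a::euclidean_space \<Rightarrow> real"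
  assumes "r > 0" "sqint f" "integrable lborel f"
  shows "(conv f (eta r) x)\<^sup>2 \<le> (\<integral>y. (f y)\<^sup>2 * eta r (x - y) \<partial>lborel)"
proof -
  note eta = eta_nonneg[OF assms(1), where 'a='a] eta_test_function[OF assms(1)]
  have [measurable]: "(eta r :: 'a \<Rightarrow> real) \<in> borel_measurable borel" "f \<in> borel_measurable borel"
    using eta_measurable[OF assms(1)] assms(2) by auto
  let ?s = "\<lambda>y. sqrt (eta r (x - y))"
  have s: "sqint ?s"
    using eta_integrable_shift'[OF assms(1), of x] eta by (simp add: sqint_def)
  have fs: "sqint (\<lambda>y. f y * ?s y)"
    using conv_integrable[OF sqint_integrable_sq[OF assms(2)] eta(2), of x] eta(1)
    by (simp add: sqint_def power_mult_distrib)
  have "conv f (eta r) x = (\<integral>y. (f y * ?s y) * ?s y \<partial>lborel)"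
    using eta(1) by (simp add: conv_def mult.assoc)
  then show ?thesis
    using Cauchy_Schwarz_integral[OF fs s] eta(1) eta_integral_shift'[OF assms(1), of x]
    by (simp add: power_mult_distrib)
qed

text \<open>Jensen's inequality is integrated in \<open>x\<close> and the order of integration
  exchanged; the kernel has mass 1 in \<open>x\<close> as well. Working with nonnegative integrals
  yields integrability and the bound at once.\<close>

lemma conv_eta_contraction:
  fixes f :: "'a::euclidean_space \<Rightarrow> real"
  assumes "r > 0" "sqint f" "integrable lborel f"
  shows "sqint (conv f (eta r))"
    and "(\<integral>x. (conv f (eta r) x)\<^sup>2 \<partial>lborel) \<le> (\<integral>x. (f x)\<^sup>2 \<partial>lborel)"
proof -
  note eta = eta_nonneg[OF assms(1), where 'a='a] eta_test_function[OF assms(1)]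
  have [measurable]: "(eta r :: 'a \<Rightarrow> real) \<in> borel_measurable borel" "f \<in> borel_measurable borel"
    using eta_measurable[OF assms(1)] assms(2) by auto
  have [measurable]: "conv f (eta r) \<in> borel_measurable borel"
    using conv_continuous[OF assms(3) eta(2)] by (rule borel_measurable_continuous_onI)
  have "(\<integral>\<^sup>+x. ennreal ((conv f (eta r) x)\<^sup>2) \<partial>lborel)
      \<le> (\<integral>\<^sup>+x. (\<integral>\<^sup>+y. ennreal ((f y)\<^sup>2 * eta r (x - y)) \<partial>lborel) \<partial>lborel)"
  proof (rule nn_integral_mono)
    fix x
    have "integrable lborel (\<lambda>y. (f y)\<^sup>2 * eta r (x - y))"
      by (rule conv_integrable[OF sqint_integrable_sq[OF assms(2)] eta(2)])
    then have "(\<integral>\<^sup>+y. ennreal ((f y)\<^sup>2 * eta r (x - y)) \<partial>lborel)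
        = ennreal (\<integral>y. (f y)\<^sup>2 * eta r (x - y) \<partial>lborel)"
      using eta(1) by (intro nn_integral_eq_integral) auto
    then show "ennreal ((conv f (eta r) x)\<^sup>2) \<le> (\<integral>\<^sup>+y. ennreal ((f y)\<^sup>2 * eta r (x - y)) \<partial>lborel)"
      using conv_eta_sq_le[OF assms] by (simp add: ennreal_leI)
  qed
  also have "\<dots> = (\<integral>\<^sup>+y. (\<integral>\<^sup>+x. ennreal ((f y)\<^sup>2 * eta r (x - y)) \<partial>lborel) \<partial>lborel)"
    by (rule lborel_pair.Fubini') measurable
  also have "\<dots> = (\<integral>\<^sup>+y. ennreal ((f y)\<^sup>2) \<partial>lborel)"
  proof (rule nn_integral_cong)
    fix y
    have "(\<integral>\<^sup>+x. ennreal ((f y)\<^sup>2 * eta r (x - y)) \<partial>lborel)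
        = ennreal (\<integral>x. (f y)\<^sup>2 * eta r (x - y) \<partial>lborel)"
      using eta(1) eta_integrable_shift[OF assms(1)] by (intro nn_integral_eq_integral) auto
    then show "(\<integral>\<^sup>+x. ennreal ((f y)\<^sup>2 * eta r (x - y)) \<partial>lborel) = ennreal ((f y)\<^sup>2)"
      using eta_integral_shift[OF assms(1), of y] by simp
  qed
  also have "\<dots> = ennreal (\<integral>y. (f y)\<^sup>2 \<partial>lborel)"
    using sqint_integrable_sq[OF assms(2)] by (intro nn_integral_eq_integral) auto
  finally have le: "(\<integral>\<^sup>+x. ennreal ((conv f (eta r) x)\<^sup>2) \<partial>lborel) \<le> ennreal (\<integral>y. (f y)\<^sup>2 \<partial>lborel)" .
  have int: "integrable lborel (\<lambda>x. (conv f (eta r) x)\<^sup>2)"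
    by (rule integrableI_nonneg) (use le in \<open>auto simp: ennreal_less_top order_le_less_trans\<close>)
  then show "sqint (conv f (eta r))" by (simp add: sqint_def)
  have "ennreal (\<integral>x. (conv f (eta r) x)\<^sup>2 \<partial>lborel) \<le> ennreal (\<integral>y. (f y)\<^sup>2 \<partial>lborel)"
    using le nn_integral_eq_integral[OF int] by simp
  then show "(\<integral>x. (conv f (eta r) x)\<^sup>2 \<partial>lborel) \<le> (\<integral>x. (f x)\<^sup>2 \<partial>lborel)"
    by simp
qed

text \<open>First \<open>f\<close> is truncated in value by \<open>cl\<close> and in space by
  \<open>ch\<close>. Measurability then supplies continuous functions converging to \<open>f\<close>
  almost everywhere; applying the same truncation to them provides a common bound, so dominated
  convergence applies in both stages.\<close>

lemma compact_support_dense_sqint: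
  fixes f :: "'a::euclidean_space \<Rightarrow> real"
  assumes f: "sqint f" and "e > 0"
  obtains g K where "continuous_on UNIV g" "compact K" "\<And>x. x \<notin> K \<Longrightarrow> g x = 0"
    "(\<integral>x. (f x - g x)\<^sup>2 \<partial>lborel) < e"
proof -
  have [measurable]: "f \<in> borel_measurable borel" using f by (rule sqint_measurable)
  have "f \<in> borel_measurable lebesgue" by (rule measurable_completion) simp
  then have "f measurable_on UNIV" by (intro lebesgue_measurable_imp_measurable_on) auto
  then obtain N h where N: "negligible N" and h: "\<And>n. continuous_on UNIV (h n)"
    "\<And>x. x \<notin> N \<Longrightarrow> (\<lambda>n. h n x) \<longlonglongrightarrow> f x"
    unfolding measurable_on_def by auto
  have "AE x in lebesgue. x \<notin> N"
    using N by (intro AE_not_in) (simp add: negligible_iff_null_sets)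
  then have aeN: "AE x in lborel. x \<notin> N" by (simp add: AE_completion_iff)
  have [measurable]: "h n \<in> borel_measurable borel" for n
    using h(1) by (rule borel_measurable_continuous_onI)
  define cl :: "nat \<Rightarrow> real \<Rightarrow> real" where "cl k t = max (- real k) (min (real k) t)" for k t
  define ch :: "nat \<Rightarrow> 'a \<Rightarrow> real" where "ch k x = max 0 (min 1 (real k + 1 - norm x))" for k x
  define F where "F k x = cl k (f x) * ch k x" for k x
  define G where "G k n x = cl k (h n x) * ch k x" for k n x
  have cl_cont: "continuous_on UNIV (cl k)" for k
    unfolding cl_def by (intro continuous_intros)
  have [measurable]: "cl k \<in> borel_measurable borel" "ch k \<in> borel_measurable borel" for k
    unfolding cl_def ch_def by measurable
  have ch: "0 \<le> ch k x" "ch k x \<le> 1" "x \<notin> cball 0 (real k + 1) \<Longrightarrow> ch k x = 0" for k x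
    by (auto simp: ch_def)
  have cl: "\<bar>cl k t\<bar> \<le> real k" "\<bar>cl k t\<bar> \<le> \<bar>t\<bar>" "0 \<le> t \<Longrightarrow> 0 \<le> cl k t" "t \<le> 0 \<Longrightarrow> cl k t \<le> 0" for k t
    by (auto simp: cl_def)
  have F_le: "\<bar>F k x - f x\<bar> \<le> 2 * \<bar>f x\<bar>" for k x
  proof -
    have "\<bar>F k x\<bar> \<le> \<bar>f x\<bar> * 1"
      unfolding F_def abs_mult using cl(2) ch by (intro mult_mono) auto
    then show ?thesis by linarith
  qed
  have "(\<lambda>k. \<integral>x. (F k x - f x)\<^sup>2 \<partial>lborel) \<longlonglongrightarrow> (\<integral>x. 0 \<partial>(lborel :: 'a measure))"
  proof (rule integral_dominated_convergence)
    show "integrable lborel (\<lambda>x. 4 * (f x)\<^sup>2)" using f by (simp add: sqint_def)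
    show "AE x in lborel. (\<lambda>k. (F k x - f x)\<^sup>2) \<longlonglongrightarrow> 0"
    proof (rule AE_I2)
      fix x
      obtain k0 where k0: "real k0 \<ge> \<bar>f x\<bar> + norm x" using real_arch_simple by blast
      have "(F k x - f x)\<^sup>2 = 0" if "k \<ge> k0" for k
      proof -
        have "real k \<ge> \<bar>f x\<bar> + norm x" using that k0 by linarith
        then have "real k \<ge> \<bar>f x\<bar>" "real k \<ge> norm x" using norm_ge_zero[of x] by linarith+
        then have "cl k (f x) = f x" "ch k x = 1" by (auto simp: cl_def ch_def)
        then show ?thesis by (simp add: F_def)
      qed
      then show "(\<lambda>k. (F k x - f x)\<^sup>2) \<longlonglongrightarrow> 0"
        by (intro tendsto_eventually) (auto simp: eventually_sequentially)
    qed
    show "AE x in lborel. norm ((F k x - f x)\<^sup>2) \<le> 4 * (f x)\<^sup>2" for k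
      using power_mono[OF F_le, of k _ 2] by (intro AE_I2) (simp add: power_mult_distrib)
  qed (auto simp: F_def)
  then have "(\<lambda>k. \<integral>x. (F k x - f x)\<^sup>2 \<partial>lborel) \<longlonglongrightarrow> 0" by simp
  \<comment> \<open>A quarter of \<open>e\<close> for each stage, since combining the two errors
    doubles each squared norm.\<close>
  then have "\<forall>\<^sub>F k in sequentially. (\<integral>x. (F k x - f x)\<^sup>2 \<partial>lborel) < e / 4"
    by (rule order_tendstoD) (use \<open>e > 0\<close> in simp)
  then obtain k where k: "(\<integral>x. (F k x - f x)\<^sup>2 \<partial>lborel) < e / 4"
    by (auto simp: eventually_sequentially)
  have Gsup: "x \<notin> cball 0 (real k + 1) \<Longrightarrow> G k n x = 0" "x \<notin> cball 0 (real k + 1) \<Longrightarrow> F k x = 0" for n x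
    using ch(3)[of x k] by (simp_all add: G_def F_def)
  have GF: "\<bar>G k n x - F k x\<bar> \<le> 2 * real k" for n x
  proof -
    have "\<bar>G k n x\<bar> \<le> real k * 1" "\<bar>F k x\<bar> \<le> real k * 1"
      unfolding G_def F_def abs_mult using cl(1) ch by (intro mult_mono; auto)+
    then show ?thesis by linarith
  qed
  have ball: "integrable lborel (\<lambda>x::'a. indicator (cball 0 (real k + 1)) x * (2 * real k)\<^sup>2)"
    using emeasure_bounded_finite[of "cball (0::'a) (real k + 1)"]
    by (intro integrable_mult_left integrable_real_indicator) simp_all
  have ind: "(G k n x - F k x)\<^sup>2 \<le> indicator (cball 0 (real k + 1)) x * (2 * real k)\<^sup>2" for n x
    using power_mono[OF GF, of n x 2] Gsup(1)[of x n] Gsup(2)[of x] by (auto simp: indicator_def)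
  have "(\<lambda>n. \<integral>x. (G k n x - F k x)\<^sup>2 \<partial>lborel) \<longlonglongrightarrow> (\<integral>x. 0 \<partial>(lborel :: 'a measure))"
  proof (rule integral_dominated_convergence[OF _ _ ball])
    show "AE x in lborel. (\<lambda>n. (G k n x - F k x)\<^sup>2) \<longlonglongrightarrow> 0"
      using aeN
    proof eventually_elim
      case (elim x)
      have "(\<lambda>n. cl k (h n x)) \<longlonglongrightarrow> cl k (f x)"
        using h(2)[OF elim] by (intro continuous_on_tendsto_compose[OF cl_cont]) auto
      then have "(\<lambda>n. (G k n x - F k x)\<^sup>2) \<longlonglongrightarrow> (cl k (f x) * ch k x - F k x)\<^sup>2"
        unfolding G_def by (intro tendsto_intros)
      then show ?case by (simp add: F_def)
    qed
    show "AE x in lborel. norm ((G k n x - F k x)\<^sup>2) \<le> indicator (cball 0 (real k + 1)) x * (2 * real k)\<^sup>2" for n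
      using ind by (intro AE_I2) simp
  qed (auto simp: F_def G_def)
  then have "(\<lambda>n. \<integral>x. (G k n x - F k x)\<^sup>2 \<partial>lborel) \<longlonglongrightarrow> 0" by simp
  then have "\<forall>\<^sub>F n in sequentially. (\<integral>x. (G k n x - F k x)\<^sup>2 \<partial>lborel) < e / 4"
    by (rule order_tendstoD) (use \<open>e > 0\<close> in simp)
  then obtain n where n: "(\<integral>x. (G k n x - F k x)\<^sup>2 \<partial>lborel) < e / 4"
    by (auto simp: eventually_sequentially)
  have sGF: "sqint (\<lambda>x. G k n x - F k x)"
    by (rule sqint_bound[OF ball _ ind]) (auto simp: F_def G_def)
  have sFf: "sqint (\<lambda>x. F k x - f x)"
  proof (rule sqint_bound[of "\<lambda>x. 4 * (f x)\<^sup>2"])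
    show "(F k x - f x)\<^sup>2 \<le> 4 * (f x)\<^sup>2" for x
      using power_mono[OF F_le, of k x 2] by (simp add: power_mult_distrib)
  qed (use f in \<open>auto simp: sqint_def F_def\<close>)
  show ?thesis
  proof (rule that[of "G k n" "cball 0 (real k + 1)"])
    show "continuous_on UNIV (G k n)"
      unfolding G_def ch_def
      by (intro continuous_intros continuous_on_compose2[OF cl_cont h(1)]) auto
    have "(\<integral>x. (f x - G k n x)\<^sup>2 \<partial>lborel) \<le> (\<integral>x. 2 * (F k x - f x)\<^sup>2 + 2 * (G k n x - F k x)\<^sup>2 \<partial>lborel)"
    proof (rule integral_mono)
      show "integrable lborel (\<lambda>x. (f x - G k n x)\<^sup>2)"
        using sqint_uminus[OF sqint_add[OF sGF sFf]] by (simp add: sqint_def)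
      show "(f x - G k n x)\<^sup>2 \<le> 2 * (F k x - f x)\<^sup>2 + 2 * (G k n x - F k x)\<^sup>2" for x
        using sq_add_le[of "F k x - f x" "G k n x - F k x"] by (simp add: power2_commute)
    qed (use sGF sFf in \<open>simp add: sqint_def\<close>)
    also have "\<dots> < e" using n k sGF sFf by (simp add: sqint_def)
    finally show "(\<integral>x. (f x - G k n x)\<^sup>2 \<partial>lborel) < e" .
  qed (use Gsup in auto)
qed

section \<open>L2 convergence of mollifications\<close>

lemma conv_diff_left:
  assumes "integrable lborel f" "integrable lborel g" "h \<in> test_functions UNIV"
  shows "conv (\<lambda>x. f x - g x) h x = conv f h x - conv g h x"
  unfolding conv_def using conv_integrable[OF assms(1,3), of x] conv_integrable[OF assms(2,3), of x]
  by (simp add: left_diff_distrib)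

text \<open>One null sequence in \<open>(0, 1]\<close> serves as mollification radius, as smoothing
  parameter for the positive part, and as \<open>\<delta>\<close> in the final limit.\<close>

definition rad :: "nat \<Rightarrow> real" where "rad n = inverse (real (Suc n))"

lemma rad_pos: "rad n > 0" and rad_le_1: "rad n \<le> 1" and rad_tendsto: "rad \<longlonglongrightarrow> 0"
  using LIMSEQ_inverse_real_of_nat by (auto simp: rad_def[abs_def] field_simps)

text \<open>As the kernel has mass 1, the difference is a weighted average of
  \<open>g y - g x\<close> over points \<open>y\<close> closer to \<open>x\<close> than
  \<open>r\<close>.\<close>

lemma conv_eta_uniform:
  fixes g :: "'a::euclidean_space \<Rightarrow> real"
  assumes g: "continuous_on UNIV g" "compact K" "\<And>x. x \<notin> K \<Longrightarrow> g x = 0"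
    and r: "r > 0" and d: "\<And>x y. norm (x - y) < r \<Longrightarrow> \<bar>g x - g y\<bar> < e"
  shows "\<bar>conv g (eta r) x - g x\<bar> \<le> e"
proof -
  note eta = eta_nonneg[OF r, where 'a='a] eta_test_function[OF r]
  have intg: "integrable lborel g" by (rule continuous_compact_support_integrable[OF g])
  have i1: "integrable lborel (\<lambda>y. g y * eta r (x - y))" by (rule conv_integrable[OF intg eta(2)])
  have i2: "integrable lborel (\<lambda>y. g x * eta r (x - y))" using eta_integrable_shift'[OF r, of x] by simp
  have "conv g (eta r) x - g x = (\<integral>y. g y * eta r (x - y) - g x * eta r (x - y) \<partial>lborel)"
    using i1 i2 eta_integral_shift'[OF r, of x] by (simp add: conv_def)
  also have "\<bar>\<dots>\<bar> \<le> (\<integral>y. \<bar>g y * eta r (x - y) - g x * eta r (x - y)\<bar> \<partial>lborel)"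
    using integral_norm_bound[of lborel "\<lambda>y. g y * eta r (x - y) - g x * eta r (x - y)"] by simp
  also have "\<dots> \<le> (\<integral>y. e * eta r (x - y) \<partial>lborel)"
  proof (rule integral_mono)
    fix y
    show "\<bar>g y * eta r (x - y) - g x * eta r (x - y)\<bar> \<le> e * eta r (x - y)"
    proof (cases "norm (y - x) < r")
      case True
      then have "\<bar>g y - g x\<bar> * eta r (x - y) \<le> e * eta r (x - y)"
        using d eta(1) by (intro mult_right_mono) (auto intro: less_imp_le)
      then show ?thesis using eta(1) by (simp add: abs_mult flip: left_diff_distrib)
    next
      case False
      then show ?thesis using eta_eq_0[OF r, of "x - y"] by (simp add: norm_minus_commute)
    qed
  qed (use i1 i2 eta_integrable_shift'[OF r, of x] in auto)
  also have "\<dots> = e" using eta_integral_shift'[OF r, of x] by simp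
  finally show ?thesis .
qed

text \<open>Uniform continuity settles the case of continuous \<open>g\<close> with compact support.
  The contraction property controls the mollification of \<open>f - g\<close> independently of the
  radius, so density extends the result to \<open>f\<close>.\<close>

lemma conv_eta_tendsto:
  fixes f :: "'a::euclidean_space \<Rightarrow> real"
  assumes f: "sqint f" "integrable lborel f"
  shows "(\<lambda>n. \<integral>x. (conv f (eta (rad n)) x - f x)\<^sup>2 \<partial>lborel) \<longlonglongrightarrow> 0"
proof (rule order_tendstoI)
  fix e0 :: real assume "0 > e0"
  then show "\<forall>\<^sub>F n in sequentially. e0 < (\<integral>x. (conv f (eta (rad n)) x - f x)\<^sup>2 \<partial>lborel)"
    by (intro always_eventually allI order_less_le_trans[OF \<open>0 > e0\<close>]) simp
next
  fix e0 :: real assume "0 < e0"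
  \<comment> \<open>The three errors enter with the factors 2, 4 and 4, and 10 / 11 leaves room for
    the strict inequality.\<close>
  define e where "e = e0 / 11"
  have "e > 0" using \<open>0 < e0\<close> by (simp add: e_def)
  obtain g K where g: "continuous_on UNIV g" "compact K" "\<And>x. x \<notin> K \<Longrightarrow> g x = 0"
    and fg: "(\<integral>x. (f x - g x)\<^sup>2 \<partial>lborel) < e"
    using compact_support_dense_sqint[OF f(1) \<open>e > 0\<close>] by metis
  have sg: "sqint g" by (rule sqint_continuous_compact_support[OF g])
  have ig: "integrable lborel g" by (rule continuous_compact_support_integrable[OF g])
  obtain R where R: "K \<subseteq> cball 0 R"
    using bounded_subset_ballD[OF compact_imp_bounded[OF g(2)], of 0] ball_subset_cball by fastforce
  define V where "V = measure lborel (cball (0::'a) (R + 1))"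
  have "V \<ge> 0" by (simp add: V_def)
  \<comment> \<open>Since \<open>rad n \<le> 1\<close>, the error for \<open>g\<close> lives on a
    ball of volume \<open>V\<close>; a uniform error \<open>e'\<close> there contributes at most
    \<open>V / (V + 1) * e\<close> to the squared norm.\<close>
  define e' where "e' = sqrt (e / (V + 1))"
  have "e' > 0" using \<open>e > 0\<close> \<open>V \<ge> 0\<close> by (simp add: e'_def)
  obtain d where d: "d > 0" "\<And>x y. norm (x - y) < d \<Longrightarrow> \<bar>g x - g y\<bar> < e'"
    using continuous_compact_support_uniform[OF g \<open>e' > 0\<close>] by metis
  have "(\<integral>x. (conv f (eta (rad n)) x - f x)\<^sup>2 \<partial>lborel) < e0" if n: "rad n < d" for n
  proof -
    let ?r = "rad n"
    note r = rad_pos[of n]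
    note eta = eta_nonneg[OF r, where 'a='a] eta_test_function[OF r]
    have out: "conv g (eta ?r) x - g x = 0" if "x \<notin> cball 0 (R + 1)" for x
    proof -
      have "g y * eta ?r (x - y) = 0" for y
      proof (cases "y \<in> K")
        case True
        then have "norm y \<le> R" using R by auto
        then have "norm (x - y) \<ge> 1" using that norm_triangle_ineq2[of x y] by simp
        then show ?thesis using eta_eq_0[OF r, of "x - y"] rad_le_1[of n] by simp
      qed (use g(3) in auto)
      moreover have "g x = 0" using g(3)[of x] R that by fastforce
      ultimately show ?thesis unfolding conv_def by (simp only: Bochner_Integration.integral_zero)
    qed
    have un: "\<bar>conv g (eta ?r) x - g x\<bar> \<le> e'" for x
      by (rule conv_eta_uniform[OF g r]) (use d n in auto)
    have ball: "integrable lborel (\<lambda>x::'a. indicator (cball 0 (R + 1)) x * e'\<^sup>2)"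
      using emeasure_bounded_finite[of "cball (0::'a) (R + 1)"]
      by (intro integrable_mult_left integrable_real_indicator) simp_all
    have bd: "(conv g (eta ?r) x - g x)\<^sup>2 \<le> indicator (cball 0 (R + 1)) x * e'\<^sup>2" for x
      using power_mono[OF un, of x 2] out[of x] by (auto simp: indicator_def)
    have s2: "sqint (\<lambda>x. conv g (eta ?r) x - g x)"
      by (intro sqint_diff sg conv_eta_contraction(1)[OF r sg ig])
    have "(\<integral>x. (conv g (eta ?r) x - g x)\<^sup>2 \<partial>lborel) \<le> (\<integral>x. indicator (cball (0::'a) (R + 1)) x * e'\<^sup>2 \<partial>lborel)"
      by (rule integral_mono[OF sqint_integrable_sq[OF s2] ball bd])
    also have "\<dots> = V * e'\<^sup>2" by (simp add: V_def)
    also have "\<dots> = (V / (V + 1)) * e" using \<open>e > 0\<close> \<open>V \<ge> 0\<close> by (simp add: e'_def)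
    also have "\<dots> \<le> 1 * e" using \<open>e > 0\<close> \<open>V \<ge> 0\<close> by (intro mult_right_mono) auto
    finally have m: "(\<integral>x. (conv g (eta ?r) x - g x)\<^sup>2 \<partial>lborel) \<le> e" by simp
    have sfg: "sqint (\<lambda>x. f x - g x)" by (rule sqint_diff[OF f(1) sg])
    have ifg: "integrable lborel (\<lambda>x. f x - g x)" using f(2) ig by simp
    have s1: "sqint (conv (\<lambda>x. f x - g x) (eta ?r))"
      by (rule conv_eta_contraction(1)[OF r sfg ifg])
    have l: "(\<integral>x. (conv (\<lambda>x. f x - g x) (eta ?r) x)\<^sup>2 \<partial>lborel) < e"
      using conv_eta_contraction(2)[OF r sfg ifg] fg by simp
    have eq: "conv f (eta ?r) x - f x = conv (\<lambda>x. f x - g x) (eta ?r) x + (conv g (eta ?r) x - g x - (f x - g x))" for x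
      using conv_diff_left[OF f(2) ig eta(2), of x] by simp
    have "(\<integral>x. (conv f (eta ?r) x - f x)\<^sup>2 \<partial>lborel)
       \<le> (\<integral>x. 2 * (conv (\<lambda>x. f x - g x) (eta ?r) x)\<^sup>2 + (4 * (conv g (eta ?r) x - g x)\<^sup>2 + 4 * (f x - g x)\<^sup>2) \<partial>lborel)"
    proof (rule integral_mono)
      show "integrable lborel (\<lambda>x. (conv f (eta ?r) x - f x)\<^sup>2)"
        by (intro sqint_integrable_sq sqint_diff f(1) conv_eta_contraction(1)[OF r f])
      show "integrable lborel (\<lambda>x. 2 * (conv (\<lambda>x. f x - g x) (eta ?r) x)\<^sup>2
          + (4 * (conv g (eta ?r) x - g x)\<^sup>2 + 4 * (f x - g x)\<^sup>2))"
        by (intro Bochner_Integration.integrable_add integrable_mult_right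
            sqint_integrable_sq[OF s1] sqint_integrable_sq[OF s2] sqint_integrable_sq[OF sfg])
      show "(conv f (eta ?r) x - f x)\<^sup>2 \<le> 2 * (conv (\<lambda>x. f x - g x) (eta ?r) x)\<^sup>2
          + (4 * (conv g (eta ?r) x - g x)\<^sup>2 + 4 * (f x - g x)\<^sup>2)" for x
        unfolding eq using sq_add_le[of "conv (\<lambda>x. f x - g x) (eta ?r) x" "conv g (eta ?r) x - g x - (f x - g x)"]
          sq_add_le[of "conv g (eta ?r) x - g x" "- (f x - g x)"]
        by (simp add: power2_commute[of "g x" "f x"])
    qed
    also have "\<dots> = 2 * (\<integral>x. (conv (\<lambda>x. f x - g x) (eta ?r) x)\<^sup>2 \<partial>lborel)
        + (4 * (\<integral>x. (conv g (eta ?r) x - g x)\<^sup>2 \<partial>lborel) + 4 * (\<integral>x. (f x - g x)\<^sup>2 \<partial>lborel))"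
      using sqint_integrable_sq[OF s1] sqint_integrable_sq[OF s2] sqint_integrable_sq[OF sfg] by simp
    also have "\<dots> < e0" using l m fg \<open>0 < e0\<close> by (simp add: e_def)
    finally show ?thesis .
  qed
  moreover have "\<forall>\<^sub>F n in sequentially. rad n < d"
    using rad_tendsto \<open>d > 0\<close> by (rule order_tendstoD)
  ultimately show "\<forall>\<^sub>F n in sequentially. (\<integral>x. (conv f (eta (rad n)) x - f x)\<^sup>2 \<partial>lborel) < e0"
    by (auto elim: eventually_mono)
qed

lemma sqint_tendsto_integral_mult:
  assumes fn: "\<And>n. sqint (fn n)" "sqint f" "(\<lambda>n. \<integral>x. (fn n x - f x)\<^sup>2 \<partial>lborel) \<longlonglongrightarrow> 0"
    and g: "sqint g"
  shows "(\<lambda>n. \<integral>x. g x * fn n x \<partial>lborel) \<longlonglongrightarrow> (\<integral>x. g x * f x \<partial>lborel)"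
proof -
  have "(\<lambda>n. (\<integral>x. g x * fn n x \<partial>lborel) - (\<integral>x. g x * f x \<partial>lborel)) \<longlonglongrightarrow> 0"
  proof (rule tendsto_rabs_zero_cancel, rule tendsto_0_le)
    show "(\<lambda>n. sqrt ((\<integral>x. (g x)\<^sup>2 \<partial>lborel) * (\<integral>x. (fn n x - f x)\<^sup>2 \<partial>lborel))) \<longlonglongrightarrow> 0"
      using tendsto_real_sqrt[OF tendsto_mult_right_zero[OF fn(3)]] by simp
    have "\<bar>(\<integral>x. g x * fn n x \<partial>lborel) - (\<integral>x. g x * f x \<partial>lborel)\<bar>
        \<le> sqrt ((\<integral>x. (g x)\<^sup>2 \<partial>lborel) * (\<integral>x. (fn n x - f x)\<^sup>2 \<partial>lborel))" for n
    proof -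
      have "(\<integral>x. g x * fn n x \<partial>lborel) - (\<integral>x. g x * f x \<partial>lborel) = (\<integral>x. g x * (fn n x - f x) \<partial>lborel)"
        using sqint_mult_integrable[OF g fn(1)] sqint_mult_integrable[OF g fn(2)]
        by (simp add: right_diff_distrib)
      then show ?thesis
        using Cauchy_Schwarz_integral[OF g sqint_diff[OF fn(1)[of n] fn(2)]] by (simp add: real_le_rsqrt)
    qed
    then show "\<forall>\<^sub>F n in sequentially. norm \<bar>(\<integral>x. g x * fn n x \<partial>lborel) - (\<integral>x. g x * f x \<partial>lborel)\<bar>
        \<le> norm (sqrt ((\<integral>x. (g x)\<^sup>2 \<partial>lborel) * (\<integral>x. (fn n x - f x)\<^sup>2 \<partial>lborel))) * 1"
      by (intro always_eventually) auto
  qed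
  then show ?thesis by (simp add: LIM_zero_iff)
qed

subsection \<open>Weak derivatives and the positive part\<close>

text \<open>Whole-space integrals are harmless here: test functions and their derivatives vanish
  outside \<open>S\<close>, so only the values of \<open>f\<close> and \<open>d\<close> on
  \<open>S\<close> enter.\<close>

definition has_weak_pd :: "'a::euclidean_space set \<Rightarrow> 'a \<Rightarrow> ('a \<Rightarrow> real) \<Rightarrow> ('a \<Rightarrow> real) \<Rightarrow> bool" where
  "has_weak_pd S b f d \<longleftrightarrow> (\<forall>\<phi>\<in>test_functions S.
     (\<integral>x. f x * pd b \<phi> x \<partial>lborel) = - (\<integral>x. d x * \<phi> x \<partial>lborel))"

text \<open>The kernel centred at \<open>x\<close> is itself the test function, which requires its
  support to lie in \<open>S\<close>. The sign from differentiating \<open>x - y\<close> cancels the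
  one in the weak formulation.\<close>

lemma conv_eta_weak_pd:
  assumes "has_weak_pd S b f d" "r > 0" "cball x r \<subseteq> S"
  shows "conv f (pd b (eta r)) x = conv d (eta r) x"
proof -
  let ?\<phi> = "\<lambda>y. eta r (x - y)"
  have "pd b ?\<phi> y = - pd b (eta r) (x - y)" for y
  proof -
    have "(?\<phi> has_derivative (\<lambda>h. frechet_derivative (eta r) (at (x - y)) (- h))) (at y)"
      by (rule has_derivative_compose[of "\<lambda>y. x - y",
            OF _ test_functions_has_derivative[OF eta_test_function[OF assms(2)]]])
         (auto intro!: derivative_eq_intros)
    moreover have "linear (frechet_derivative (eta r) (at (x - y)))"
      using test_functions_has_derivative[OF eta_test_function[OF assms(2)]] has_derivative_linear by blast
    ultimately show ?thesis by (simp add: frechet_derivative_eqI linear_neg)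
  qed
  moreover have "(\<integral>y. f y * pd b ?\<phi> y \<partial>lborel) = - (\<integral>y. d y * ?\<phi> y \<partial>lborel)"
    using assms eta_test_function_shift[OF assms(2,3)] by (simp add: has_weak_pd_def)
  ultimately show ?thesis by (simp add: conv_def)
qed

text \<open>Cauchy-Schwarz in the form shared by the three error terms of the chain rule: a fixed L2
  weight times a factor that tends to 0 in L2.\<close>

lemma sqint_tendsto_integral_0:
  assumes fn: "\<And>n. sqint (fn n)" "sqint f" "(\<lambda>n. \<integral>x. (fn n x - f x)\<^sup>2 \<partial>lborel) \<longlonglongrightarrow> 0"
    and w: "sqint w" and h: "\<And>n x. \<bar>h n x\<bar> \<le> C * (\<bar>w x\<bar> * \<bar>fn n x - f x\<bar>)"
    and m: "\<And>n. h n \<in> borel_measurable borel"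
  shows "(\<lambda>n. \<integral>x. h n x \<partial>lborel) \<longlonglongrightarrow> 0"
proof (rule tendsto_rabs_zero_cancel)
  have a: "sqint (\<lambda>x. \<bar>fn n x - f x\<bar>)" for n
    using sqint_diff[OF fn(1)[of n] fn(2)] by (auto simp: sqint_def)
  have w': "sqint (\<lambda>x. \<bar>w x\<bar>)" using w by (auto simp: sqint_def)
  have "(\<lambda>n. \<integral>x. \<bar>w x\<bar> * \<bar>fn n x - f x\<bar> \<partial>lborel) \<longlonglongrightarrow> (\<integral>x. \<bar>w x\<bar> * 0 \<partial>lborel)"
    by (rule sqint_tendsto_integral_mult[OF a _ _ w']) (use fn(3) in \<open>simp_all add: sqint_def\<close>)
  then have lim: "(\<lambda>n. C * (\<integral>x. \<bar>w x\<bar> * \<bar>fn n x - f x\<bar> \<partial>lborel)) \<longlonglongrightarrow> 0"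
    by (intro tendsto_mult_right_zero) simp
  have le: "\<bar>\<integral>x. h n x \<partial>lborel\<bar> \<le> C * (\<integral>x. \<bar>w x\<bar> * \<bar>fn n x - f x\<bar> \<partial>lborel)" for n
  proof -
    have i: "integrable lborel (\<lambda>x. C * (\<bar>w x\<bar> * \<bar>fn n x - f x\<bar>))"
      using sqint_mult_integrable[OF w' a] by simp
    have "integrable lborel (h n)"
      by (rule Bochner_Integration.integrable_bound[OF i])
         (use h[of n] m order_trans[OF _ abs_ge_self] in \<open>auto intro!: AE_I2\<close>)
    then have "(\<integral>x. \<bar>h n x\<bar> \<partial>lborel) \<le> (\<integral>x. C * (\<bar>w x\<bar> * \<bar>fn n x - f x\<bar>) \<partial>lborel)"
      using h i by (intro integral_mono) auto
    also have "\<dots> = C * (\<integral>x. \<bar>w x\<bar> * \<bar>fn n x - f x\<bar> \<partial>lborel)" by simp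
    finally show ?thesis by (rule order_trans[OF integral_abs_bound])
  qed
  show "(\<lambda>n. \<bar>\<integral>x. h n x \<partial>lborel\<bar>) \<longlonglongrightarrow> 0"
    by (rule tendsto_sandwich[OF _ _ tendsto_const lim]) (use le in auto)
qed

text \<open>The classical chain rule holds for the mollifications, and on the compact support of
  \<open>\<phi>\<close> their derivative is the mollified \<open>d\<close> once the radius is small.
  In the limit, boundedness of \<open>\<beta>'\<close> handles the convergence of the derivatives
  and its Lipschitz bound the convergence inside \<open>\<beta>'\<close>.\<close>

lemma has_weak_pd_chain:
  fixes f :: "'a::euclidean_space \<Rightarrow> real"
  assumes S: "open S" and b: "b \<in> Basis"
    and f: "sqint f" "integrable lborel f" and d: "sqint d" "integrable lborel d"
    and wd: "has_weak_pd S b f d"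
    and \<beta>: "\<And>s. (\<beta> has_field_derivative \<beta>' s) (at s)" "\<And>s. \<bar>\<beta>' s\<bar> \<le> 1"
      "\<And>s t. \<bar>\<beta>' s - \<beta>' t\<bar> \<le> L * \<bar>s - t\<bar>"
  shows "has_weak_pd S b (\<lambda>x. \<beta> (f x)) (\<lambda>x. \<beta>' (f x) * d x)"
  unfolding has_weak_pd_def
proof
  fix \<phi> assume \<phi>: "\<phi> \<in> test_functions S"
  have pd\<phi>: "pd b \<phi> \<in> test_functions S" by (rule test_functions_pd[OF \<phi> b])
  obtain K where K: "compact K" "K \<subseteq> S" "\<And>x. x \<notin> K \<Longrightarrow> \<phi> x = 0"
    using \<phi> by (rule test_functionsE) blast
  obtain e where e: "e > 0" "(\<Union>x\<in>K. cball x e) \<subseteq> S"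
    using compact_subset_open_imp_cball_epsilon_subset[OF K(1) S K(2)] by metis
  have \<beta>lip: "\<bar>\<beta> s - \<beta> t\<bar> \<le> \<bar>s - t\<bar>" for s t
    using field_differentiable_bound[of UNIV \<beta> \<beta>' 1 s t] \<beta>(1,2) by simp
  have L: "0 \<le> L" using order_trans[OF abs_ge_zero \<beta>(3)[of 1 0]] by simp
  have c\<beta>: "continuous_on UNIV \<beta>"
    using \<beta>(1) DERIV_isCont by (auto intro!: continuous_at_imp_continuous_on)
  have c\<beta>': "continuous_on UNIV \<beta>'"
  proof (rule continuous_onI)
    fix s e :: real assume "e > 0"
    show "\<exists>d>0. \<forall>t\<in>UNIV. dist t s < d \<longrightarrow> dist (\<beta>' t) (\<beta>' s) \<le> e"
    proof (intro exI[of _ "e / (L + 1)"] conjI ballI impI)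
      fix t assume "dist t s < e / (L + 1)"
      then have "(L + 1) * \<bar>t - s\<bar> \<le> e" using L by (simp add: dist_real_def field_simps)
      moreover have "L * \<bar>t - s\<bar> \<le> (L + 1) * \<bar>t - s\<bar>" by (simp add: mult_right_mono)
      ultimately show "dist (\<beta>' t) (\<beta>' s) \<le> e" using \<beta>(3)[of t s] by (simp add: dist_real_def)
    qed (use \<open>e > 0\<close> L in auto)
  qed
  have [measurable]: "\<beta> \<in> borel_measurable borel" "\<beta>' \<in> borel_measurable borel"
    using c\<beta> c\<beta>' by (auto intro: borel_measurable_continuous_onI)
  have [measurable]: "\<phi> \<in> borel_measurable borel" "pd b \<phi> \<in> borel_measurable borel"
    "f \<in> borel_measurable borel" "d \<in> borel_measurable borel"
    using test_functions_measurable[OF \<phi>] test_functions_measurable[OF pd\<phi>] f d by auto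
  define fn where "fn n = conv f (eta (rad n))" for n
  define dn where "dn n = conv d (eta (rad n))" for n
  have sfn: "sqint (fn n)" and sdn: "sqint (dn n)" for n
    unfolding fn_def dn_def by (intro conv_eta_contraction(1)[OF rad_pos] f d)+
  then have [measurable]: "fn n \<in> borel_measurable borel" "dn n \<in> borel_measurable borel" for n
    by auto
  have fn: "(\<lambda>n. \<integral>x. (fn n x - f x)\<^sup>2 \<partial>lborel) \<longlonglongrightarrow> 0"
    and dn: "(\<lambda>n. \<integral>x. (dn n x - d x)\<^sup>2 \<partial>lborel) \<longlonglongrightarrow> 0"
    unfolding fn_def dn_def by (rule conv_eta_tendsto[OF f], rule conv_eta_tendsto[OF d])
  obtain B where B: "0 \<le> B" "\<And>x. \<bar>\<phi> x\<bar> \<le> B" using test_functions_bounded[OF \<phi>] by metis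
  have s\<phi>: "sqint \<phi>" "sqint (pd b \<phi>)" using sqint_test_function \<phi> pd\<phi> by auto
  have d\<phi>: "sqint (\<lambda>x. \<phi> x * d x)" by (rule sqint_mult_bounded[OF d(1) _ B(2)]) measurable
  have parts: "(\<integral>x. \<beta> (fn n x) * pd b \<phi> x \<partial>lborel) = - (\<integral>x. \<beta>' (fn n x) * dn n x * \<phi> x \<partial>lborel)"
    if n: "rad n < e" for n
  proof -
    let ?r = "rad n"
    have et: "eta ?r \<in> test_functions UNIV" by (rule eta_test_function[OF rad_pos])
    let ?D = "\<lambda>x h. \<Sum>b\<in>Basis. conv f (pd b (eta ?r)) x * (h \<bullet> b)"
    have Db: "?D x b = conv f (pd b (eta ?r)) x" for x
      using conv_pd[OF f(2) et b, of x] frechet_derivative_eqI[OF conv_has_derivative[OF f(2) et, of x]]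
      by simp
    have "((\<lambda>x. \<beta> (fn n x)) has_derivative (\<lambda>h. \<beta>' (fn n x) * ?D x h)) (at x)" for x
      unfolding fn_def
      by (rule has_derivative_compose[OF conv_has_derivative[OF f(2) et] \<beta>(1)[unfolded has_field_derivative_def]])
    moreover have "continuous_on UNIV (\<lambda>x. \<beta>' (fn n x) * ?D x b)"
      unfolding Db fn_def
      by (intro continuous_on_mult continuous_on_compose2[OF c\<beta>'] conv_continuous f et test_functions_pd b) auto
    ultimately have "(\<integral>x. \<beta> (fn n x) * pd b \<phi> x \<partial>lborel) = - (\<integral>x. (\<beta>' (fn n x) * ?D x b) * \<phi> x \<partial>lborel)"
      by (rule integral_by_parts[OF _ _ test_functions_has_derivative[OF \<phi>]
          test_functions_continuous[OF pd\<phi>] K(1,3)])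
    also have "(\<lambda>x. (\<beta>' (fn n x) * ?D x b) * \<phi> x) = (\<lambda>x. \<beta>' (fn n x) * dn n x * \<phi> x)"
    proof
      fix x show "(\<beta>' (fn n x) * ?D x b) * \<phi> x = \<beta>' (fn n x) * dn n x * \<phi> x"
      proof (cases "x \<in> K")
        case True
        then have "cball x ?r \<subseteq> S" using e(2) n by force
        then show ?thesis
          unfolding Db using conv_eta_weak_pd[OF wd rad_pos] by (simp add: dn_def)
      qed (use K(3) in simp)
    qed
    finally show ?thesis .
  qed
  have i\<beta>: "integrable lborel (\<lambda>x. \<beta> (g x) * pd b \<phi> x)" if g: "sqint g" for g
  proof -
    have [measurable]: "g \<in> borel_measurable borel" using g by auto
    \<comment> \<open>A nonzero constant is not square integrable on the whole space, so
      \<open>\<beta> 0\<close> is split off and paired with the integrable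
      \<open>pd b \<phi>\<close>.\<close>
    have "sqint (\<lambda>x. \<beta> (g x) - \<beta> 0)"
      by (rule sqint_bound[OF sqint_integrable_sq[OF g]])
         (use power_mono[OF \<beta>lip, of _ 0 2] in auto)
    then have "integrable lborel (\<lambda>x. (\<beta> (g x) - \<beta> 0) * pd b \<phi> x + \<beta> 0 * pd b \<phi> x)"
      using sqint_mult_integrable[OF _ s\<phi>(2)] test_functions_integrable[OF pd\<phi>] by auto
    then show ?thesis by (simp add: algebra_simps)
  qed
  have i\<beta>': "integrable lborel (\<lambda>x. \<beta>' (g x) * c x * \<phi> x)" if "sqint c" "sqint g" for c g
  proof -
    have [measurable]: "g \<in> borel_measurable borel" using that by auto
    have "sqint (\<lambda>x. \<beta>' (g x) * c x)"
      by (rule sqint_mult_bounded[OF that(1) _ \<beta>(2)]) measurable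
    then show ?thesis by (rule sqint_mult_integrable[OF _ s\<phi>(1)])
  qed
  have "(\<lambda>n. \<integral>x. (\<beta> (fn n x) - \<beta> (f x)) * pd b \<phi> x \<partial>lborel) \<longlonglongrightarrow> 0"
  proof (rule sqint_tendsto_integral_0[OF sfn f(1) fn s\<phi>(2), of _ 1])
    show "\<bar>(\<beta> (fn n x) - \<beta> (f x)) * pd b \<phi> x\<bar> \<le> 1 * (\<bar>pd b \<phi> x\<bar> * \<bar>fn n x - f x\<bar>)" for n x
      using mult_left_mono[OF \<beta>lip abs_ge_zero] by (simp add: abs_mult mult.commute)
  qed measurable
  then have l1: "(\<lambda>n. (\<integral>x. \<beta> (fn n x) * pd b \<phi> x \<partial>lborel) - (\<integral>x. \<beta> (f x) * pd b \<phi> x \<partial>lborel)) \<longlonglongrightarrow> 0"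
    using i\<beta>[OF sfn] i\<beta>[OF f(1)] by (simp add: left_diff_distrib)
  have r1: "(\<lambda>n. \<integral>x. \<beta>' (fn n x) * (dn n x - d x) * \<phi> x \<partial>lborel) \<longlonglongrightarrow> 0"
  proof (rule sqint_tendsto_integral_0[OF sdn d(1) dn s\<phi>(1), of _ 1])
    show "\<bar>\<beta>' (fn n x) * (dn n x - d x) * \<phi> x\<bar> \<le> 1 * (\<bar>\<phi> x\<bar> * \<bar>dn n x - d x\<bar>)" for n x
      using mult_right_mono[OF \<beta>(2)[of "fn n x"], of "\<bar>\<phi> x\<bar> * \<bar>dn n x - d x\<bar>"]
      by (simp add: abs_mult mult_ac)
  qed measurable
  have r2: "(\<lambda>n. \<integral>x. (\<beta>' (fn n x) - \<beta>' (f x)) * d x * \<phi> x \<partial>lborel) \<longlonglongrightarrow> 0"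
  proof (rule sqint_tendsto_integral_0[OF sfn f(1) fn d\<phi>, of _ L])
    show "\<bar>(\<beta>' (fn n x) - \<beta>' (f x)) * d x * \<phi> x\<bar> \<le> L * (\<bar>\<phi> x * d x\<bar> * \<bar>fn n x - f x\<bar>)" for n x
      using mult_right_mono[OF \<beta>(3)[of "fn n x" "f x"], of "\<bar>\<phi> x * d x\<bar>"]
      by (simp add: abs_mult mult_ac)
  qed measurable
  \<comment> \<open>One factor changes at a time: first \<open>dn n\<close> to \<open>d\<close>,
    then \<open>fn n\<close> to \<open>f\<close> inside \<open>\<beta>'\<close>.\<close>
  have "(\<integral>x. \<beta>' (fn n x) * dn n x * \<phi> x \<partial>lborel) - (\<integral>x. \<beta>' (f x) * d x * \<phi> x \<partial>lborel)
     = (\<integral>x. \<beta>' (fn n x) * (dn n x - d x) * \<phi> x \<partial>lborel) + (\<integral>x. (\<beta>' (fn n x) - \<beta>' (f x)) * d x * \<phi> x \<partial>lborel)" for n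
    using i\<beta>'[OF sdn[of n] sfn[of n]] i\<beta>'[OF d(1) f(1)] i\<beta>'[OF d(1) sfn[of n]]
    by (simp add: left_diff_distrib right_diff_distrib)
  with tendsto_add[OF r1 r2]
  have "(\<lambda>n. (\<integral>x. \<beta>' (fn n x) * dn n x * \<phi> x \<partial>lborel) - (\<integral>x. \<beta>' (f x) * d x * \<phi> x \<partial>lborel)) \<longlonglongrightarrow> 0"
    by simp
  then have l2: "(\<lambda>n. - (\<integral>x. \<beta>' (fn n x) * dn n x * \<phi> x \<partial>lborel)) \<longlonglongrightarrow> - (\<integral>x. \<beta>' (f x) * d x * \<phi> x \<partial>lborel)"
    by (intro tendsto_minus) (simp add: LIM_zero_iff)
  have "\<forall>\<^sub>F n in sequentially. rad n < e" using rad_tendsto e(1) by (rule order_tendstoD)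
  then have "(\<lambda>n. \<integral>x. \<beta> (fn n x) * pd b \<phi> x \<partial>lborel) \<longlonglongrightarrow> - (\<integral>x. \<beta>' (f x) * d x * \<phi> x \<partial>lborel)"
    by (intro Lim_transform_eventually[OF l2]) (auto elim!: eventually_mono simp: parts)
  moreover have "(\<lambda>n. \<integral>x. \<beta> (fn n x) * pd b \<phi> x \<partial>lborel) \<longlonglongrightarrow> (\<integral>x. \<beta> (f x) * pd b \<phi> x \<partial>lborel)"
    using l1 by (simp add: LIM_zero_iff)
  ultimately show "(\<integral>x. \<beta> (f x) * pd b \<phi> x \<partial>lborel) = - (\<integral>x. \<beta>' (f x) * d x * \<phi> x \<partial>lborel)"
    using LIMSEQ_unique by blast
qed

text \<open>The value \<open>1/2\<close> at 0 is the derivative at 0 of the smooth approximations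
  \<open>(s + sqrt (s\<^sup>2 + \<epsilon>\<^sup>2)) / 2\<close> of the positive part; only \<open>0 \<le> heaviside\<close> matters later.\<close>

definition heaviside :: "real \<Rightarrow> real" where "heaviside s = (1 + sgn s) / 2"

lemma heaviside_bounds: "0 \<le> heaviside s" "\<bar>heaviside s\<bar> \<le> 1"
  by (auto simp: heaviside_def sgn_if)

lemma heaviside_measurable [measurable]: "heaviside \<in> borel_measurable borel"
  unfolding heaviside_def[abs_def] by measurable

text \<open>The roots are the norms of \<open>(s, c)\<close> and \<open>(t, c)\<close> in the plane,
  so this is the reverse triangle inequality.\<close>

lemma sqrt_sq_add_Lipschitz: "\<bar>sqrt (s\<^sup>2 + c\<^sup>2) - sqrt (t\<^sup>2 + c\<^sup>2)\<bar> \<le> \<bar>s - t\<bar>"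
proof -
  have "\<bar>norm (s, c) - norm (t, c)\<bar> \<le> norm ((s, c) - (t, c))" by (rule norm_triangle_ineq3)
  then show ?thesis by (simp add: norm_Pair)
qed

text \<open>The chain rule is applied to smooth approximations of the positive part with parameter
  \<open>c = rad n\<close>. The Lipschitz constant \<open>1 / c\<close> of their derivatives blows
  up, but it enters only for each fixed \<open>n\<close>; the limit relies on the bounds
  \<open>|\<beta>'| \<le> 1\<close> and \<open>|\<beta> (f x)| \<le> |f x| + 1\<close>, uniform in
  \<open>n\<close>.\<close>

lemma has_weak_pd_positive_part:
  fixes f :: "'a::euclidean_space \<Rightarrow> real"
  assumes S: "open S" and b: "b \<in> Basis"
    and f: "sqint f" "integrable lborel f" and d: "sqint d" "integrable lborel d"
    and wd: "has_weak_pd S b f d"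
  shows "has_weak_pd S b (\<lambda>x. max (f x) 0) (\<lambda>x. heaviside (f x) * d x)"
  unfolding has_weak_pd_def
proof
  fix \<phi> assume \<phi>: "\<phi> \<in> test_functions S"
  have pd\<phi>: "pd b \<phi> \<in> test_functions S" by (rule test_functions_pd[OF \<phi> b])
  have [measurable]: "\<phi> \<in> borel_measurable borel" "pd b \<phi> \<in> borel_measurable borel"
    "f \<in> borel_measurable borel" "d \<in> borel_measurable borel"
    using test_functions_measurable[OF \<phi>] test_functions_measurable[OF pd\<phi>] f d by auto
  define \<beta> where "\<beta> c s = (s + sqrt (s\<^sup>2 + c\<^sup>2)) / 2" for c s :: real
  define \<beta>' where "\<beta>' c s = (1 + s / sqrt (s\<^sup>2 + c\<^sup>2)) / 2" for c s :: real
  have pos: "s\<^sup>2 + c\<^sup>2 > 0" if "c > 0" for s c :: real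
    using that by (simp add: add_nonneg_pos)
  have [measurable]: "\<beta> c \<in> borel_measurable borel" "\<beta>' c \<in> borel_measurable borel" for c
    unfolding \<beta>_def \<beta>'_def by measurable
  have der: "(\<beta> c has_field_derivative \<beta>' c s) (at s)" if "c > 0" for c s
  proof -
    have "((\<lambda>s. s\<^sup>2 + c\<^sup>2) has_field_derivative 2 * s) (at s)"
      by (auto intro!: derivative_eq_intros)
    then have "((\<lambda>s. sqrt (s\<^sup>2 + c\<^sup>2)) has_field_derivative inverse (sqrt (s\<^sup>2 + c\<^sup>2)) / 2 * (2 * s)) (at s)"
      by (rule DERIV_chain2[where f = sqrt, rotated]) (rule DERIV_real_sqrt[OF pos[OF that]])
    then have "((\<lambda>s. (s + sqrt (s\<^sup>2 + c\<^sup>2)) / 2) has_field_derivative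
        (1 + inverse (sqrt (s\<^sup>2 + c\<^sup>2)) / 2 * (2 * s)) / 2) (at s)"
      by (rule DERIV_cdivide[OF DERIV_add[OF DERIV_ident]])
    moreover have "inverse a / 2 * (2 * s) = s / a" for a :: real
      by (cases "a = 0") (simp_all add: field_simps)
    moreover have "\<beta> c = (\<lambda>s. (s + sqrt (s\<^sup>2 + c\<^sup>2)) / 2)"
      by (rule ext) (rule \<beta>_def)
    ultimately show ?thesis by (simp only: \<beta>'_def)
  qed
  have abs_le: "\<bar>s\<bar> \<le> sqrt (s\<^sup>2 + c\<^sup>2)" for s c :: real
    by (rule real_le_rsqrt) simp
  have bd: "\<bar>\<beta>' c s\<bar> \<le> 1" for c s
  proof -
    have "\<bar>s / a\<bar> \<le> 1" if "\<bar>s\<bar> \<le> a" for a :: real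
      using that by (auto simp: divide_le_eq_1)
    from this[OF abs_le[of s c]] have "\<bar>s / sqrt (s\<^sup>2 + c\<^sup>2)\<bar> \<le> 1" .
    moreover have "\<bar>(1 + y) / 2\<bar> \<le> 1" if "\<bar>y\<bar> \<le> 1" for y :: real
      using that by (simp add: abs_le_iff)
    ultimately show ?thesis unfolding \<beta>'_def by blast
  qed
  have lip: "\<bar>\<beta>' c s - \<beta>' c t\<bar> \<le> (1 / c) * \<bar>s - t\<bar>" if c: "c > 0" for c s t
  proof -
    define p q where "p = sqrt (s\<^sup>2 + c\<^sup>2)" and "q = sqrt (t\<^sup>2 + c\<^sup>2)"
    have pq: "p > 0" "q > 0" using pos[OF c] by (simp_all add: p_def q_def)
    have "c \<le> p" using abs_le[of c s] c by (simp add: p_def add.commute)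
    have "\<bar>t\<bar> \<le> q" unfolding q_def by (rule abs_le)
    \<comment> \<open>Both numerator terms are at most \<open>|s - t|\<close>, the second since
      \<open>|t / q| \<le> 1\<close> and by the Lipschitz bound for the root; then
      \<open>c \<le> p\<close>.\<close>
    have "s / p - t / q = ((s - t) + (t / q) * (q - p)) / p"
      using pq by (simp add: field_simps)
    moreover have "\<bar>(s - t) + (t / q) * (q - p)\<bar> \<le> \<bar>s - t\<bar> + 1 * \<bar>s - t\<bar>"
    proof (rule order_trans[OF abs_triangle_ineq], rule add_left_mono)
      have "\<bar>q - p\<bar> \<le> \<bar>s - t\<bar>"
        using sqrt_sq_add_Lipschitz[of s c t] by (simp add: p_def q_def)
      then show "\<bar>(t / q) * (q - p)\<bar> \<le> 1 * \<bar>s - t\<bar>"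
        unfolding abs_mult using \<open>\<bar>t\<bar> \<le> q\<close> pq by (intro mult_mono) (auto simp: divide_le_eq_1)
    qed
    ultimately have "\<bar>s / p - t / q\<bar> \<le> (2 * \<bar>s - t\<bar>) / p"
      using pq by (simp add: divide_right_mono)
    also have "\<dots> \<le> (2 * \<bar>s - t\<bar>) / c"
      using \<open>c \<le> p\<close> c by (intro divide_left_mono) auto
    finally have "\<bar>s / p - t / q\<bar> \<le> (2 * \<bar>s - t\<bar>) / c" .
    moreover have "\<bar>\<beta>' c s - \<beta>' c t\<bar> = \<bar>s / p - t / q\<bar> / 2"
      unfolding \<beta>'_def p_def q_def by (simp flip: diff_divide_distrib)
    ultimately show ?thesis by simp
  qed
  have eq: "(\<integral>x. \<beta> (rad n) (f x) * pd b \<phi> x \<partial>lborel) = - (\<integral>x. \<beta>' (rad n) (f x) * d x * \<phi> x \<partial>lborel)" for n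
    using has_weak_pd_chain[OF S b f d wd der[OF rad_pos] bd lip[OF rad_pos], of n] \<phi>
    by (simp add: has_weak_pd_def)
  have s\<phi>: "sqint \<phi>" "sqint (pd b \<phi>)" using sqint_test_function \<phi> pd\<phi> by auto
  have lim1: "(\<lambda>n. \<beta> (rad n) s) \<longlonglongrightarrow> max s 0" for s
  proof -
    have "(\<lambda>n. \<beta> (rad n) s) \<longlonglongrightarrow> (s + sqrt (s\<^sup>2 + 0\<^sup>2)) / 2"
      unfolding \<beta>_def by (intro tendsto_intros rad_tendsto) simp
    moreover have "(s + sqrt (s\<^sup>2 + 0\<^sup>2)) / 2 = max s 0" by auto
    ultimately show ?thesis by simp
  qed
  have lim2: "(\<lambda>n. \<beta>' (rad n) s) \<longlonglongrightarrow> heaviside s" for s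
  proof (cases "s = 0")
    case True
    then show ?thesis by (simp add: \<beta>'_def heaviside_def)
  next
    case False
    have "(\<lambda>n. \<beta>' (rad n) s) \<longlonglongrightarrow> (1 + s / sqrt (s\<^sup>2 + 0\<^sup>2)) / 2"
      unfolding \<beta>'_def using False by (intro tendsto_intros rad_tendsto) auto
    moreover have "(1 + s / sqrt (s\<^sup>2 + 0\<^sup>2)) / 2 = heaviside s" using False by (auto simp: heaviside_def sgn_if)
    ultimately show ?thesis by simp
  qed
  have "(\<lambda>n. \<integral>x. \<beta> (rad n) (f x) * pd b \<phi> x \<partial>lborel) \<longlonglongrightarrow> (\<integral>x. max (f x) 0 * pd b \<phi> x \<partial>lborel)"
  proof (rule integral_dominated_convergence)
    show "integrable lborel (\<lambda>x. \<bar>f x * pd b \<phi> x\<bar> + \<bar>pd b \<phi> x\<bar>)"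
      using sqint_mult_integrable[OF f(1) s\<phi>(2)] test_functions_integrable[OF pd\<phi>] by auto
    show "AE x in lborel. (\<lambda>n. \<beta> (rad n) (f x) * pd b \<phi> x) \<longlonglongrightarrow> max (f x) 0 * pd b \<phi> x"
      using lim1 by (intro AE_I2 tendsto_intros)
    show "AE x in lborel. norm (\<beta> (rad n) (f x) * pd b \<phi> x) \<le> \<bar>f x * pd b \<phi> x\<bar> + \<bar>pd b \<phi> x\<bar>" for n
    proof (rule AE_I2)
      fix x
      have "sqrt ((f x)\<^sup>2 + (rad n)\<^sup>2) \<le> \<bar>f x\<bar> + rad n"
        using sqrt_sum_squares_le_sum_abs[of "f x" "rad n"] rad_pos[of n] by simp
      moreover have "\<bar>(a + q) / 2\<bar> \<le> \<bar>a\<bar> + 1" if "0 \<le> q" "q \<le> \<bar>a\<bar> + rad n" for a q :: real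
        using that rad_le_1[of n] unfolding abs_le_iff by (auto simp: field_simps)
      ultimately have "\<bar>\<beta> (rad n) (f x)\<bar> \<le> \<bar>f x\<bar> + 1"
        unfolding \<beta>_def by simp
      then have "\<bar>\<beta> (rad n) (f x)\<bar> * \<bar>pd b \<phi> x\<bar> \<le> (\<bar>f x\<bar> + 1) * \<bar>pd b \<phi> x\<bar>"
        by (rule mult_right_mono) simp
      then show "norm (\<beta> (rad n) (f x) * pd b \<phi> x) \<le> \<bar>f x * pd b \<phi> x\<bar> + \<bar>pd b \<phi> x\<bar>"
        by (simp add: abs_mult distrib_right)
    qed
  qed measurable
  moreover have "(\<lambda>n. \<integral>x. \<beta>' (rad n) (f x) * d x * \<phi> x \<partial>lborel) \<longlonglongrightarrow> (\<integral>x. heaviside (f x) * d x * \<phi> x \<partial>lborel)"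
  proof (rule integral_dominated_convergence)
    show "integrable lborel (\<lambda>x. \<bar>d x * \<phi> x\<bar>)"
      using sqint_mult_integrable[OF d(1) s\<phi>(1)] by auto
    show "AE x in lborel. (\<lambda>n. \<beta>' (rad n) (f x) * d x * \<phi> x) \<longlonglongrightarrow> heaviside (f x) * d x * \<phi> x"
      using lim2 by (intro AE_I2 tendsto_intros)
    show "AE x in lborel. norm (\<beta>' (rad n) (f x) * d x * \<phi> x) \<le> \<bar>d x * \<phi> x\<bar>" for n
      by (intro AE_I2) (simp add: abs_mult mult.assoc mult_left_le_one_le bd)
  qed measurable
  ultimately show "(\<integral>x. max (f x) 0 * pd b \<phi> x \<partial>lborel) = - (\<integral>x. heaviside (f x) * d x * \<phi> x \<partial>lborel)"
    unfolding eq using LIMSEQ_unique tendsto_minus by blast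
qed

subsection \<open>Comparison with a smooth supersolution\<close>

lemma sqint_indicator_continuous:
  fixes g :: "'a::euclidean_space \<Rightarrow> real"
  assumes g: "continuous_on UNIV g" and S: "bounded S" "S \<in> sets borel"
  shows "sqint (\<lambda>x. indicator S x * g x)"
proof (rule sqint_bound)
  have [measurable]: "g \<in> borel_measurable borel" using g by (rule borel_measurable_continuous_onI)
  show "integrable lborel (\<lambda>x. indicator (closure S) x *\<^sub>R (g x)\<^sup>2)"
    using S g by (intro borel_integrable_compact) (auto intro!: continuous_intros intro: continuous_on_subset)
  show "(indicator S x * g x)\<^sup>2 \<le> indicator (closure S) x *\<^sub>R (g x)\<^sup>2" for x
    using closure_subset[of S] by (auto simp: indicator_def)
  show "(\<lambda>x. indicator S x * g x) \<in> borel_measurable borel" using S by measurable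
qed

text \<open>Classical integration by parts handles \<open>w\<close>. The indicator makes the
  difference square integrable on bounded \<open>S\<close> although \<open>w\<close> may grow, and
  it is invisible to test functions supported in \<open>S\<close>.\<close>

lemma has_weak_pd_diff_smooth:
  fixes u w :: "'a::euclidean_space \<Rightarrow> real"
  assumes S: "open S" and b: "b \<in> Basis"
    and u: "sqint u" "sqint D" "has_weak_pd S b u D"
    and w: "\<And>x. (w has_derivative w' x) (at x)" "continuous_on UNIV (\<lambda>x. w' x b)"
  shows "has_weak_pd S b (\<lambda>x. indicator S x * (u x - w x)) (\<lambda>x. indicator S x * (D x - w' x b))"
  unfolding has_weak_pd_def
proof
  fix \<phi> assume \<phi>: "\<phi> \<in> test_functions S"
  have pd\<phi>: "pd b \<phi> \<in> test_functions S" by (rule test_functions_pd[OF \<phi> b])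
  obtain K where K: "compact K" "K \<subseteq> S" "\<And>x. x \<notin> K \<Longrightarrow> \<phi> x = 0"
    using \<phi> by (rule test_functionsE) blast
  have out: "pd b \<phi> x = 0" if "x \<notin> K" for x
    using frechet_derivative_outside[of K \<phi> x] K that by (simp add: compact_imp_closed)
  have c: "continuous_on UNIV w"
    by (intro continuous_at_imp_continuous_on ballI has_derivative_continuous[OF w(1)])
  have i1: "integrable lborel (\<lambda>x. w x * pd b \<phi> x)"
    by (rule continuous_compact_support_integrable[OF continuous_on_mult[OF c test_functions_continuous[OF pd\<phi>]] K(1)])
       (simp add: out)
  have i2: "integrable lborel (\<lambda>x. w' x b * \<phi> x)"
    by (rule continuous_compact_support_integrable[OF continuous_on_mult[OF w(2) test_functions_continuous[OF \<phi>]] K(1)])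
       (simp add: K(3))
  have i3: "integrable lborel (\<lambda>x. u x * pd b \<phi> x)" "integrable lborel (\<lambda>x. D x * \<phi> x)"
    using u sqint_test_function[OF \<phi>] sqint_test_function[OF pd\<phi>] by (auto intro: sqint_mult_integrable)
  have "(\<integral>x. indicator S x * (u x - w x) * pd b \<phi> x \<partial>lborel) = (\<integral>x. u x * pd b \<phi> x - w x * pd b \<phi> x \<partial>lborel)"
    using out K(2) by (intro Bochner_Integration.integral_cong) (auto simp: indicator_def algebra_simps)
  also have "\<dots> = - (\<integral>x. D x * \<phi> x \<partial>lborel) + (\<integral>x. w' x b * \<phi> x \<partial>lborel)"
    using i1 i3 u(3) \<phi> integral_by_parts[OF w test_functions_has_derivative[OF \<phi>]
        test_functions_continuous[OF pd\<phi>] K(1,3)]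
    by (simp add: has_weak_pd_def)
  also have "\<dots> = - (\<integral>x. D x * \<phi> x - w' x b * \<phi> x \<partial>lborel)"
    using i2 i3 by simp
  also have "(\<integral>x. D x * \<phi> x - w' x b * \<phi> x \<partial>lborel) = (\<integral>x. indicator S x * (D x - w' x b) * \<phi> x \<partial>lborel)"
    using K(2,3) by (intro Bochner_Integration.integral_cong) (auto simp: indicator_def algebra_simps)
  finally show "(\<integral>x. indicator S x * (u x - w x) * pd b \<phi> x \<partial>lborel)
      = - (\<integral>x. indicator S x * (D x - w' x b) * \<phi> x \<partial>lborel)" .
qed

text \<open>If \<open>Z = max (u - w) 0\<close> has compact support in \<open>S\<close>, then its mollifications are admissible
  test functions, whose gradients converge to the weak gradient of \<open>Z\<close>; in the limit
  \<open>0 \<le> \<integral>\<nabla>(u - w) \<bullet> \<nabla>Z \<le> - M \<integral>(u\<^sup>p - w\<^sup>p) Z\<close>.\<close>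

lemma comparison:
  fixes u w :: "'a::euclidean_space \<Rightarrow> real" and D w' :: "'a \<Rightarrow> 'a \<Rightarrow> real"
  assumes S: "open S" "bounded S"
    and u: "sqint u" "\<And>x. 0 \<le> u x" "\<And>x. u x \<le> A"
    and D: "\<And>b. b \<in> Basis \<Longrightarrow> sqint (D b)" "\<And>b. b \<in> Basis \<Longrightarrow> has_weak_pd S b u (D b)"
    and sub: "\<And>\<psi>. \<psi> \<in> test_functions S \<Longrightarrow> (\<And>x. 0 \<le> \<psi> x) \<Longrightarrow>
        (\<Sum>b\<in>Basis. \<integral>x. D b x * pd b \<psi> x \<partial>lborel) \<le> - M * (\<integral>x. u x powr p * \<psi> x \<partial>lborel)"
    and w: "\<And>x. (w has_derivative w' x) (at x)"
      "\<And>b x. b \<in> Basis \<Longrightarrow> ((\<lambda>x. w' x b) has_derivative w'' b x) (at x)"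
      "\<And>b. b \<in> Basis \<Longrightarrow> continuous_on UNIV (\<lambda>x. w'' b x b)"
      "\<And>x. 0 < w x" "\<And>x. (\<Sum>b\<in>Basis. w'' b x b) \<le> M * w x powr p"
    and K: "compact K" "K \<subseteq> S" "\<And>x. x \<in> S \<Longrightarrow> x \<notin> K \<Longrightarrow> A < w x"
    and "0 < p" "0 < M"
  shows "AE x in lborel. x \<in> S \<longrightarrow> u x \<le> w x"
proof -
  have Sb: "S \<in> sets borel" using S by auto
  have [measurable]: "u \<in> borel_measurable borel" using u by auto
  have cw: "continuous_on UNIV w"
    by (intro continuous_at_imp_continuous_on ballI has_derivative_continuous[OF w(1)])
  have cw': "continuous_on UNIV (\<lambda>x. w' x b)" if "b \<in> Basis" for b
    by (intro continuous_at_imp_continuous_on ballI has_derivative_continuous[OF w(2)[OF that]])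
  have cwp: "continuous_on UNIV (\<lambda>x. w x powr p)"
    using cw w(4) by (intro continuous_intros) (auto simp: less_imp_neq[symmetric])
  define v where "v x = indicator S x * (u x - w x)" for x
  define e where "e b x = indicator S x * (D b x - w' x b)" for b x
  define Z where "Z x = max (v x) 0" for x
  define dZ where "dZ b x = heaviside (v x) * e b x" for b x
  define q where "q x = indicator S x * (u x powr p - w x powr p)" for x
  have sv: "sqint v"
  proof -
    have "sqint (\<lambda>x. indicator S x * u x - indicator S x * w x)"
      by (intro sqint_diff sqint_mult_bounded[OF u(1), of _ 1] sqint_indicator_continuous cw S Sb)
         (use Sb in \<open>auto simp: indicator_def\<close>)
    then show ?thesis by (simp add: v_def[abs_def] right_diff_distrib)
  qed
  have se: "sqint (e b)" if "b \<in> Basis" for b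
  proof -
    have "sqint (\<lambda>x. indicator S x * D b x - indicator S x * w' x b)"
      by (intro sqint_diff sqint_mult_bounded[OF D(1)[OF that], of _ 1] sqint_indicator_continuous cw' that S Sb)
         (use Sb in \<open>auto simp: indicator_def\<close>)
    then show ?thesis by (simp add: e_def[abs_def] right_diff_distrib)
  qed
  have [measurable]: "v \<in> borel_measurable borel" using sv by auto
  have iv: "integrable lborel v" by (rule sqint_integrable[OF sv S(2) Sb]) (simp add: v_def)
  have ie: "integrable lborel (e b)" if "b \<in> Basis" for b
    by (rule sqint_integrable[OF se[OF that] S(2) Sb]) (simp add: e_def)
  have wdv: "has_weak_pd S b v (e b)" if "b \<in> Basis" for b
    using has_weak_pd_diff_smooth[OF S(1) that u(1) D(1)[OF that] D(2)[OF that] w(1) cw'[OF that]]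
    by (simp add: v_def[abs_def] e_def[abs_def])
  have wdZ: "has_weak_pd S b Z (dZ b)" if "b \<in> Basis" for b
    using has_weak_pd_positive_part[OF S(1) that sv iv se[OF that] ie[OF that] wdv[OF that]]
    by (simp add: Z_def[abs_def] dZ_def[abs_def])
  have sZ: "sqint Z"
    by (rule sqint_bound[OF sqint_integrable_sq[OF sv]]) (auto simp: Z_def[abs_def] max_def)
  have sdZ: "sqint (dZ b)" if "b \<in> Basis" for b
    unfolding dZ_def[abs_def] by (rule sqint_mult_bounded[OF se[OF that] _ heaviside_bounds(2)]) measurable
  \<comment> \<open>Strictness of \<open>A < w x\<close> matters: on \<open>S\<close> outside
    \<open>K\<close> it gives \<open>v x < 0\<close>, where \<open>heaviside\<close> is 0, whereas
    at 0 its value is \<open>1/2\<close>. Outside \<open>S\<close> the indicators do the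
    work.\<close>
  have Z0: "Z x = 0" and dZ0: "dZ b x = 0" if "x \<notin> K" for x b
  proof -
    have "x \<in> S \<Longrightarrow> v x < 0" using K(3)[of x] that u(3)[of x] by (simp add: v_def)
    then show "Z x = 0" "dZ b x = 0"
      by (cases "x \<in> S"; simp add: Z_def dZ_def heaviside_def v_def e_def)+
  qed
  have Kb: "bounded K" "K \<in> sets borel" using K(1) by (auto simp: compact_imp_bounded compact_imp_closed)
  have iZ: "integrable lborel Z" by (rule sqint_integrable[OF sZ Kb Z0])
  have idZ: "integrable lborel (dZ b)" if "b \<in> Basis" for b
    by (rule sqint_integrable[OF sdZ[OF that] Kb dZ0])
  have sq: "sqint q"
  proof -
    have "sqint (\<lambda>x. u x powr p * indicator S x)"
    proof (rule sqint_mult_bounded[OF sqint_indicator[OF S(2) Sb], of _ "A powr p"])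
      show "\<bar>u x powr p\<bar> \<le> A powr p" for x
        using u(2,3) \<open>0 < p\<close> by (simp add: powr_mono2)
    qed measurable
    from sqint_diff[OF this sqint_indicator_continuous[OF cwp S(2) Sb]]
    show ?thesis by (simp add: q_def[abs_def] right_diff_distrib mult.commute)
  qed
  obtain \<epsilon> where \<epsilon>: "\<epsilon> > 0" "(\<Union>x\<in>K. cball x \<epsilon>) \<subseteq> S"
    using compact_subset_open_imp_cball_epsilon_subset[OF K(1) S(1) K(2)] by metis
  have ineq: "(\<Sum>b\<in>Basis. \<integral>x. e b x * conv (dZ b) (eta (rad n)) x \<partial>lborel)
      \<le> - M * (\<integral>x. q x * conv Z (eta (rad n)) x \<partial>lborel)" if n: "rad n < \<epsilon> / 2" for n
  proof -
    let ?r = "rad n"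
    note r = rad_pos[of n]
    have et: "eta ?r \<in> test_functions UNIV" by (rule eta_test_function[OF r])
    define \<psi> where "\<psi> = conv Z (eta ?r)"
    have cb: "cball x (2 * ?r) \<subseteq> S" if "x \<in> K" for x
    proof -
      have "cball x (2 * ?r) \<subseteq> cball x \<epsilon>" using n by (intro subset_cball) simp
      then show ?thesis using \<epsilon>(2) that by blast
    qed
    have \<psi>: "\<psi> \<in> test_functions S"
      unfolding \<psi>_def
    proof (rule conv_test_functions[OF iZ et K(1) Z0 eta_eq_0[OF r]])
      show "cball x ?r \<subseteq> S" if "x \<in> K" for x
        using cb[OF that] subset_cball[of ?r "2 * ?r" x] r by auto
    qed
    have \<psi>nn: "0 \<le> \<psi> x" for x
      unfolding \<psi>_def conv_def by (intro integral_nonneg_AE AE_I2 mult_nonneg_nonneg eta_nonneg[OF r]) (simp add: Z_def)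
    \<comment> \<open>The weak derivative may be mollified only where the ball about
      \<open>x\<close> lies in \<open>S\<close>. Otherwise \<open>x\<close> is farther than
      \<open>?r\<close> from \<open>K\<close>, because balls of twice that radius about points of
      \<open>K\<close> lie in \<open>S\<close>, and both sides vanish.\<close>
    have pd\<psi>: "pd b \<psi> x = conv (dZ b) (eta ?r) x" if b: "b \<in> Basis" for b x
    proof (cases "cball x ?r \<subseteq> S")
      case True
      then show ?thesis
        using conv_pd[OF iZ et b] conv_eta_weak_pd[OF wdZ[OF b] r] by (simp add: \<psi>_def)
    next
      case False
      have far: "?r < norm (x - y)" if "y \<in> K" for y
      proof (rule ccontr)
        assume "\<not> ?r < norm (x - y)"
        then have "cball x ?r \<subseteq> cball y (2 * ?r)"
          by (simp add: cball_subset_cball_iff dist_norm)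
        then show False using False cb[OF that] by auto
      qed
      have "pd b (eta ?r) z = 0" if "?r < norm z" for z :: 'a
      proof -
        have "eta ?r y = 0" if "y \<notin> cball 0 ?r" for y :: 'a
          using that by (intro eta_eq_0[OF r]) simp
        from frechet_derivative_outside[of "cball 0 ?r" "eta ?r" z, OF closed_cball this]
        show ?thesis using that by simp
      qed
      then have "Z y * pd b (eta ?r) (x - y) = 0" "dZ b y * eta ?r (x - y) = 0" for y
        using far[of y] Z0[of y] dZ0[of y b] eta_eq_0[OF r, of "x - y"] by (cases "y \<in> K"; force)+
      then have "conv Z (pd b (eta ?r)) x = 0" "conv (dZ b) (eta ?r) x = 0"
        unfolding conv_def by (simp_all only: Bochner_Integration.integral_zero)
      then show ?thesis using conv_pd[OF iZ et b] by (simp add: \<psi>_def)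
    qed
    obtain L where L: "compact L" "L \<subseteq> S" "\<And>x. x \<notin> L \<Longrightarrow> \<psi> x = 0"
      using \<psi> by (rule test_functionsE) blast
    have out: "pd b \<psi> x = 0" if "x \<notin> L" for b x
      using frechet_derivative_outside[of L \<psi> x] L that by (simp add: compact_imp_closed)
    have pdt: "pd b \<psi> \<in> test_functions S" if "b \<in> Basis" for b
      by (rule test_functions_pd[OF \<psi> that])
    have i1: "integrable lborel (\<lambda>x. w' x b * pd b \<psi> x)" if "b \<in> Basis" for b
      by (rule continuous_compact_support_integrable[OF continuous_on_mult[OF cw'[OF that] test_functions_continuous[OF pdt[OF that]]] L(1)])
         (simp add: out)
    have i2: "integrable lborel (\<lambda>x. w'' b x b * \<psi> x)" if "b \<in> Basis" for b
      by (rule continuous_compact_support_integrable[OF continuous_on_mult[OF w(3)[OF that] test_functions_continuous[OF \<psi>]] L(1)])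
         (simp add: L(3))
    have i3: "integrable lborel (\<lambda>x. D b x * pd b \<psi> x)" if "b \<in> Basis" for b
      using D(1)[OF that] sqint_test_function[OF pdt[OF that]] by (rule sqint_mult_integrable)
    have i4: "integrable lborel (\<lambda>x. w x powr p * \<psi> x)"
      by (rule continuous_compact_support_integrable[OF continuous_on_mult[OF cwp test_functions_continuous[OF \<psi>]] L(1)])
         (simp add: L(3))
    have i5: "integrable lborel (\<lambda>x. q x * \<psi> x)"
      by (rule sqint_mult_integrable[OF sq sqint_test_function[OF \<psi>]])
    \<comment> \<open>This separates the part cancelled by the supersolution inequality of
      \<open>w\<close>; the indicator in \<open>q\<close> does no harm since \<open>\<psi>\<close>
      vanishes outside \<open>S\<close>.\<close>
    have "(\<lambda>x. u x powr p * \<psi> x) = (\<lambda>x. q x * \<psi> x + w x powr p * \<psi> x)"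
    proof
      fix x show "u x powr p * \<psi> x = q x * \<psi> x + w x powr p * \<psi> x"
        using L(2) L(3)[of x] by (cases "x \<in> S") (auto simp: q_def algebra_simps)
    qed
    then have up: "(\<integral>x. u x powr p * \<psi> x \<partial>lborel) = (\<integral>x. q x * \<psi> x \<partial>lborel) + (\<integral>x. w x powr p * \<psi> x \<partial>lborel)"
      using i4 i5 by simp
    have "(\<Sum>b\<in>Basis. \<integral>x. w' x b * pd b \<psi> x \<partial>lborel) = (\<Sum>b\<in>Basis. - (\<integral>x. w'' b x b * \<psi> x \<partial>lborel))"
      by (intro sum.cong refl integral_by_parts[OF w(2) w(3) test_functions_has_derivative[OF \<psi>]
          test_functions_continuous[OF pdt] L(1,3)])
    also have "\<dots> = - (\<integral>x. (\<Sum>b\<in>Basis. w'' b x b) * \<psi> x \<partial>lborel)"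
      using i2 by (simp add: sum_negf sum_distrib_right)
    also have "\<dots> \<ge> - (\<integral>x. M * (w x powr p * \<psi> x) \<partial>lborel)"
    proof -
      have "integrable lborel (\<lambda>x. (\<Sum>b\<in>Basis. w'' b x b) * \<psi> x)"
        unfolding sum_distrib_right using i2 by auto
      then have "(\<integral>x. (\<Sum>b\<in>Basis. w'' b x b) * \<psi> x \<partial>lborel) \<le> (\<integral>x. M * (w x powr p * \<psi> x) \<partial>lborel)"
        using i4 mult_right_mono[OF w(5) \<psi>nn] by (intro integral_mono) (auto simp: mult.assoc)
      then show ?thesis by simp
    qed
    finally have wi: "(\<Sum>b\<in>Basis. \<integral>x. w' x b * pd b \<psi> x \<partial>lborel) \<ge> - (M * (\<integral>x. w x powr p * \<psi> x \<partial>lborel))"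
      by simp
    have "(\<Sum>b\<in>Basis. \<integral>x. e b x * conv (dZ b) (eta ?r) x \<partial>lborel)
        = (\<Sum>b\<in>Basis. \<integral>x. D b x * pd b \<psi> x - w' x b * pd b \<psi> x \<partial>lborel)"
    proof (intro sum.cong refl Bochner_Integration.integral_cong)
      fix b x :: 'a assume "b \<in> Basis"
      then show "e b x * conv (dZ b) (eta ?r) x = D b x * pd b \<psi> x - w' x b * pd b \<psi> x"
        using pd\<psi>[of b x] out[of x b] L(2) by (cases "x \<in> S") (auto simp: e_def algebra_simps)
    qed
    also have "\<dots> = (\<Sum>b\<in>Basis. \<integral>x. D b x * pd b \<psi> x \<partial>lborel) - (\<Sum>b\<in>Basis. \<integral>x. w' x b * pd b \<psi> x \<partial>lborel)"
      using i1 i3 by (simp add: sum_subtractf)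
    also have "\<dots> \<le> - M * (\<integral>x. q x * \<psi> x \<partial>lborel)"
      using sub[OF \<psi> \<psi>nn] wi unfolding up by (simp add: algebra_simps)
    finally show ?thesis by (simp add: \<psi>_def)
  qed
  have lim1: "(\<lambda>n. \<Sum>b\<in>Basis. \<integral>x. e b x * conv (dZ b) (eta (rad n)) x \<partial>lborel)
      \<longlonglongrightarrow> (\<Sum>b\<in>Basis. \<integral>x. e b x * dZ b x \<partial>lborel)"
    by (intro tendsto_sum sqint_tendsto_integral_mult conv_eta_tendsto conv_eta_contraction(1) rad_pos se sdZ idZ)
  have lim2: "(\<lambda>n. - M * (\<integral>x. q x * conv Z (eta (rad n)) x \<partial>lborel)) \<longlonglongrightarrow> - M * (\<integral>x. q x * Z x \<partial>lborel)"
    by (intro tendsto_mult_left sqint_tendsto_integral_mult conv_eta_tendsto conv_eta_contraction(1) rad_pos sZ iZ sq)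
  have "\<forall>\<^sub>F n in sequentially. rad n < \<epsilon> / 2"
    using rad_tendsto by (rule order_tendstoD) (use \<epsilon> in simp)
  then have "(\<Sum>b\<in>Basis. \<integral>x. e b x * dZ b x \<partial>lborel) \<le> - M * (\<integral>x. q x * Z x \<partial>lborel)"
    by (intro tendsto_le[OF _ lim2 lim1] eventually_mono[OF _ ineq]) auto
  \<comment> \<open>Each integrand is \<open>heaviside (v x)\<close> times the square of
    \<open>e b x\<close>.\<close>
  moreover have "0 \<le> (\<Sum>b\<in>Basis. \<integral>x. e b x * dZ b x \<partial>lborel)"
    by (intro sum_nonneg integral_nonneg_AE AE_I2) (simp add: dZ_def heaviside_bounds mult.left_commute)
  ultimately have "M * (\<integral>x. q x * Z x \<partial>lborel) \<le> 0" by simp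
  then have le: "(\<integral>x. q x * Z x \<partial>lborel) \<le> 0" using \<open>0 < M\<close> by (simp add: mult_le_0_iff)
  have pos: "0 < q x * Z x" if "x \<in> S" "w x < u x" for x
  proof -
    have "w x powr p < u x powr p" using that w(4)[of x] \<open>0 < p\<close> by (simp add: powr_less_mono2)
    then show ?thesis using that by (simp add: q_def Z_def v_def)
  qed
  have nn: "0 \<le> q x * Z x" for x
  proof (cases "x \<in> S \<and> w x < u x")
    case True
    then show ?thesis using pos[of x] by simp
  next
    case False
    then have "Z x = 0" by (auto simp: Z_def v_def indicator_def)
    then show ?thesis by simp
  qed
  have "0 \<le> (\<integral>x. q x * Z x \<partial>lborel)" using nn by (intro integral_nonneg_AE) auto
  then have "(\<integral>x. q x * Z x \<partial>lborel) = 0" using le by simp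
  then have "AE x in lborel. q x * Z x = 0"
    using integral_nonneg_eq_0_iff_AE[OF sqint_mult_integrable[OF sq sZ]] nn by auto
  then show ?thesis
  proof eventually_elim
    case (elim x)
    then show ?case using pos[of x] by force
  qed
qed

section \<open>The dimensional constant and the explicit barrier\<close>

lemma two_powr_le: "2 powr t \<le> 1 + t" if "0 \<le> t" "t \<le> 1" for t :: real
  \<comment> \<open>Weighted arithmetic-geometric mean of 2 and 1 with weights \<open>t\<close> and
    \<open>1 - t\<close>.\<close>
  using Youngs_inequality_0[of t "1 - t" 2 1] that by simp

text \<open>Equality holds for \<open>N = 1\<close>. Each further dimension adds
  \<open>2 (1 - p)\<close> on the left and multiplies the right by
  \<open>2 powr (1 - p) \<ge> (3 - p) / 2\<close>; once the right side has reached 4, its growth is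
  at least \<open>4 (1 - p) / 2\<close>, which is the growth on the left.\<close>

lemma dimension_constant_le:
  fixes p :: real
  assumes "0 < p" "p < 1" "1 \<le> N"
  shows "4 * p + 2 * real N * (1 - p) \<le> (1 + p) * 2 powr (real N * (1 - p) + p)"
  using assms(3)
proof (induction N rule: dec_induct)
  case base
  then show ?case by simp
next
  case (step n)
  show ?case
  proof (cases "n = 1")
    case True
    \<comment> \<open>For \<open>n = 1\<close> the right side is \<open>2 (1 + p)\<close>, still
      below 4, so the passage to dimension 2, where the left side is exactly 4, is done
      separately.\<close>
    have "2 powr p * 2 powr (2 - p) = (4::real)"
      by (simp flip: powr_add)
    then have "4 \<le> (1 + p) * 2 powr (2 - p)"
      using two_powr_le[of p] assms mult_right_mono[of "2 powr p" "1 + p" "2 powr (2 - p)"] by simp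
    then show ?thesis using True by (simp add: algebra_simps)
  next
    case False
    then have n: "2 \<le> real n" using step by simp
    let ?f = "(1 + p) * 2 powr (real n * (1 - p) + p)"
    have "2 * 2 * (1 - p) \<le> 2 * real n * (1 - p)"
      using n assms by (intro mult_right_mono) auto
    then have f4: "4 \<le> ?f" using step(3) by (simp add: algebra_simps)
    \<comment> \<open>Equivalent to nonnegativity of the square of \<open>1 - p\<close>.\<close>
    have "(3 - p) / 2 * (1 + p) \<le> 2" using zero_le_power2[of "1 - p"] by (simp add: field_simps power2_eq_square)
    moreover have "(3 - p) / 2 * 2 powr p \<le> (3 - p) / 2 * (1 + p)"
      using two_powr_le[of p] assms by (intro mult_left_mono) auto
    moreover have "2 powr (1 - p) * 2 powr p = (2::real)"
      by (simp flip: powr_add)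
    ultimately have "(3 - p) / 2 * 2 powr p \<le> 2 powr (1 - p) * 2 powr p" by linarith
    then have g: "(3 - p) / 2 \<le> 2 powr (1 - p)"
      by (rule mult_right_le_imp_le) simp
    have "4 * p + 2 * real (Suc n) * (1 - p) = (4 * p + 2 * real n * (1 - p)) + 4 * ((1 - p) / 2)"
      by (simp add: field_simps)
    also have "\<dots> \<le> ?f + 4 * ((1 - p) / 2)"
      using step(3) by (rule add_right_mono)
    also have "\<dots> \<le> ?f + ?f * ((1 - p) / 2)"
      using f4 assms by (intro add_left_mono mult_right_mono) auto
    also have "\<dots> = ?f * ((3 - p) / 2)" by (simp add: field_simps)
    also have "\<dots> \<le> ?f * 2 powr (1 - p)" using g assms by (intro mult_left_mono) auto
    also have "\<dots> = (1 + p) * 2 powr (real (Suc n) * (1 - p) + p)"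
      by (simp add: mult.assoc algebra_simps flip: powr_add)
    finally show ?thesis .
  qed
qed

text \<open>For \<open>q = 1 / (1 - p)\<close> one has \<open>q * p = q - 1\<close>, so \<open>\<Delta>w\<close> and \<open>w\<^sup>p\<close> are both
  multiples of \<open>s\<^bsup>q - 1\<^esup>\<close> when \<open>w = c * s\<^bsup>q\<^esup>\<close> and \<open>s\<close> is quadratic.\<close>

lemma barrier:
  fixes a :: "'a::euclidean_space" and c q p \<delta> M :: real
  assumes "0 < \<delta>" "0 < c" "0 < p" "p < 1" and q: "q = 1 / (1 - p)"
    and M: "2 * q * (2 * (q - 1) + real DIM('a)) * c powr (1 - p) \<le> M"
  defines "s \<equiv> \<lambda>x. (x - a) \<bullet> (x - a) + \<delta>"
  defines "w \<equiv> \<lambda>x. c * s x powr q"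
  defines "w' \<equiv> \<lambda>x h. 2 * c * q * (s x powr (q - 1) * ((x - a) \<bullet> h))"
  defines "w'' \<equiv> \<lambda>b x h. 2 * c * q * (s x powr (q - 1) * (h \<bullet> b)
      + ((q - 1) * s x powr (q - 2) * (2 * ((x - a) \<bullet> h))) * ((x - a) \<bullet> b))"
  shows "(w has_derivative w' x) (at x)"
    and "((\<lambda>x. w' x b) has_derivative w'' b x) (at x)"
    and "continuous_on UNIV (\<lambda>x. w'' b x b)"
    and "0 < w x"
    and "(\<Sum>b\<in>Basis. w'' b x b) \<le> M * w x powr p"
proof -
  have s: "0 < s x" for x using assms(1) by (simp add: s_def add_nonneg_pos)
  have q1: "q > 1" using assms(3,4) q by simp
  have ds: "(s has_derivative (\<lambda>h. 2 * ((x - a) \<bullet> h))) (at x)" for x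
    unfolding s_def by (auto intro!: derivative_eq_intros simp: inner_commute)
  have dp: "((\<lambda>x. s x powr k) has_derivative (\<lambda>h. k * s x powr (k - 1) * (2 * ((x - a) \<bullet> h)))) (at x)" for k x
    by (rule has_derivative_compose[OF ds has_real_derivative_powr[OF s, of k x, unfolded has_field_derivative_def]])
  show "(w has_derivative w' x) (at x)"
    using has_derivative_mult_right[OF dp[of q x], of c] by (simp add: w_def w'_def mult_ac)
  have "((\<lambda>x. 2 * c * q * (s x powr (q - 1) * ((x - a) \<bullet> b))) has_derivative w'' b x) (at x)"
  proof -
    have "((\<lambda>x. (x - a) \<bullet> b) has_derivative (\<lambda>h. h \<bullet> b)) (at x)"
      by (auto intro!: derivative_eq_intros)
    from has_derivative_mult_right[OF has_derivative_mult[OF dp[of "q - 1" x] this], of "2 * c * q"]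
    show ?thesis by (simp add: w''_def mult_ac)
  qed
  then show "((\<lambda>x. w' x b) has_derivative w'' b x) (at x)" by (simp add: w'_def)
  have cs: "continuous_on UNIV s" unfolding s_def by (intro continuous_intros)
  show "continuous_on UNIV (\<lambda>x. w'' b x b)"
    unfolding w''_def
    by (intro continuous_intros cs) (use s in \<open>auto simp: less_imp_neq[symmetric]\<close>)
  show "0 < w x" using s[of x] assms(2) by (simp add: w_def)
  have e: "s x powr (q - 1) = s x powr (q - 2) * s x"
    using s[of x] powr_add[of "s x" "q - 2" 1] by simp
  have "(\<Sum>b\<in>Basis. w'' b x b) = 2 * c * q * (\<Sum>b\<in>Basis. s x powr (q - 1)
      + 2 * (q - 1) * s x powr (q - 2) * (((x - a) \<bullet> b) * ((x - a) \<bullet> b)))"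
    unfolding w''_def sum_distrib_left by (intro sum.cong) (auto simp: algebra_simps)
  also have "\<dots> = 2 * c * q * (real DIM('a) * s x powr (q - 1)
      + 2 * (q - 1) * s x powr (q - 2) * ((x - a) \<bullet> (x - a)))"
    by (simp add: sum.distrib euclidean_inner[of "x - a" "x - a"] flip: sum_distrib_left)
  \<comment> \<open>The squared distance is replaced by the larger \<open>s x\<close>, which needs
    \<open>q > 1\<close>; only now do both terms become multiples of the same power of
    \<open>s x\<close>.\<close>
  also have "\<dots> \<le> 2 * c * q * (real DIM('a) * s x powr (q - 1) + 2 * (q - 1) * s x powr (q - 2) * s x)"
    using assms(1,2) q1 by (intro mult_left_mono add_left_mono) (auto simp: s_def)
  also have "2 * c * q * (real DIM('a) * s x powr (q - 1) + 2 * (q - 1) * s x powr (q - 2) * s x)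
      = (2 * q * (2 * (q - 1) + real DIM('a)) * c) * s x powr (q - 1)"
    by (simp add: e algebra_simps)
  \<comment> \<open>Of \<open>c = c powr (1 - p) * c powr p\<close>, the first factor is absorbed by
    \<open>M\<close> and the second belongs to \<open>w x powr p\<close>.\<close>
  also have "2 * q * (2 * (q - 1) + real DIM('a)) * c
      = (2 * q * (2 * (q - 1) + real DIM('a)) * c powr (1 - p)) * c powr p"
    using assms(2) by (simp add: mult.assoc flip: powr_add)
  also have "\<dots> * s x powr (q - 1) \<le> (M * c powr p) * s x powr (q - 1)"
    using M by (intro mult_right_mono) auto
  also have "q - 1 = q * p" using q assms(4) by (simp add: field_simps)
  then have "(M * c powr p) * s x powr (q - 1) = M * w x powr p"
    using assms(2) s[of x] by (simp add: w_def powr_mult powr_powr)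
  finally show "(\<Sum>b\<in>Basis. w'' b x b) \<le> M * w x powr p" .
qed

subsection \<open>Borel representatives\<close>

lemma AE_lebesgue_on_iff:
  assumes "open S"
  shows "(AE x in lebesgue_on S. P x) \<longleftrightarrow> (AE x in lborel. x \<in> S \<longrightarrow> P x)"
  using assms by (subst AE_restrict_space_iff) (auto simp: AE_completion_iff)

lemma borel_measurable_lebesgue_onI:
  "f \<in> borel_measurable borel \<Longrightarrow> f \<in> borel_measurable (lebesgue_on S)"
  by (intro measurable_restrict_space1 measurable_completion) simp

lemma integrable_lebesgue_onI:
  fixes f :: "'a::euclidean_space \<Rightarrow> 'b::{banach, second_countable_topology}"
  assumes "integrable lborel f" "S \<in> sets lebesgue"
  shows "integrable (lebesgue_on S) f"
proof -
  have "integrable lebesgue f"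
    using assms(1) by (subst integrable_completion) auto
  then show ?thesis
    using assms(2) by (subst integrable_restrict_space) (auto intro!: integrable_mult_indicator)
qed

text \<open>The bridge from integrals over \<open>S\<close> in the completed measure to Borel
  integrals over the whole space; \<open>g\<close> plays the role of a representative extended by
  0.\<close>

lemma integral_lebesgue_on:
  fixes g :: "'a::euclidean_space \<Rightarrow> real"
  assumes S: "open S" and f: "f \<in> borel_measurable (lebesgue_on S)"
    and g: "g \<in> borel_measurable borel" "\<And>x. x \<notin> S \<Longrightarrow> g x = 0"
    and eq: "AE x in lebesgue_on S. f x = g x"
  shows "(LINT x|lebesgue_on S. f x) = (\<integral>x. g x \<partial>lborel)"
proof -
  have "(LINT x|lebesgue_on S. f x) = (LINT x|lebesgue_on S. g x)"
    by (rule integral_cong_AE[OF f borel_measurable_lebesgue_onI[OF g(1)] eq])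
  also have "\<dots> = (\<integral>x. indicator S x *\<^sub>R g x \<partial>lebesgue)"
    using S by (intro integral_restrict_space) auto
  also have "(\<lambda>x. indicator S x *\<^sub>R g x) = g"
    using g(2) by (auto simp: indicator_def fun_eq_iff)
  also have "(\<integral>x. g x \<partial>lebesgue) = (\<integral>x. g x \<partial>lborel)"
    using g(1) by (intro integral_completion) simp
  finally show ?thesis .
qed

text \<open>Tonelli's theorem in \<open>conv_eta_contraction\<close> needs Borel functions, hence the passage from
  Lebesgue measurable functions to representatives, extended by 0 outside \<open>S\<close>.\<close>

definition borel_repr :: "'a::euclidean_space set \<Rightarrow> ('a \<Rightarrow> real) \<Rightarrow> ('a \<Rightarrow> real) \<Rightarrow> bool" where
  "borel_repr S f g \<longleftrightarrow> f \<in> borel_measurable (lebesgue_on S) \<and> sqint g \<and> (\<forall>x. x \<notin> S \<longrightarrow> g x = 0) \<and>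
     (AE x in lebesgue_on S. f x = g x)"

lemma borel_repr_exists:
  assumes S: "open S" and f: "f \<in> borel_measurable (lebesgue_on S)"
    "integrable (lebesgue_on S) (\<lambda>x. (f x)\<^sup>2)"
  shows "\<exists>g. borel_repr S f g"
proof -
  have Sl: "S \<inter> space lebesgue \<in> sets lebesgue" using S by auto
  have "(\<lambda>x. f x * indicator S x) \<in> borel_measurable lebesgue"
    using f(1) by (subst (asm) borel_measurable_restrict_space_iff[OF Sl]) (simp add: mult.commute)
  then obtain g where g: "g \<in> borel_measurable lborel" "AE x in lborel. f x * indicator S x = g x"
    using completion_ex_borel_measurable_real by blast
  let ?g = "\<lambda>x. indicator S x * g x"
  have [measurable]: "g \<in> borel_measurable borel" "S \<in> sets borel" using g(1) S by auto
  have ae: "AE x in lebesgue_on S. f x = ?g x"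
    unfolding AE_lebesgue_on_iff[OF S] using g(2) by eventually_elim auto
  have "integrable lebesgue (\<lambda>x. indicator S x *\<^sub>R (f x)\<^sup>2)"
    by (rule iffD1[OF integrable_restrict_space[OF Sl] f(2)])
  then have "integrable lebesgue (\<lambda>x. (?g x)\<^sup>2)"
  proof (rule integrable_cong_AE_imp)
    show "(\<lambda>x. (?g x)\<^sup>2) \<in> borel_measurable lebesgue"
      by (rule measurable_completion) simp
    have "AE x in lebesgue. f x * indicator S x = g x" using g(2) by (simp add: AE_completion_iff)
    then show "AE x in lebesgue. indicator S x *\<^sub>R (f x)\<^sup>2 = (?g x)\<^sup>2"
      by eventually_elim (auto simp: indicator_def)
  qed
  then have "integrable lborel (\<lambda>x. (?g x)\<^sup>2)"
    by (subst (asm) integrable_completion) auto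
  then have "borel_repr S f ?g"
    using f(1) ae by (simp add: borel_repr_def sqint_def)
  then show ?thesis by blast
qed

lemma borel_repr_integral_mult:
  assumes S: "open S" and r: "borel_repr S f g" and h: "h \<in> borel_measurable borel"
  shows "(LINT x|lebesgue_on S. f x * h x) = (\<integral>x. g x * h x \<partial>lborel)"
proof (rule integral_lebesgue_on[OF S])
  have "g \<in> borel_measurable borel" using r by (auto simp: borel_repr_def)
  then show "(\<lambda>x. g x * h x) \<in> borel_measurable borel" using h by simp
  show "(\<lambda>x. f x * h x) \<in> borel_measurable (lebesgue_on S)"
    using r borel_measurable_lebesgue_onI[OF h] by (auto simp: borel_repr_def)
  have "AE x in lebesgue_on S. f x = g x" using r by (simp add: borel_repr_def)
  then show "AE x in lebesgue_on S. f x * h x = g x * h x" by eventually_elim simp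
qed (use r in \<open>simp add: borel_repr_def\<close>)

lemma borel_repr_has_weak_pd:
  assumes S: "open S" and wg: "weak_gradient S u Du" and b: "b \<in> Basis"
    and r: "borel_repr S u v" "borel_repr S (\<lambda>x. Du x \<bullet> b) d"
  shows "has_weak_pd S b v d"
  unfolding has_weak_pd_def
proof
  fix \<phi> assume \<phi>: "\<phi> \<in> test_functions S"
  have "(LINT x|lebesgue_on S. u x * (grad \<phi> x \<bullet> b)) = - (LINT x|lebesgue_on S. (Du x \<bullet> b) * \<phi> x)"
    using wg \<phi> b by (simp add: weak_gradient_def)
  then show "(\<integral>x. v x * pd b \<phi> x \<partial>lborel) = - (\<integral>x. d x * \<phi> x \<partial>lborel)"
    using borel_repr_integral_mult[OF S r(1) test_functions_measurable[OF test_functions_pd[OF \<phi> b]]]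
      borel_repr_integral_mult[OF S r(2) test_functions_measurable[OF \<phi>]]
    by (simp add: grad_inner_Basis[OF b])
qed

section \<open>Admissible functions and the bound by the boundary value\<close>

lemma grad_test_function:
  fixes \<psi> :: "'a::euclidean_space \<Rightarrow> real"
  assumes \<psi>: "\<psi> \<in> test_functions S"
  shows "grad \<psi> \<in> borel_measurable borel" "integrable lborel (grad \<psi>)"
    "integrable lborel (\<lambda>x. (norm (grad \<psi> x))\<^sup>2)"
proof -
  note pd = test_functions_pd[OF \<psi>]
  show "grad \<psi> \<in> borel_measurable borel"
    unfolding grad_def[abs_def]
    using test_functions_measurable[OF pd] by (intro borel_measurable_sum borel_measurable_scaleR) auto
  show "integrable lborel (grad \<psi>)"
    unfolding grad_def[abs_def]
    using test_functions_integrable[OF pd] by (intro Bochner_Integration.integrable_sum integrable_scaleR_left) auto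
  have "(norm (grad \<psi> x))\<^sup>2 = (\<Sum>b\<in>Basis. (pd b \<psi> x)\<^sup>2)" for x
    unfolding power2_norm_eq_inner euclidean_inner[of "grad \<psi> x" "grad \<psi> x"]
    by (simp add: grad_inner_Basis power2_eq_square)
  then show "integrable lborel (\<lambda>x. (norm (grad \<psi> x))\<^sup>2)"
    using sqint_test_function[OF pd] by (simp add: sqint_def)
qed

text \<open>The constant sequence approximates \<open>\<psi>\<close>. With this, smooth nonnegative
  functions of compact support may be inserted into \<open>weak_subsolution\<close>.\<close>

lemma test_function_H10:
  fixes \<psi> :: "'a::euclidean_space \<Rightarrow> real"
  assumes S: "open S" and \<psi>: "\<psi> \<in> test_functions S"
  shows "weak_gradient S \<psi> (grad \<psi>)" "\<psi> \<in> H10 S"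
proof -
  have Sl: "S \<in> sets lebesgue" using S by auto
  have m[measurable]: "\<psi> \<in> borel_measurable borel" by (rule test_functions_measurable[OF \<psi>])
  note g = grad_test_function[OF \<psi>]
  have loc: "f \<in> L1_loc S" if "integrable lborel f" for f :: "'a \<Rightarrow> 'b::euclidean_space"
    unfolding L1_loc_def set_integrable_def
  proof (intro CollectI allI impI)
    fix K assume "compact K \<and> K \<subseteq> S"
    then have "K \<in> sets lebesgue" by (auto simp: compact_imp_closed)
    moreover have "integrable lebesgue f" using that by (subst integrable_completion) auto
    ultimately show "integrable lebesgue (\<lambda>x. indicator K x *\<^sub>R f x)"
      by (intro integrable_mult_indicator)
  qed
  show wg: "weak_gradient S \<psi> (grad \<psi>)"
    unfolding weak_gradient_def
  proof (intro conjI ballI loc test_functions_integrable[OF \<psi>] g(2))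
    fix \<phi> b :: "_" assume \<phi>: "\<phi> \<in> test_functions S" and b: "b \<in> (Basis :: 'a set)"
    obtain K where K: "compact K" "K \<subseteq> S" "\<And>x. x \<notin> K \<Longrightarrow> \<phi> x = 0"
      using \<phi> by (rule test_functionsE) blast
    have out: "pd b \<phi> x = 0" if "x \<notin> K" for x
      using frechet_derivative_outside[of K \<phi> x] K that by (simp add: compact_imp_closed)
    have [measurable]: "\<phi> \<in> borel_measurable borel" "pd b \<phi> \<in> borel_measurable borel" "pd b \<psi> \<in> borel_measurable borel"
      using test_functions_measurable test_functions_pd \<phi> \<psi> b by blast+
    have "(LINT x|lebesgue_on S. \<psi> x * pd b \<phi> x) = (\<integral>x. \<psi> x * pd b \<phi> x \<partial>lborel)"
      by (rule integral_lebesgue_on[OF S borel_measurable_lebesgue_onI]) (use out K(2) in auto)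
    also have "\<dots> = - (\<integral>x. pd b \<psi> x * \<phi> x \<partial>lborel)"
      by (rule integral_by_parts[OF test_functions_has_derivative[OF \<psi>] test_functions_continuous
            test_functions_has_derivative[OF \<phi>] test_functions_continuous K(1,3)])
         (rule test_functions_pd[OF \<psi> b] test_functions_pd[OF \<phi> b])+
    also have "(\<integral>x. pd b \<psi> x * \<phi> x \<partial>lborel) = (LINT x|lebesgue_on S. pd b \<psi> x * \<phi> x)"
      by (rule sym, rule integral_lebesgue_on[OF S borel_measurable_lebesgue_onI]) (use K(2,3) in auto)
    finally show "(LINT x|lebesgue_on S. \<psi> x * (grad \<phi> x \<bullet> b)) = - (LINT x|lebesgue_on S. (grad \<psi> x \<bullet> b) * \<phi> x)"
      by (simp add: grad_inner_Basis[OF b])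
  qed
  have "\<psi> \<in> L2 S"
    using integrable_lebesgue_onI[OF sqint_integrable_sq[OF sqint_test_function[OF \<psi>]] Sl]
      borel_measurable_lebesgue_onI[OF m]
    by (simp add: L2_def)
  moreover have "grad \<psi> \<in> L2 S"
    using integrable_lebesgue_onI[OF g(3) Sl] borel_measurable_lebesgue_onI[OF g(1)] by (simp add: L2_def)
  ultimately show "\<psi> \<in> H10 S"
    unfolding H10_def using wg \<psi>
    by (intro CollectI conjI bexI[of _ "grad \<psi>"] exI[of _ "\<lambda>_. \<psi>"]) auto
qed

text \<open>Tested with \<open>\<phi> = (u - A)\<close> cut off below at 0, the gradient term is
  nonnegative, so the integral of \<open>u powr p * \<phi>\<close> is at most 0 and its nonnegative
  integrand vanishes almost everywhere. Where \<open>u > A > 0\<close> it would be positive. The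
  reaction term thus replaces a Poincare inequality.\<close>

lemma weak_maximum_principle:
  fixes u :: "'a::euclidean_space \<Rightarrow> real"
  assumes S: "open S" "bounded S" and "0 < M" "0 < A" "0 < p" "p < 1"
    and u: "u \<in> L2 S" "AE x in lebesgue_on S. 0 \<le> u x"
    and Du: "Du \<in> L2 S" "weak_gradient S u Du"
    and D: "borel_repr S u u0" "\<And>b. b \<in> Basis \<Longrightarrow> borel_repr S (\<lambda>x. Du x \<bullet> b) (D b)"
    and sub: "weak_subsolution S M p u"
    and bdry: "(\<lambda>x. max (u x - A) 0) \<in> H10 S"
  shows "AE x in lebesgue_on S. u x \<le> A"
proof -
  have Sl: "S \<in> sets lebesgue" and Sb[measurable]: "S \<in> sets borel" using S by auto
  have um[measurable]: "u \<in> borel_measurable (lebesgue_on S)" and Dum[measurable]: "Du \<in> borel_measurable (lebesgue_on S)"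
    using u(1) Du(1) by (auto simp: L2_def)
  have su0: "sqint u0" and aeu0: "AE x in lebesgue_on S. u x = u0 x" using D(1) by (auto simp: borel_repr_def)
  have [measurable]: "u0 \<in> borel_measurable borel" using su0 by auto
  have sD: "sqint (D b)" and aeD: "AE x in lebesgue_on S. Du x \<bullet> b = D b x" if "b \<in> Basis" for b
    using D(2)[OF that] by (auto simp: borel_repr_def)
  define v where "v x = indicator S x * (u0 x - A)" for x
  \<comment> \<open>The subtracted 0 is the derivative of the constant \<open>A\<close>, which acts
    as the smooth function in \<open>has_weak_pd_diff_smooth\<close>.\<close>
  define e where "e b x = indicator S x * (D b x - 0)" for b x
  define \<phi> where "\<phi> x = max (u x - A) 0" for x
  define D\<phi> where "D\<phi> x = heaviside (v x) *\<^sub>R Du x" for x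
  have sv: "sqint v"
  proof -
    have "sqint (\<lambda>x. indicator S x * u0 x - indicator S x * A)"
      by (intro sqint_diff sqint_mult_bounded[OF su0, of _ 1] sqint_indicator_continuous S Sb)
         (auto simp: indicator_def)
    then show ?thesis by (simp add: v_def[abs_def] right_diff_distrib)
  qed
  have [measurable]: "v \<in> borel_measurable borel" using sv by auto
  have se: "sqint (e b)" if "b \<in> Basis" for b
    unfolding e_def[abs_def] using sD[OF that] by (intro sqint_mult_bounded[of _ _ 1]) (auto simp: indicator_def)
  have iv: "integrable lborel v" by (rule sqint_integrable[OF sv S(2) Sb]) (simp add: v_def)
  have ie: "integrable lborel (e b)" if "b \<in> Basis" for b
    by (rule sqint_integrable[OF se[OF that] S(2) Sb]) (simp add: e_def)
  have wdv: "has_weak_pd S b v (e b)" if "b \<in> Basis" for b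
    using has_weak_pd_diff_smooth[OF S(1) that su0 sD[OF that] borel_repr_has_weak_pd[OF S(1) Du(2) that D(1) D(2)[OF that]],
        of "\<lambda>_. A" "\<lambda>_ _. 0"]
    by (simp add: v_def[abs_def] e_def[abs_def])
  have wdZ: "has_weak_pd S b (\<lambda>x. max (v x) 0) (\<lambda>x. heaviside (v x) * e b x)" if "b \<in> Basis" for b
    by (rule has_weak_pd_positive_part[OF S(1) that sv iv se[OF that] ie[OF that] wdv[OF that]])
  have r1: "borel_repr S \<phi> (\<lambda>x. max (v x) 0)"
    unfolding borel_repr_def
  proof (intro conjI allI impI)
    show "\<phi> \<in> borel_measurable (lebesgue_on S)" unfolding \<phi>_def[abs_def] by measurable
    show "sqint (\<lambda>x. max (v x) 0)"
      by (rule sqint_bound[OF sqint_integrable_sq[OF sv]]) (auto simp: max_def)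
    show "AE x in lebesgue_on S. \<phi> x = max (v x) 0"
      using aeu0 unfolding AE_lebesgue_on_iff[OF S(1)] by eventually_elim (simp add: \<phi>_def v_def)
  qed (simp add: v_def)
  have Hm[measurable]: "(\<lambda>x. heaviside (v x)) \<in> borel_measurable (lebesgue_on S)"
    by (rule borel_measurable_lebesgue_onI) measurable
  have r2: "borel_repr S (\<lambda>x. D\<phi> x \<bullet> b) (\<lambda>x. heaviside (v x) * e b x)" if b: "b \<in> Basis" for b
    unfolding borel_repr_def
  proof (intro conjI allI impI)
    show "(\<lambda>x. D\<phi> x \<bullet> b) \<in> borel_measurable (lebesgue_on S)" unfolding D\<phi>_def[abs_def] by measurable
    show "sqint (\<lambda>x. heaviside (v x) * e b x)"
      by (rule sqint_mult_bounded[OF se[OF b] _ heaviside_bounds(2)]) measurable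
    show "AE x in lebesgue_on S. D\<phi> x \<bullet> b = heaviside (v x) * e b x"
      using aeD[OF b] unfolding AE_lebesgue_on_iff[OF S(1)] by eventually_elim (simp add: D\<phi>_def e_def)
  qed (simp add: e_def)
  have wg: "weak_gradient S \<phi> D\<phi>"
    unfolding weak_gradient_def
  proof (intro conjI ballI)
    show "\<phi> \<in> L1_loc S" using bdry by (auto simp: H10_def weak_gradient_def \<phi>_def[abs_def])
    have "Du \<in> L1_loc S" using Du(2) by (simp add: weak_gradient_def)
    show "D\<phi> \<in> L1_loc S"
      unfolding L1_loc_def set_integrable_def
    proof (intro CollectI allI impI)
      fix K assume "compact K \<and> K \<subseteq> S"
      then have K: "integrable lebesgue (\<lambda>x. indicator K x *\<^sub>R Du x)"
        using \<open>Du \<in> L1_loc S\<close> by (simp add: L1_loc_def set_integrable_def)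
      have Hl: "(\<lambda>x. heaviside (v x)) \<in> borel_measurable lebesgue"
        by (rule measurable_completion) simp
      have "integrable lebesgue (\<lambda>x. heaviside (v x) *\<^sub>R (indicator K x *\<^sub>R Du x))"
      proof (rule Bochner_Integration.integrable_bound[OF K])
        show "AE x in lebesgue. norm (heaviside (v x) *\<^sub>R indicator K x *\<^sub>R Du x) \<le> norm (indicator K x *\<^sub>R Du x)"
          by (intro AE_I2) (simp add: abs_mult mult.assoc mult_left_le_one_le heaviside_bounds abs_le_D1[OF heaviside_bounds(2)])
      qed (rule borel_measurable_scaleR[OF Hl borel_measurable_integrable[OF K]])
      then show "integrable lebesgue (\<lambda>x. indicator K x *\<^sub>R D\<phi> x)"
        by (simp add: D\<phi>_def mult.commute)
    qed
    fix \<psi> b assume \<psi>: "\<psi> \<in> test_functions S" and b: "b \<in> (Basis :: 'a set)"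
    show "(LINT x|lebesgue_on S. \<phi> x * (grad \<psi> x \<bullet> b)) = - (LINT x|lebesgue_on S. (D\<phi> x \<bullet> b) * \<psi> x)"
      using borel_repr_integral_mult[OF S(1) r1 test_functions_measurable[OF test_functions_pd[OF \<psi> b]]]
        borel_repr_integral_mult[OF S(1) r2[OF b] test_functions_measurable[OF \<psi>]] wdZ[OF b] \<psi>
      by (simp add: grad_inner_Basis[OF b] has_weak_pd_def)
  qed
  \<comment> \<open>\<open>weak_subsolution\<close> accepts every weak gradient of the test
    function, in particular this explicit one, for which the scalar product is
    \<open>heaviside (v x)\<close> times the squared norm of \<open>Du x\<close>.\<close>
  have "(LINT x|lebesgue_on S. Du x \<bullet> D\<phi> x) \<le> - M * (LINT x|lebesgue_on S. u x powr p * \<phi> x)"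
    using sub Du(2) bdry wg unfolding weak_subsolution_def \<phi>_def[abs_def] by auto
  moreover have "0 \<le> (LINT x|lebesgue_on S. Du x \<bullet> D\<phi> x)"
    by (intro integral_nonneg_AE AE_I2) (simp add: D\<phi>_def heaviside_bounds)
  ultimately have "M * (LINT x|lebesgue_on S. u x powr p * \<phi> x) \<le> 0" by simp
  then have le: "(LINT x|lebesgue_on S. u x powr p * \<phi> x) \<le> 0"
    using \<open>0 < M\<close> by (simp add: mult_le_0_iff)
  have nn: "0 \<le> u x powr p * \<phi> x" for x by (simp add: \<phi>_def)
  \<comment> \<open>Without integrability a zero integral would say nothing, as 0 is also the
    default value. The bound combines \<open>u x powr p \<le> 1 + u x\<close>, from
    \<open>0 < p < 1\<close>, with \<open>\<phi> x \<le> u x\<close>.\<close>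
  have int: "integrable (lebesgue_on S) (\<lambda>x. u x powr p * \<phi> x)"
  proof (rule Bochner_Integration.integrable_bound)
    have "integrable lborel (indicator S :: 'a \<Rightarrow> real)"
      using emeasure_bounded_finite[OF S(2)] Sb by (intro integrable_real_indicator) auto
    then have "integrable (lebesgue_on S) (indicator S :: 'a \<Rightarrow> real)"
      by (rule integrable_lebesgue_onI[OF _ Sl])
    moreover have "integrable (lebesgue_on S) (\<lambda>x. (u x)\<^sup>2)" using u(1) by (simp add: L2_def)
    ultimately show "integrable (lebesgue_on S) (\<lambda>x. indicator S x + 2 * (u x)\<^sup>2)" by auto
    show "(\<lambda>x. u x powr p * \<phi> x) \<in> borel_measurable (lebesgue_on S)"
      unfolding \<phi>_def[abs_def] by measurable
    show "AE x in lebesgue_on S. norm (u x powr p * \<phi> x) \<le> norm (indicator S x + 2 * (u x)\<^sup>2)"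
      using u(2) unfolding AE_lebesgue_on_iff[OF S(1)]
    proof eventually_elim
      case (elim x)
      show ?case
      proof
        assume x: "x \<in> S"
        then have ux: "0 \<le> u x" using elim by simp
        have "u x powr p \<le> 1 + u x"
        proof (cases "u x \<le> 1")
          case True
          then have "u x powr p \<le> 1" using ux \<open>0 < p\<close> by (intro powr_le1) auto
          then show ?thesis using ux by simp
        next
          case False
          then have "u x powr p \<le> u x powr 1" using \<open>p < 1\<close> by (intro powr_mono) auto
          then show ?thesis using False by simp
        qed
        moreover have "\<phi> x \<le> u x" "0 \<le> \<phi> x" using ux \<open>0 < A\<close> by (auto simp: \<phi>_def)
        ultimately have "u x powr p * \<phi> x \<le> (1 + u x) * u x"
          using ux by (intro mult_mono) auto
        also have "\<dots> \<le> 1 + 2 * (u x)\<^sup>2"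
          using zero_le_power2[of "u x - 1"] zero_le_power2[of "u x"]
          by (simp add: power2_eq_square algebra_simps) (smt (verit) mult_nonneg_nonneg ux)
        finally show "norm (u x powr p * \<phi> x) \<le> norm (indicator S x + 2 * (u x)\<^sup>2)"
          using nn[of x] x by simp
      qed
    qed
  qed
  have "0 \<le> (LINT x|lebesgue_on S. u x powr p * \<phi> x)"
    by (intro integral_nonneg_AE AE_I2 nn)
  with le have "(LINT x|lebesgue_on S. u x powr p * \<phi> x) = 0" by simp
  then have "AE x in lebesgue_on S. u x powr p * \<phi> x = 0"
    using integral_nonneg_eq_0_iff_AE[OF int] nn by auto
  then show ?thesis
  proof eventually_elim
    case (elim x)
    then show ?case using \<open>0 < A\<close> by (auto simp: \<phi>_def max_def split: if_splits)
  qed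
qed

theorem proposition3p1:
  fixes u :: "'a::euclidean_space \<Rightarrow> real" and R p M A :: real
  assumes "R > 0" and "0 < p" and "p < 1" and "M > 0" and "A > 0"
    and "u \<in> H1 (ball 0 (2 * R))"
    and "weak_subsolution (ball 0 (2 * R)) M p u"
    and "AE x in lebesgue_on (ball 0 (2 * R)). u x \<ge> 0"
    and "(\<lambda>x. max (u x - A) 0) \<in> H10 (ball 0 (2 * R))"
    and "M \<ge> (1 + p) * 2 powr (real DIM('a) * (1 - p) + p) / (1 - p)\<^sup>2 * (A powr (1 - p) / R\<^sup>2)"
  shows "AE x in lebesgue_on (ball 0 R). u x = 0"
proof -
  define S :: "'a set" where "S = ball 0 (2 * R)"
  have S: "open S" "bounded S" by (auto simp: S_def)
  have Sb: "S \<in> sets borel" using S by auto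
  obtain Du where u: "u \<in> L2 S" and Du: "Du \<in> L2 S" "weak_gradient S u Du"
    using assms(6) by (auto simp: H1_def S_def)
  have um[measurable]: "u \<in> borel_measurable (lebesgue_on S)" and Dum[measurable]: "Du \<in> borel_measurable (lebesgue_on S)"
    using u Du(1) by (auto simp: L2_def)
  have unn: "AE x in lebesgue_on S. 0 \<le> u x" unfolding S_def by (rule assms(8))
  obtain u0 where u0: "borel_repr S u u0"
    using borel_repr_exists[OF S(1) um] u by (auto simp: L2_def)
  have "\<exists>d. borel_repr S (\<lambda>x. Du x \<bullet> b) d" if b: "b \<in> Basis" for b
  proof (rule borel_repr_exists[OF S(1)])
    show "integrable (lebesgue_on S) (\<lambda>x. (Du x \<bullet> b)\<^sup>2)"
    proof (rule Bochner_Integration.integrable_bound)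
      show "integrable (lebesgue_on S) (\<lambda>x. (norm (Du x))\<^sup>2)" using Du by (simp add: L2_def)
      show "AE x in lebesgue_on S. norm ((Du x \<bullet> b)\<^sup>2) \<le> norm ((norm (Du x))\<^sup>2)"
        using power_mono[OF Basis_le_norm[OF b], of _ 2] by (intro AE_I2) simp
    qed measurable
  qed measurable
  then obtain D where D: "\<And>b. b \<in> Basis \<Longrightarrow> borel_repr S (\<lambda>x. Du x \<bullet> b) (D b)" by metis
  have uA: "AE x in lebesgue_on S. u x \<le> A"
    by (rule weak_maximum_principle[OF S assms(4,5,2,3) u unn Du u0 D assms(7,9)[folded S_def]])
  \<comment> \<open>\<open>comparison\<close> asks for bounds at every point. The truncation changes
    \<open>u0\<close> only on a null subset of \<open>S\<close> and keeps the value 0 outside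
    \<open>S\<close>.\<close>
  define u1 where "u1 x = min A (max 0 (u0 x))" for x
  have su0: "sqint u0" and aeu0: "AE x in lebesgue_on S. u x = u0 x" using u0 by (auto simp: borel_repr_def)
  have [measurable]: "u0 \<in> borel_measurable borel" using su0 by auto
  have u1m[measurable]: "u1 \<in> borel_measurable borel" unfolding u1_def[abs_def] by measurable
  have su1: "sqint u1"
  proof (rule sqint_bound[OF sqint_integrable_sq[OF su0] u1m])
    show "(u1 x)\<^sup>2 \<le> (u0 x)\<^sup>2" for x
      using assms(5) by (intro abs_le_square_iff[THEN iffD1]) (auto simp: u1_def)
  qed
  have aeu1: "AE x in lebesgue_on S. u x = u1 x"
    using aeu0 unn uA by eventually_elim (simp add: u1_def)
  have u1: "borel_repr S u u1"
    using u0 su1 aeu1 assms(5) by (simp add: borel_repr_def u1_def)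
  have sD: "sqint (D b)" if "b \<in> Basis" for b using D[OF that] by (simp add: borel_repr_def)
  have aeD: "AE x in lebesgue_on S. Du x \<bullet> b = D b x" if "b \<in> Basis" for b
    using D[OF that] by (simp add: borel_repr_def)
  have wD: "has_weak_pd S b u1 (D b)" if "b \<in> Basis" for b
    by (rule borel_repr_has_weak_pd[OF S(1) Du(2) that u1 D[OF that]])
  have sub: "(\<Sum>b\<in>Basis. \<integral>x. D b x * pd b \<psi> x \<partial>lborel) \<le> - M * (\<integral>x. u1 x powr p * \<psi> x \<partial>lborel)"
    if \<psi>: "\<psi> \<in> test_functions S" and nn: "\<And>x. 0 \<le> \<psi> x" for \<psi>
  proof -
    obtain K where K: "compact K" "K \<subseteq> S" "\<And>x. x \<notin> K \<Longrightarrow> \<psi> x = 0"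
      using \<psi> by (rule test_functionsE) blast
    have pdt: "pd b \<psi> \<in> test_functions S" if "b \<in> Basis" for b by (rule test_functions_pd[OF \<psi> that])
    have [measurable]: "\<psi> \<in> borel_measurable borel" by (rule test_functions_measurable[OF \<psi>])
    have \<psi>m[measurable]: "\<psi> \<in> borel_measurable (lebesgue_on S)" by (rule borel_measurable_lebesgue_onI) simp
    have gm[measurable]: "grad \<psi> \<in> borel_measurable (lebesgue_on S)"
      by (rule borel_measurable_lebesgue_onI[OF grad_test_function(1)[OF \<psi>]])
    have i: "integrable lborel (\<lambda>x. D b x * pd b \<psi> x)" if "b \<in> Basis" for b
      by (rule sqint_mult_integrable[OF sD[OF that] sqint_test_function[OF pdt[OF that]]])
    have "(LINT x|lebesgue_on S. Du x \<bullet> grad \<psi> x) = (\<integral>x. (\<Sum>b\<in>Basis. D b x * pd b \<psi> x) \<partial>lborel)"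
    proof (rule integral_lebesgue_on[OF S(1)])
      have "AE x in lebesgue_on S. \<forall>b\<in>Basis. Du x \<bullet> b = D b x"
        by (rule AE_finite_allI[OF finite_Basis aeD])
      then show "AE x in lebesgue_on S. Du x \<bullet> grad \<psi> x = (\<Sum>b\<in>Basis. D b x * pd b \<psi> x)"
      proof eventually_elim
        case (elim x)
        then show ?case
          unfolding euclidean_inner[of "Du x" "grad \<psi> x"] by (intro sum.cong) (auto simp: grad_inner_Basis)
      qed
      show "(\<lambda>x. \<Sum>b\<in>Basis. D b x * pd b \<psi> x) \<in> borel_measurable borel"
        using sD test_functions_measurable[OF pdt] by (intro borel_measurable_sum borel_measurable_times) auto
      show "(\<Sum>b\<in>Basis. D b x * pd b \<psi> x) = 0" if "x \<notin> S" for x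
        using D that by (simp add: borel_repr_def)
    qed measurable
    also have "\<dots> = (\<Sum>b\<in>Basis. \<integral>x. D b x * pd b \<psi> x \<partial>lborel)"
      using i by (rule Bochner_Integration.integral_sum)
    finally have 1: "(LINT x|lebesgue_on S. Du x \<bullet> grad \<psi> x) = (\<Sum>b\<in>Basis. \<integral>x. D b x * pd b \<psi> x \<partial>lborel)" .
    have 2: "(LINT x|lebesgue_on S. u x powr p * \<psi> x) = (\<integral>x. u1 x powr p * \<psi> x \<partial>lborel)"
    proof (rule integral_lebesgue_on[OF S(1)])
      show "AE x in lebesgue_on S. u x powr p * \<psi> x = u1 x powr p * \<psi> x"
        using aeu1 by eventually_elim simp
      show "u1 x powr p * \<psi> x = 0" if "x \<notin> S" for x using K(2,3) that by auto
    qed measurable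
    have "(LINT x|lebesgue_on S. Du x \<bullet> grad \<psi> x) \<le> - M * (LINT x|lebesgue_on S. u x powr p * \<psi> x)"
      using assms(7)[folded S_def] Du(2) test_function_H10[OF S(1) \<psi>] nn
      unfolding weak_subsolution_def by blast
    then show ?thesis unfolding 1 2 .
  qed
  define q where "q = 1 / (1 - p)"
  have q: "q > 0" "q * (1 - p) = 1" using assms(2,3) by (auto simp: q_def)
  \<comment> \<open>Chosen so that \<open>c * R powr (2 * q) = A\<close>.\<close>
  define c where "c = A * R powr (- (2 * q))"
  have c: "c > 0" using assms(1,5) by (simp add: c_def)
  \<comment> \<open>The factor \<open>A powr (1 - p) / R\<^sup>2\<close> of the threshold is exactly
    \<open>c powr (1 - p)\<close>, because \<open>2 * q * (1 - p) = 2\<close>; the remaining factor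
    is bounded by the dimensional estimate.\<close>
  have cM: "2 * q * (2 * (q - 1) + real DIM('a)) * c powr (1 - p) \<le> M"
  proof -
    have "2 * q * (2 * (q - 1) + real DIM('a)) = (4 * p + 2 * real DIM('a) * (1 - p)) / (1 - p)\<^sup>2"
      using assms(3) by (simp add: q_def field_simps power2_eq_square)
    also have "\<dots> \<le> (1 + p) * 2 powr (real DIM('a) * (1 - p) + p) / (1 - p)\<^sup>2"
      using dimension_constant_le[OF assms(2,3), of "DIM('a)"] by (intro divide_right_mono) auto
    finally have *: "2 * q * (2 * (q - 1) + real DIM('a)) \<le> (1 + p) * 2 powr (real DIM('a) * (1 - p) + p) / (1 - p)\<^sup>2" .
    have "- (2 * q) * (1 - p) = - 2" using q(2) by (simp add: mult.assoc)
    then have "(R powr (- (2 * q))) powr (1 - p) = R powr (- 2)"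
      by (simp only: powr_powr)
    then have "c powr (1 - p) = A powr (1 - p) * R powr (- 2)"
      using assms(1,5) by (simp add: c_def powr_mult)
    also have "R powr (- 2) = 1 / R\<^sup>2"
      using assms(1) by (simp add: powr_minus_divide)
    finally have "c powr (1 - p) = A powr (1 - p) / R\<^sup>2" by simp
    then show ?thesis
      using mult_right_mono[OF *, of "A powr (1 - p) / R\<^sup>2"] assms(10) by simp
  qed
  have key: "AE x in lborel. x \<in> S \<longrightarrow> u1 x \<le> c * ((x - a) \<bullet> (x - a) + \<delta>) powr q"
    if a: "a \<in> ball 0 R" and \<delta>: "\<delta> > 0" for a \<delta>
  proof -
    note bar = barrier[where a = a, OF \<delta> c assms(2,3) q_def cM]
    let ?w' = "\<lambda>x h. 2 * c * q * (((x - a) \<bullet> (x - a) + \<delta>) powr (q - 1) * ((x - a) \<bullet> h))"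
    let ?w'' = "\<lambda>b x h. 2 * c * q * (((x - a) \<bullet> (x - a) + \<delta>) powr (q - 1) * (h \<bullet> b)
      + ((q - 1) * ((x - a) \<bullet> (x - a) + \<delta>) powr (q - 2) * (2 * ((x - a) \<bullet> h))) * ((x - a) \<bullet> b))"
    show ?thesis
    proof (rule comparison[where D = D and A = A and w' = ?w' and w'' = ?w'' and K = "cball a R",
          OF S su1 _ _ _ _ _ bar(1) bar(2) bar(3) bar(4) bar(5) compact_cball _ _ assms(2,4)])
      show "sqint (D b)" "has_weak_pd S b u1 (D b)" if "b \<in> Basis" for b
        using sD wD that by blast+
      show "(\<Sum>b\<in>Basis. \<integral>x. D b x * pd b \<psi> x \<partial>lborel) \<le> - M * (\<integral>x. u1 x powr p * \<psi> x \<partial>lborel)"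
        if "\<psi> \<in> test_functions S" "\<And>x. 0 \<le> \<psi> x" for \<psi>
        by (rule sub[OF that])
      show "0 \<le> u1 x" "u1 x \<le> A" for x using assms(5) by (auto simp: u1_def)
      show "cball a R \<subseteq> S"
      proof
        fix x assume "x \<in> cball a R"
        then show "x \<in> S" using a norm_triangle_ineq[of a "x - a"] by (simp add: S_def dist_norm norm_minus_commute)
      qed
      fix x assume "x \<notin> cball a R"
      then have "R < norm (x - a)" by (simp add: dist_norm norm_minus_commute)
      then have "R\<^sup>2 < (norm (x - a))\<^sup>2" using assms(1) by (intro power_strict_mono) auto
      then have "R\<^sup>2 < (x - a) \<bullet> (x - a) + \<delta>" using \<delta> by (simp add: power2_norm_eq_inner)
      then have "(R\<^sup>2) powr q < ((x - a) \<bullet> (x - a) + \<delta>) powr q" using q by (intro powr_less_mono2) auto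
      moreover have "(R\<^sup>2) powr q = R powr (2 * q)"
        using assms(1) by (simp add: powr_powr flip: powr_numeral)
      ultimately have "c * R powr (2 * q) < c * ((x - a) \<bullet> (x - a) + \<delta>) powr q" using c by simp
      moreover have "c * R powr (2 * q) = A"
        using assms(1) by (simp add: c_def mult.assoc flip: powr_add)
      ultimately show "A < c * ((x - a) \<bullet> (x - a) + \<delta>) powr q" by simp
    qed
  qed
  obtain E :: "'a set" where E: "countable E" "\<And>X. open X \<Longrightarrow> X \<noteq> {} \<Longrightarrow> \<exists>d\<in>E. d \<in> X"
    using countable_dense_exists by auto
  \<comment> \<open>Countably many centres and parameters leave a single exceptional null
    set.\<close>
  have "AE x in lborel. \<forall>a\<in>E \<inter> ball 0 R. \<forall>n. x \<in> S \<longrightarrow> u1 x \<le> c * ((x - a) \<bullet> (x - a) + rad n) powr q"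
    using E(1) key rad_pos by (intro AE_ball_countable' AE_all_countable[THEN iffD2] allI) auto
  then have "AE x in lborel. x \<in> ball 0 R \<longrightarrow> u1 x = 0"
  proof eventually_elim
    case (elim x)
    show ?case
    proof
      assume x: "x \<in> ball 0 R"
      then have xS: "x \<in> S" using assms(1) by (simp add: S_def)
      \<comment> \<open>The same \<open>rad n\<close> bounds the distance to the centre and serves
        as \<open>\<delta>\<close>; since \<open>rad n \<le> 1\<close>, the squared distance is also
        at most \<open>rad n\<close>.\<close>
      have le: "u1 x \<le> c * (2 * rad n) powr q" for n
      proof -
        have "x \<in> ball x (rad n) \<inter> ball 0 R" using x rad_pos[of n] by simp
        then have "\<exists>a\<in>E. a \<in> ball x (rad n) \<inter> ball 0 R" by (intro E(2)) blast+
        then obtain a where a: "a \<in> E" "a \<in> ball x (rad n)" "a \<in> ball 0 R" by blast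
        have "norm (x - a) \<le> rad n" using a(2) by (simp add: dist_norm)
        then have "norm (x - a) * norm (x - a) \<le> 1 * rad n"
          using rad_le_1[of n] by (intro mult_mono) auto
        then have "(x - a) \<bullet> (x - a) + rad n \<le> 2 * rad n"
          by (simp add: power2_eq_square flip: power2_norm_eq_inner)
        then have "c * ((x - a) \<bullet> (x - a) + rad n) powr q \<le> c * (2 * rad n) powr q"
          using c q rad_pos[of n] by (intro mult_left_mono powr_mono2) auto
        then show ?thesis using elim a xS by (meson IntI order_trans)
      qed
      \<comment> \<open>A positive exponent makes \<open>powr\<close> continuous from the right at
        base 0, where its value is 0.\<close>
      have "(\<lambda>n. c * (2 * rad n) powr q) \<longlonglongrightarrow> c * (2 * 0) powr q"
        using q less_imp_le[OF rad_pos]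
        by (intro tendsto_intros tendsto_powr' rad_tendsto) (auto intro: always_eventually)
      then have "u1 x \<le> c * (2 * 0) powr q"
        by (rule LIMSEQ_le_const) (use le in blast)
      then show "u1 x = 0" using assms(5) by (auto simp: u1_def)
    qed
  qed
  moreover have "AE x in lborel. x \<in> S \<longrightarrow> u x = u1 x"
    using aeu1 by (simp add: AE_lebesgue_on_iff[OF S(1)])
  ultimately have "AE x in lborel. x \<in> ball 0 R \<longrightarrow> u x = 0"
    by eventually_elim (use assms(1) in \<open>auto simp: S_def\<close>)
  then show ?thesis by (simp add: AE_lebesgue_on_iff)
qed

end
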